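(* Let $n\ge2$, $1\le k\le n$, and let $\Omega\subseteq\mathbb{R}^n$ be a bounded, strictly $(k-1)$-convex domain with $\partial\Omega\in C^{3,1}$. Let $f:(0,\infty)\to\mathbb{R}$ satisfy: $(\mathbf{f_1})$ $f\in C^1(0,\infty)$, $f>0$ and $f$ is nondecreasing on $(0,\infty)$; $(\mathbf{f_2})$ with $F(\tau)=\int_0^\tau f(s)\,ds$ and $H(\tau)=((k+1)F(\tau))^{1/(k+1)}$, the integral $\Phi(s)=\int_s^\infty\frac{d\tau}{H(\tau)}$ is finite for every $s>0$; $(\mathbf{f_3})$ there is $C_f>0$ with $\lim_{s\to\infty}H'(s)\int_s^\infty\frac{d\tau}{H(\tau)}=C_f$. Let $b$ satisfy: $(\mathbf{b_1})$ $b\in C^{1,1}(\overline\Omega)$ is positive in $\Omega$; $(\mathbf{b_2})$ there exist $\delta_0>0$, a positive nondecreasing function $m\in C^1(0,\delta_0)$ and positive constants $\underline b,\overline b$ with $$\underline b=\liminf_{x\in\Omega,\ d(x)\to0}\frac{b(x)}{m^{k+1}(d(x))}\le\limsup_{x\in\Omega,\ d(x)\to0}\frac{b(x)}{m^{k+1}(d(x))}=\overline b,$$ where $M(t)=\int_0^t m(s)\,ds<\infty$ for $0<t<\delta_0$, and there is $C_m\in[0,\infty)$ with $\lim_{t\to0^+}\big(M(t)/m(t)\big)'=C_m$. Assume $C_f>1-C_m$. Then every viscosity solution $u$ of $S_k(D^2u)=b(x)f(u)$ in $\Omega$, $u=\infty$ on $\partial\Omega$, satisfies $$1\le\liminf_{x\in\Omega,\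 d(x)\to0}\frac{u(x)}{\varphi(\overline\xi M(d(x)))}\quad\text{and}\quad\limsup_{x\in\Omega,\ d(x)\to0}\frac{u(x)}{\varphi(\underline\xi M(d(x)))}\le1,$$ where $$\underline\xi=\left(\frac{\underline b}{L_0(1-C_f^{-1}(1-C_m))}\right)^{1/(k+1)},\qquad \overline\xi=\left(\frac{\overline b}{l_0(1-C_f^{-1}(1-C_m))}\right)^{1/(k+1)}.$$
   Context: $d(x)=\operatorname{dist}(x,\partial\Omega)$. For a symmetric matrix $A$ with eigenvalues $\lambda$, $S_k(A)=\sigma_k(\lambda)$, the $k$-th elementary symmetric function ($\sigma_0=1$). $\Gamma_k=\{\lambda\in\mathbb{R}^n:\sigma_j(\lambda)>0,\ j=1,\dots,k\}$; a $C^2$ function is $k$-admissible if the eigenvalues of its Hessian lie in $\Gamma_k$ everywhere. For $\bar x\in\partial\Omega$, $\rho(\bar x)=(\rho_1(\bar x),\dots,\rho_{n-1}(\bar x))$ are the principal curvatures of $\partial\Omega$ relative to the interior normal; $\Omega$ is strictly $(k-1)$-convex if $\sigma_j(\rho(\bar x))>0$ for $j=1,\dots,k-1$ and all $\bar x\in\partial\Omega$. $L_0=\max_{\bar x\in\partial\Omega}\sigma_{k-1}(\rho(\bar x))$ and $l_0=\min_{\bar x\in\partial\Omega}\sigma_{k-1}(\rho(\bar x))$. The function $\varphi$ is the inverse of $\Phi$, i.e. $\int_{\varphi(t)}^\infty\frac{d\tau}{H(\tau)}=t$ for all $t>0$. A function $u\in C(\Omega)$ is a viscosity subsolution (resp.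 supersolution) of $S_k(D^2u)=b(x)f(u)$ if whenever $x_0\in\Omega$, $A$ is an open neighborhood of $x_0$, $\psi\in C^2(A)$ is $k$-admissible and $u-\psi$ has a local maximum (resp. minimum) at $x_0$, then $S_k(D^2\psi(x_0))\ge b(x_0)f(\psi(x_0))$ (resp. $\le$); a viscosity solution is both. The condition $u=\infty$ on $\partial\Omega$ means $u(x)\to+\infty$ as $d(x)\to0^+$. *)

theory Defs
  imports "HOL-Analysis.Analysis"
begin

definition sigma :: "nat \<Rightarrow> real^'n \<Rightarrow> real" where
  "sigma j lam = (\<Sum>I\<in>{I::'n set. card I = j}. \<Prod>i\<in>I. lam $ i)"

definition diagm :: "real^'n \<Rightarrow> real^'n^'n" where
  "diagm lam = (\<chi> i j. if i = j then lam $ i else 0)"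

definition eigvals :: "real^'n^'n \<Rightarrow> real^'n" where
  "eigvals A = (SOME lam. \<exists>Q. orthogonal_matrix Q \<and> A = Q ** diagm lam ** transpose Q)"

definition Sk :: "nat \<Rightarrow> real^'n^'n \<Rightarrow> real" where
  "Sk j A = sigma j (eigvals A)"

definition Gamma :: "nat \<Rightarrow> (real^'n) set" where
  "Gamma k = {lam. \<forall>j\<in>{1..k}. sigma j lam > 0}"

definition partial :: "'n \<Rightarrow> (real^'n \<Rightarrow> real) \<Rightarrow> real^'n \<Rightarrow> real" where
  "partial i g x = frechet_derivative g (at x) (axis i 1)"

fun pds :: "'n list \<Rightarrow> (real^'n \<Rightarrow> real) \<Rightarrow> real^'n \<Rightarrow> real" where
  "pds [] g = g"
| "pds (i # is) g = partial i (pds is g)"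

definition Ck_on :: "nat \<Rightarrow> (real^'n) set \<Rightarrow> (real^'n \<Rightarrow> real) \<Rightarrow> bool" where
  "Ck_on k S g \<longleftrightarrow>
     (\<forall>is. length is \<le> k \<longrightarrow> continuous_on S (pds is g)) \<and>
     (\<forall>is. length is < k \<longrightarrow> (\<forall>x\<in>S. pds is g differentiable at x))"

definition Ckl_on :: "nat \<Rightarrow> (real^'n) set \<Rightarrow> (real^'n \<Rightarrow> real) \<Rightarrow> bool" where
  "Ckl_on k S g \<longleftrightarrow> Ck_on k S g \<and>
     (\<forall>is. length is = k \<longrightarrow> (\<exists>L. L-lipschitz_on S (pds is g)))"

definition C11_closure :: "(real^'n) set \<Rightarrow> (real^'n \<Rightarrow> real) \<Rightarrow> bool" where
  "C11_closure \<Omega> g \<longleftrightarrow> continuous_on (closure \<Omega>) g \<and> Ckl_on 1 \<Omega> g"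

definition hess :: "(real^'n \<Rightarrow> real) \<Rightarrow> real^'n \<Rightarrow> real^'n^'n" where
  "hess g x = (\<chi> i j. pds [i, j] g x)"

text \<open>Local graph representation of the boundary near xb: in the rotated coordinates
  x = xb + Q y, Omega is locally {y_{i0} > phi(y')} where phi does not depend on y_{i0},
  phi(0)=0, D phi(0)=0.  The principal curvatures (w.r.t. the interior normal) are the
  eigenvalues of D^2 phi(0) on the hyperplane y_{i0}=0; the full n x n Hessian has in
  addition the eigenvalue 0, which does not change sigma_j.\<close>
definition boundary_chart ::
  "(real^'n) set \<Rightarrow> real^'n \<Rightarrow> real^'n^'n \<Rightarrow> 'n \<Rightarrow> (real^'n \<Rightarrow> real) \<Rightarrow> real \<Rightarrow> bool" where
  "boundary_chart \<Omega> xb Q i0 \<phi> r \<longleftrightarrow>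
     orthogonal_matrix Q \<and> 0 < r \<and> \<phi> 0 = 0 \<and> (\<forall>i. partial i \<phi> 0 = 0) \<and>
     (\<forall>y. \<phi> y = \<phi> (y - (y $ i0) *\<^sub>R axis i0 1)) \<and>
     Ck_on 2 (ball 0 r) \<phi> \<and>
     (\<forall>y\<in>ball 0 r. (xb + Q *v y \<in> \<Omega>) \<longleftrightarrow> \<phi> y < y $ i0)"

definition C31_boundary :: "(real^'n) set \<Rightarrow> bool" where
  "C31_boundary \<Omega> \<longleftrightarrow> (\<forall>xb\<in>frontier \<Omega>. \<exists>Q i0 \<phi> r.
      boundary_chart \<Omega> xb Q i0 \<phi> r \<and> Ckl_on 3 (ball 0 r) \<phi>)"

definition curv_sigma :: "(real^'n) set \<Rightarrow> nat \<Rightarrow> real^'n \<Rightarrow> real" where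
  "curv_sigma \<Omega> j xb =
     (let \<phi> = (SOME \<phi>. \<exists>Q i0 r. boundary_chart \<Omega> xb Q i0 \<phi> r) in Sk j (hess \<phi> 0))"

definition strictly_convex_k :: "nat \<Rightarrow> (real^'n) set \<Rightarrow> bool" where
  "strictly_convex_k j \<Omega> \<longleftrightarrow> (\<forall>xb\<in>frontier \<Omega>. \<forall>i\<in>{1..j}. curv_sigma \<Omega> i xb > 0)"

definition L0 :: "nat \<Rightarrow> (real^'n) set \<Rightarrow> real" where
  "L0 k \<Omega> = (SUP xb\<in>frontier \<Omega>. curv_sigma \<Omega> (k - 1) xb)"

definition l0 :: "nat \<Rightarrow> (real^'n) set \<Rightarrow> real" where
  "l0 k \<Omega> = (INF xb\<in>frontier \<Omega>. curv_sigma \<Omega> (k - 1) xb)"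

definition dist_bd :: "(real^'n) set \<Rightarrow> real^'n \<Rightarrow> real" where
  "dist_bd \<Omega> x = infdist x (frontier \<Omega>)"

definition bd_filter :: "(real^'n) set \<Rightarrow> (real^'n) filter" where
  "bd_filter \<Omega> = inf (principal \<Omega>) (filtercomap (dist_bd \<Omega>) (at_right 0))"

definition Fint :: "(real \<Rightarrow> real) \<Rightarrow> real \<Rightarrow> real" where
  "Fint f \<tau> = integral {0..\<tau>} f"

definition Hf :: "nat \<Rightarrow> (real \<Rightarrow> real) \<Rightarrow> real \<Rightarrow> real" where
  "Hf k f \<tau> = (real (k + 1) * Fint f \<tau>) powr (1 / real (k + 1))"

definition Phi :: "nat \<Rightarrow> (real \<Rightarrow> real) \<Rightarrow> real \<Rightarrow> real" where
  "Phi k f s = integral {s..} (\<lambda>\<tau>. 1 / Hf k f \<tau>)"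

definition varphi :: "nat \<Rightarrow> (real \<Rightarrow> real) \<Rightarrow> real \<Rightarrow> real" where
  "varphi k f t = (THE s. 0 < s \<and> Phi k f s = t)"

definition k_admissible_on :: "nat \<Rightarrow> (real^'n) set \<Rightarrow> (real^'n \<Rightarrow> real) \<Rightarrow> bool" where
  "k_admissible_on k A \<psi> \<longleftrightarrow> Ck_on 2 A \<psi> \<and> (\<forall>x\<in>A. eigvals (hess \<psi> x) \<in> Gamma k)"

definition visc_sub ::
  "nat \<Rightarrow> (real^'n \<Rightarrow> real) \<Rightarrow> (real \<Rightarrow> real) \<Rightarrow> (real^'n) set \<Rightarrow> (real^'n \<Rightarrow> real) \<Rightarrow> bool" where
  "visc_sub k b f \<Omega> u \<longleftrightarrow> continuous_on \<Omega> u \<and>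
     (\<forall>x0\<in>\<Omega>. \<forall>A \<psi>. open A \<and> x0 \<in> A \<and> A \<subseteq> \<Omega> \<and> k_admissible_on k A \<psi> \<and> \<psi> x0 = u x0 \<and>
        (\<exists>e>0. \<forall>y\<in>A \<inter> ball x0 e. u y - \<psi> y \<le> u x0 - \<psi> x0)
        \<longrightarrow> Sk k (hess \<psi> x0) \<ge> b x0 * f (\<psi> x0))"

definition visc_super ::
  "nat \<Rightarrow> (real^'n \<Rightarrow> real) \<Rightarrow> (real \<Rightarrow> real) \<Rightarrow> (real^'n) set \<Rightarrow> (real^'n \<Rightarrow> real) \<Rightarrow> bool" where
  "visc_super k b f \<Omega> u \<longleftrightarrow> continuous_on \<Omega> u \<and>
     (\<forall>x0\<in>\<Omega>. \<forall>A \<psi>. open A \<and> x0 \<in> A \<and> A \<subseteq> \<Omega> \<and> k_admissible_on k A \<psi> \<and> \<psi> x0 = u x0 \<and>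
        (\<exists>e>0. \<forall>y\<in>A \<inter> ball x0 e. u y - \<psi> y \<ge> u x0 - \<psi> x0)
        \<longrightarrow> Sk k (hess \<psi> x0) \<le> b x0 * f (\<psi> x0))"

definition visc_sol ::
  "nat \<Rightarrow> (real^'n \<Rightarrow> real) \<Rightarrow> (real \<Rightarrow> real) \<Rightarrow> (real^'n) set \<Rightarrow> (real^'n \<Rightarrow> real) \<Rightarrow> bool" where
  "visc_sol k b f \<Omega> u \<longleftrightarrow> visc_sub k b f \<Omega> u \<and> visc_super k b f \<Omega> u"

end

theory Submission
  imports Defs
begin

text \<open>
  Let \<open>d\<close> be the distance to the boundary and \<open>\<rho>\<close> the principal curvatures. Since
  \<open>\<phi>' = - H(\<phi>)\<close>, the Hessian of \<open>\<phi>(\<xi> M(d))\<close> at a point with nearest boundary point \<open>p\<close> is the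
  second fundamental form at \<open>p\<close>, scaled by the slope of \<open>\<phi>(\<xi> M)\<close>, plus a rank-one matrix in the
  normal direction. The determinant of \<open>1 + t A\<close> splits off the rank-one part, which dominates by
  the two limit conditions on \<open>H\<close> and \<open>M / m\<close>, and so \<open>S\<^sub>k\<close> of the Hessian is asymptotic to
  \<open>\<xi>\<^bsup>k+1\<^esup> (1 - (1 - C\<^sub>m) / C\<^sub>f) \<sigma>\<^bsub>k-1\<^esub>(\<rho>(p)) m(d)\<^bsup>k+1\<^esup> f(\<phi>(\<xi> M(d)))\<close>. For \<open>\<xi>\<close> slightly below the
  lower critical value the shifted functions \<open>\<phi>(\<xi> M(d - \<sigma>))\<close> are therefore strict supersolutions
  near the boundary, for \<open>\<xi>\<close> slightly above the upper one \<open>\<phi>(\<xi> M(d + \<sigma>))\<close> are strict subsolutions,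
  and comparison with \<open>u\<close> gives both bounds up to additive constants as \<open>\<sigma> \<rightarrow> 0\<close>. The constants
  disappear in the quotient because \<open>\<phi>\<close> blows up, and nearby values of \<open>\<xi>\<close> may be exchanged because
  \<open>t\<^bsup>C\<^sub>f + 1\<^esup> \<phi>(t)\<close> is nondecreasing near \<open>0\<close>.

  No differentiability of \<open>d\<close> is used: comparison only needs a second order semijet of the barrier
  at a touching point. With \<open>C\<close> the second fundamental form at \<open>p\<close>, the superjet of \<open>d\<close> contains
  the Hessian \<open>- C\<close>, and near the boundary its subjet contains \<open>- C - \<eta> T\<close> for every \<open>\<eta> > 0\<close>, where
  \<open>T\<close> is the tangential projection.
\<close>

section \<open>Symmetric matrices\<close>

lemma inner_matrix_vector_left: "(A *v x) \<bullet> y = x \<bullet> (transpose A *v y)" for A :: "real^'n^'m"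
  by (metis dot_lmul_matrix transpose_matrix_vector transpose_transpose)

lemma inner_symmetric_matrix:
  fixes A :: "real^'n^'n"
  assumes "transpose A = A"
  shows "(A *v x) \<bullet> y = x \<bullet> (A *v y)"
  by (simp add: inner_matrix_vector_left assms del: transpose_matrix_vector)

lemma transpose_add: "transpose (A + B) = transpose A + transpose (B :: 'a::semiring_1^'n^'m)"
  by (simp add: transpose_def vec_eq_iff)

lemma transpose_diff: "transpose (A - B) = transpose A - transpose (B :: 'a::ring_1^'n^'m)"
  by (simp add: transpose_def vec_eq_iff)

lemma transpose_uminus: "transpose (- A) = - transpose (A :: 'a::ring_1^'n^'m)"
  by (simp add: transpose_def vec_eq_iff)

lemma matrix_vector_mult_uminus: "(- A) *v x = - (A *v x)" for A :: "real^'n^'m"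
  using matrix_vector_mult_diff_rdistrib[of 0 A x] by simp

lemma matrix_add_rdistrib: "(A + B) ** C = A ** C + B ** (C :: 'a::semiring_1^'m^'k)"
  by (simp add: matrix_matrix_mult_def vec_eq_iff sum.distrib algebra_simps)

lemma symmetric_matrix_eqI:
  fixes A B :: "real^'n^'n"
  assumes "transpose A = A" "transpose B = B" "\<And>v. v \<bullet> (A *v v) = v \<bullet> (B *v v)"
  shows "A = B"
proof -
  have polarization: "(u + v) \<bullet> (M *v (u + v)) = u \<bullet> (M *v u) + v \<bullet> (M *v v) + 2 * (u \<bullet> (M *v v))"
    if "transpose M = M" for M :: "real^'n^'n" and u v
    using inner_symmetric_matrix[OF that, of u v]
    by (simp add: matrix_vector_right_distrib inner_add inner_commute)
  have "u \<bullet> (A *v v) = u \<bullet> (B *v v)" for u v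
    using polarization[OF assms(1), of u v] polarization[OF assms(2), of u v]
    by (simp add: assms(3))
  then have "A *v v = B *v v" for v by (metis vector_eq_ldot)
  then show ?thesis by (simp add: matrix_eq)
qed

lemma norm_matrix_vector_mult_le: "norm (A *v x) \<le> norm A * norm x" for A :: "real^'n^'m"
proof -
  have "norm (A *v x) = L2_set (\<lambda>i. \<bar>A $ i \<bullet> x\<bar>) UNIV"
    by (simp add: norm_vec_def matrix_vector_mult_def inner_vec_def)
  also have "\<dots> \<le> L2_set (\<lambda>i. norm (A $ i) * norm x) UNIV"
    by (intro L2_set_mono Cauchy_Schwarz_ineq2) auto
  also have "\<dots> = norm A * norm x"
    by (simp add: norm_vec_def[of A] L2_set_left_distrib)
  finally show ?thesis .
qed

lemma abs_bilinear_form_le: "\<bar>u \<bullet> (A *v v)\<bar> \<le> norm A * norm u * norm v" for A :: "real^'n^'m"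
proof -
  have "\<bar>u \<bullet> (A *v v)\<bar> \<le> norm u * norm (A *v v)" by (rule Cauchy_Schwarz_ineq2)
  also have "\<dots> \<le> norm u * (norm A * norm v)"
    by (intro mult_left_mono norm_matrix_vector_mult_le) simp
  finally show ?thesis by (simp add: mult_ac)
qed

lemma linear_coefficient_eq_0:
  fixes a b :: real
  assumes "\<And>t. 0 \<le> t * a + t\<^sup>2 * b"
  shows "a = 0"
proof (rule ccontr)
  assume "a \<noteq> 0"
  define c where "c = \<bar>b\<bar> + 1"
  have "c > 0" "b < c" by (simp_all add: c_def)
  then have "(- a / c) * a + (- a / c)\<^sup>2 * b = (a / c)\<^sup>2 * (b - c)"
    by (simp add: power2_eq_square field_simps)
  also have "\<dots> < 0" using \<open>a \<noteq> 0\<close> \<open>c > 0\<close> \<open>b < c\<close> by (simp add: mult_less_0_iff)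
  finally show False using assms[of "- a / c"] by linarith
qed

lemma selfadjoint_eigenvector_exists:
  fixes T :: "'a::euclidean_space \<Rightarrow> 'a"
  assumes T: "linear T" and selfadjoint: "\<And>x y. T x \<bullet> y = x \<bullet> T y"
    and S: "subspace S" "S \<noteq> {0}" and invariant: "\<And>x. x \<in> S \<Longrightarrow> T x \<in> S"
  obtains x c where "x \<in> S" "norm x = 1" "T x = c *\<^sub>R x"
proof -
  let ?K = "S \<inter> sphere 0 1"
  have "compact ?K" by (simp add: S(1) closed_subspace closed_Int_compact)
  moreover obtain z where "z \<in> S" "z \<noteq> 0" using S subspace_0 by blast
  then have "z /\<^sub>R norm z \<in> ?K" using S(1) by (simp add: subspace_scale)
  then have "?K \<noteq> {}" by blast
  moreover have "continuous_on ?K (\<lambda>x. x \<bullet> T x)"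
    using T by (intro continuous_intros linear_continuous_on) (simp add: linear_conv_bounded_linear)
  ultimately obtain x where x: "x \<in> ?K" and maximal: "\<And>y. y \<in> ?K \<Longrightarrow> y \<bullet> T y \<le> x \<bullet> T x"
    using continuous_attains_sup[of ?K "\<lambda>x. x \<bullet> T x"] by blast
  define c where "c = x \<bullet> T x"
  have xx: "x \<bullet> x = 1" using x by (simp add: norm_eq_1)
  have rayleigh: "0 \<le> c * (y \<bullet> y) - y \<bullet> T y" if "y \<in> S" for y
  proof (cases "y = 0")
    case False
    then have "y /\<^sub>R norm y \<in> ?K" using that S(1) by (simp add: subspace_scale)
    from maximal[OF this] have "(y \<bullet> T y) / (norm y)\<^sup>2 \<le> c"
      by (simp add: c_def linear_cmul[OF T] field_simps power2_eq_square)
    then show ?thesis using False by (simp add: field_simps power2_norm_eq_inner)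
  qed simp
  define v where "v = T x - c *\<^sub>R x"
  have "v \<in> S" unfolding v_def using x invariant S(1) by (simp add: subspace_diff subspace_scale)
  have "0 \<le> t * (- 2 * (v \<bullet> v)) + t\<^sup>2 * (c * (v \<bullet> v) - v \<bullet> T v)" for t
  proof -
    have "x \<bullet> T v = v \<bullet> v + c * (x \<bullet> v)"
      using selfadjoint[of x v] by (simp add: v_def inner_diff inner_commute algebra_simps)
    moreover have "x \<bullet> v = 0" using xx by (simp add: v_def inner_diff c_def)
    moreover have "v \<bullet> T x = x \<bullet> T v" using selfadjoint[of x v] by (simp add: inner_commute)
    moreover have "x + t *\<^sub>R v \<in> S" using x \<open>v \<in> S\<close> S(1) by (simp add: subspace_add subspace_scale)
    note rayleigh[OF this]
    ultimately show ?thesis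
      by (simp add: linear_add[OF T] linear_cmul[OF T] inner_add xx inner_commute[of v x]
        c_def[symmetric] power2_eq_square algebra_simps)
  qed
  from linear_coefficient_eq_0[OF this] have "v = 0" by simp
  then show ?thesis using that[of x c] x by (simp add: v_def)
qed

lemma span_insert_orthogonal_complement:
  fixes x :: "'a::real_inner"
  assumes S: "subspace S" and x: "x \<in> S" "norm x = 1" and B: "span B = {y \<in> S. x \<bullet> y = 0}"
  shows "span (insert x B) = S"
proof
  have "B \<subseteq> S" using span_superset[of B] B by auto
  then show "span (insert x B) \<subseteq> S" using x(1) S by (intro span_minimal) auto
  show "S \<subseteq> span (insert x B)"
  proof
    fix y assume "y \<in> S"
    then have "y - (x \<bullet> y) *\<^sub>R x \<in> span B"
      unfolding B using x S by (simp add: subspace_diff subspace_scale inner_diff norm_eq_1)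
    then show "y \<in> span (insert x B)" by (auto simp: span_insert)
  qed
qed

lemma selfadjoint_orthonormal_eigenbasis:
  fixes T :: "'a::euclidean_space \<Rightarrow> 'a"
  assumes T: "linear T" and selfadjoint: "\<And>x y. T x \<bullet> y = x \<bullet> T y"
    and "subspace S" "\<And>x. x \<in> S \<Longrightarrow> T x \<in> S"
  shows "\<exists>B. pairwise orthogonal B \<and> span B = S \<and> (\<forall>x\<in>B. norm x = 1 \<and> (\<exists>c. T x = c *\<^sub>R x))"
  using assms(3,4)
proof (induction "dim S" arbitrary: S rule: less_induct)
  case less
  show ?case
  proof (cases "S = {0}")
    case True
    then show ?thesis by (intro exI[of _ "{}"]) simp
  next
    case False
    then obtain x c where x: "x \<in> S" "norm x = 1" "T x = c *\<^sub>R x"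
      using selfadjoint_eigenvector_exists[OF T selfadjoint less.prems(1) _ less.prems(2)] by metis
    define S' where "S' = {y \<in> S. x \<bullet> y = 0}"
    have subspace': "subspace S'"
      using less.prems(1) by (auto simp: S'_def subspace_def inner_add)
    have "S' \<subseteq> S" "x \<notin> S'" using x(2) by (auto simp: S'_def norm_eq_1)
    then have "S' \<subset> S" using x(1) by blast
    then have "dim S' < dim S"
      using less.prems(1) subspace' by (metis dim_psubset span_eq_iff)
    moreover have "T y \<in> S'" if "y \<in> S'" for y
      using that less.prems(2) selfadjoint[of x y] by (simp add: S'_def x(3))
    ultimately obtain B where B: "pairwise orthogonal B" "span B = S'"
        "\<forall>y\<in>B. norm y = 1 \<and> (\<exists>c. T y = c *\<^sub>R y)"
      using less.hyps[OF _ subspace'] by blast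
    have "B \<subseteq> S'" using B(2) span_superset by blast
    then have "pairwise orthogonal (insert x B)"
      using B(1) by (auto simp: pairwise_insert orthogonal_def S'_def inner_commute)
    moreover have "span (insert x B) = S"
      using span_insert_orthogonal_complement[OF less.prems(1) x(1,2)] B(2) by (simp add: S'_def)
    ultimately show ?thesis using B(3) x by (intro exI[of _ "insert x B"]) auto
  qed
qed

theorem symmetric_matrix_diagonalizable:
  fixes A :: "real^'n^'n"
  assumes "transpose A = A"
  obtains Q lam where "orthogonal_matrix Q" "A = Q ** diagm lam ** transpose Q"
proof -
  obtain B where eigenbasis: "pairwise orthogonal B" "span B = (UNIV :: (real^'n) set)"
      "\<forall>x\<in>B. norm x = 1 \<and> (\<exists>c. A *v x = c *\<^sub>R x)"
    using selfadjoint_orthonormal_eigenbasis[of "(*v) A" UNIV] inner_symmetric_matrix[OF assms]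
    by (metis UNIV_I matrix_vector_mul_linear subspace_UNIV)
  have "0 \<notin> B" using eigenbasis(3) by force
  then have "independent B" using eigenbasis(1) by (rule pairwise_orthogonal_independent[rotated])
  then have "finite B" "card B = CARD('n)"
    using eigenbasis(2) finiteI_independent dim_eq_card[of B UNIV] by (auto simp: dim_UNIV)
  then obtain \<beta> where \<beta>: "bij_betw \<beta> (UNIV :: 'n set) B"
    using finite_same_card_bij[of "UNIV :: 'n set" B] by auto
  then have in_B: "\<beta> j \<in> B" for j by (auto simp: bij_betw_def)
  then have "\<forall>j. \<exists>c. A *v \<beta> j = c *\<^sub>R \<beta> j" using eigenbasis(3) by blast
  from choice[OF this] obtain c where eigenvalue: "\<And>j. A *v \<beta> j = c j *\<^sub>R \<beta> j" by blast
  define Q where "Q = (\<chi> i j. \<beta> j $ i)"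
  have column_Q: "column j Q = \<beta> j" for j by (simp add: Q_def column_def)
  have "norm (\<beta> j) = 1" for j using eigenbasis(3) in_B[of j] by blast
  moreover have "orthogonal (\<beta> i) (\<beta> j)" if "i \<noteq> j" for i j
  proof -
    have "\<beta> i \<noteq> \<beta> j" using \<beta> that by (auto simp: bij_betw_def inj_on_def)
    then show ?thesis using eigenbasis(1) in_B[of i] in_B[of j] by (simp add: pairwise_def)
  qed
  ultimately have orthogonal: "orthogonal_matrix Q"
    by (simp add: orthogonal_matrix_orthonormal_columns column_Q)
  have "(A ** Q) $ i $ j = (Q ** diagm (vec_lambda c)) $ i $ j" for i j
  proof -
    have "(A ** Q) $ i $ j = (A *v \<beta> j) $ i"
      by (simp add: matrix_matrix_mult_def matrix_vector_mult_def Q_def)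
    also have "\<dots> = c j * \<beta> j $ i" by (simp add: eigenvalue)
    also have "\<dots> = (Q ** diagm (vec_lambda c)) $ i $ j"
      by (simp add: matrix_matrix_mult_def Q_def diagm_def if_distrib cong: if_cong)
    finally show ?thesis .
  qed
  then have "A ** Q = Q ** diagm (vec_lambda c)" by (simp add: vec_eq_iff)
  moreover have "Q ** transpose Q = mat 1" using orthogonal by (simp add: orthogonal_matrix_def)
  ultimately have "A = Q ** diagm (vec_lambda c) ** transpose Q"
    by (metis matrix_mul_assoc matrix_mul_rid)
  with orthogonal show ?thesis by (rule that)
qed

section \<open>Elementary symmetric functions of matrices\<close>

definition linear_pencil :: "real^'n^'n \<Rightarrow> real poly^'n^'n" where
  "linear_pencil A = (\<chi> i j. [:if i = j then 1 else 0, A $ i $ j:])"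

text \<open>Unlike \<open>Sk\<close>, which goes through a choice of eigenvalues, the coefficients of
  \<open>det (1 + t A)\<close> depend polynomially on \<open>A\<close>.\<close>

definition sigma_matrix :: "nat \<Rightarrow> real^'n^'n \<Rightarrow> real" where
  "sigma_matrix j A = coeff (det (linear_pencil A)) j"

lemma poly_det_linear_pencil: "poly (det (linear_pencil A)) t = det (mat 1 + t *\<^sub>R A)"
proof -
  have "poly (of_int (sign p)) t = of_int (sign p)" for p :: "'n \<Rightarrow> 'n"
    by (simp add: sign_def)
  then show ?thesis
    by (simp add: det_def poly_sum poly_prod linear_pencil_def mat_def)
qed

lemma sigma_matrix_eqI:
  assumes "\<And>t. det (mat 1 + t *\<^sub>R A) = poly p t"
  shows "sigma_matrix j A = coeff p j"
proof -
  have "det (linear_pencil A) = p"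
    using assms by (simp add: poly_eq_poly_eq_iff[symmetric] fun_eq_iff poly_det_linear_pencil)
  then show ?thesis by (simp add: sigma_matrix_def)
qed

lemma sigma_matrix_0 [simp]: "sigma_matrix 0 A = 1"
proof -
  have "sigma_matrix 0 A = poly (det (linear_pencil A)) 0"
    by (simp add: sigma_matrix_def poly_0_coeff_0)
  then show ?thesis by (simp add: poly_det_linear_pencil)
qed

lemma sigma_matrix_scaleR: "sigma_matrix j (c *\<^sub>R A) = c ^ j * sigma_matrix j A"
proof -
  have "det (mat 1 + t *\<^sub>R c *\<^sub>R A) = poly (pcompose (det (linear_pencil A)) [:0, c:]) t" for t
    by (simp add: poly_pcompose poly_det_linear_pencil)
  then have "sigma_matrix j (c *\<^sub>R A) = coeff (pcompose (det (linear_pencil A)) [:0, c:]) j"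
    by (rule sigma_matrix_eqI)
  then show ?thesis by (simp only: coeff_pcompose_linear sigma_matrix_def)
qed

lemma continuous_on_coeff_prod_linear:
  fixes c d :: "'i \<Rightarrow> 'a::topological_space \<Rightarrow> real"
  assumes "finite I" "\<And>i. i \<in> I \<Longrightarrow> continuous_on X (c i)" "\<And>i. i \<in> I \<Longrightarrow> continuous_on X (d i)"
  shows "continuous_on X (\<lambda>x. coeff (\<Prod>i\<in>I. [:c i x, d i x:]) j)"
  using assms
proof (induction I arbitrary: j rule: finite_induct)
  case empty
  then show ?case by (simp add: continuous_on_const)
next
  case (insert a I)
  have "continuous_on X (\<lambda>x. c a x * coeff (\<Prod>i\<in>I. [:c i x, d i x:]) j +
      coeff (pCons 0 (smult (d a x) (\<Prod>i\<in>I. [:c i x, d i x:]))) j)"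
    using insert by (cases j) (auto intro!: continuous_intros)
  then show ?case using insert by (simp add: mult.commute)
qed

lemma continuous_on_sigma_matrix: "continuous_on X (sigma_matrix j)"
proof -
  have coeff_sign: "coeff (of_int (sign p) * q) j = of_int (sign p) * coeff q j"
    for p :: "'n \<Rightarrow> 'n" and q :: "real poly"
    by (simp add: sign_def)
  show ?thesis
    unfolding sigma_matrix_def[abs_def] det_def coeff_sum coeff_sign linear_pencil_def vec_lambda_beta
    by (intro continuous_intros continuous_on_coeff_prod_linear) auto
qed

lemma tendsto_sigma_matrix [tendsto_intros]:
  assumes "(A \<longlongrightarrow> B) F"
  shows "((\<lambda>x. sigma_matrix j (A x)) \<longlongrightarrow> sigma_matrix j B) F"
  using continuous_on_sigma_matrix[of UNIV j] assms
  by (auto simp: continuous_on_eq_continuous_at intro: isCont_tendsto_compose)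

lemma det_orthogonal_conjugate:
  fixes A :: "real^'n^'n"
  assumes "orthogonal_matrix Q"
  shows "det (mat 1 + t *\<^sub>R (Q ** A ** transpose Q)) = det (mat 1 + t *\<^sub>R A)"
proof -
  have "Q ** transpose Q = mat 1" using assms by (simp add: orthogonal_matrix_def)
  then have "mat 1 + t *\<^sub>R (Q ** A ** transpose Q) = Q ** (mat 1 + t *\<^sub>R A) ** transpose Q"
    by (simp add: matrix_add_ldistrib matrix_add_rdistrib matrix_scalar_ac scalar_matrix_assoc)
  moreover have "det Q * det (transpose Q) = 1"
    by (metis \<open>Q ** transpose Q = mat 1\<close> det_I det_mul)
  ultimately show ?thesis by (simp add: det_mul)
qed

lemma sigma_matrix_orthogonal_conjugate:
  assumes "orthogonal_matrix Q"
  shows "sigma_matrix j (Q ** A ** transpose Q) = sigma_matrix j A"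
  by (subst sigma_matrix_eqI[of _ "det (linear_pencil A)"])
    (simp_all add: det_orthogonal_conjugate[OF assms] poly_det_linear_pencil sigma_matrix_def)

lemma sigma_matrix_diagm: "sigma_matrix j (diagm lam) = sigma j lam"
proof -
  define p where "p = (\<Prod>i\<in>UNIV. [:1, lam $ i:])"
  have "det (mat 1 + t *\<^sub>R diagm lam) = poly p t" for t
    by (subst det_diagonal) (auto simp: mat_def diagm_def p_def poly_prod)
  then have "sigma_matrix j (diagm lam) = coeff p j" by (rule sigma_matrix_eqI)
  also have "p = (\<Sum>I\<in>Pow UNIV. (\<Prod>i\<in>I. monom (lam $ i) 1) * (\<Prod>i\<in>UNIV-I. 1))"
    unfolding p_def by (subst prod_add[symmetric]) (auto simp: monom_altdef one_pCons)
  also have "\<dots> = (\<Sum>I\<in>Pow UNIV. monom (\<Prod>i\<in>I. lam $ i) (card I))"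
  proof -
    have "(\<Prod>i\<in>I. monom (lam $ i) 1) = monom (\<Prod>i\<in>I. lam $ i) (card I)" if "finite I" for I
      using that by (induction I rule: finite_induct) (auto simp: mult_monom)
    then show ?thesis by simp
  qed
  also have "coeff \<dots> j = (\<Sum>I\<in>Pow UNIV. if card I = j then (\<Prod>i\<in>I. lam $ i) else 0)"
    by (simp add: coeff_sum)
  also have "\<dots> = sigma j lam"
    unfolding sigma_def by (subst sum.inter_filter[symmetric]) auto
  finally show ?thesis .
qed

lemma Sk_eq_sigma_matrix:
  assumes "transpose A = A"
  shows "Sk j A = sigma_matrix j A"
proof -
  have "\<exists>lam Q. orthogonal_matrix Q \<and> A = Q ** diagm lam ** transpose Q"
    using symmetric_matrix_diagonalizable[OF assms] by metis
  then have "\<exists>Q. orthogonal_matrix Q \<and> A = Q ** diagm (eigvals A) ** transpose Q"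
    unfolding eigvals_def by (rule someI_ex)
  then show ?thesis
    unfolding Sk_def by (metis sigma_matrix_orthogonal_conjugate sigma_matrix_diagm)
qed

definition outer :: "real^'n \<Rightarrow> real^'n^'n" where
  "outer v = (\<chi> i j. v $ i * v $ j)"

lemma outer_mult_vec: "outer v *v x = (v \<bullet> x) *\<^sub>R v"
  by (simp add: outer_def matrix_vector_mult_def vec_eq_iff inner_vec_def
    sum_distrib_left sum_distrib_right mult_ac)

lemma transpose_outer [simp]: "transpose (outer v) = outer v"
  by (simp add: outer_def transpose_def vec_eq_iff mult.commute)

lemma outer_scaleR: "outer (c *\<^sub>R v) = c\<^sup>2 *\<^sub>R outer v"
  by (simp add: outer_def vec_eq_iff power2_eq_square)

lemma outer_matrix_vector_mult: "outer (A *v v) = A ** outer v ** transpose A" for A :: "real^'n^'n"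
proof -
  have "outer (A *v v) *v x = A ** outer v ** transpose A *v x" for x
    by (simp add: outer_mult_vec inner_matrix_vector_left matrix_vector_mul_assoc[symmetric]
      matrix_vector_mult_scaleR del: transpose_matrix_vector)
  then show ?thesis by (simp add: matrix_eq)
qed

lemma det_one_plus_outer:
  fixes v :: "real^'n"
  shows "det (mat 1 + s *\<^sub>R outer v) = 1 + s * (norm v)\<^sup>2"
proof (cases "v = 0")
  case True
  have "outer (0 :: real^'n) = 0" by (simp add: outer_def vec_eq_iff)
  with True show ?thesis by simp
next
  case False
  define k :: 'n where "k = undefined"
  define e :: "real^'n" where "e = axis k 1"
  have "norm (v /\<^sub>R norm v) = 1" using False by simp
  then obtain Q where Q: "orthogonal_matrix Q" "Q *v e = v /\<^sub>R norm v"
    unfolding e_def using orthogonal_matrix_exists_basis by metis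
  have "v = norm v *\<^sub>R (Q *v e)" using False Q(2) by simp
  then have "outer v = (norm v)\<^sup>2 *\<^sub>R (Q ** outer e ** transpose Q)"
    by (metis outer_scaleR outer_matrix_vector_mult)
  then have "det (mat 1 + s *\<^sub>R outer v) = det (mat 1 + (s * (norm v)\<^sup>2) *\<^sub>R outer e)"
    using det_orthogonal_conjugate[OF Q(1)] by simp
  also have "outer e = diagm e"
    by (auto simp: e_def outer_def diagm_def axis_def vec_eq_iff)
  also have "det (mat 1 + (s * (norm v)\<^sup>2) *\<^sub>R diagm e) = (\<Prod>i\<in>UNIV. 1 + s * (norm v)\<^sup>2 * e $ i)"
    by (subst det_diagonal) (auto simp: mat_def diagm_def)
  also have "\<dots> = (\<Prod>i\<in>UNIV. if i = k then 1 + s * (norm v)\<^sup>2 else 1)"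
    by (rule prod.cong) (auto simp: e_def axis_def)
  also have "\<dots> = 1 + s * (norm v)\<^sup>2" by (simp add: prod.delta)
  finally show ?thesis .
qed

lemma sigma_matrix_Suc_outer_plus:
  fixes v :: "real^'n"
  assumes "B *v v = 0"
  shows "sigma_matrix (Suc j) (a *\<^sub>R outer v + B)
    = sigma_matrix (Suc j) B + a * (norm v)\<^sup>2 * sigma_matrix j B"
proof -
  have "(B ** outer v) *v x = 0 *v x" for x
    by (simp add: matrix_vector_mul_assoc[symmetric] outer_mult_vec matrix_vector_mult_scaleR assms)
  then have B_outer: "B ** outer v = 0" by (simp add: matrix_eq)
  let ?p = "[:1, a * (norm v)\<^sup>2:] * det (linear_pencil B)"
  have "det (mat 1 + t *\<^sub>R (a *\<^sub>R outer v + B)) = poly ?p t" for t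
  proof -
    have "mat 1 + t *\<^sub>R (a *\<^sub>R outer v + B) = (mat 1 + t *\<^sub>R B) ** (mat 1 + (t * a) *\<^sub>R outer v)"
      by (simp add: matrix_add_ldistrib matrix_add_rdistrib B_outer matrix_scalar_ac
        scalar_matrix_assoc[symmetric] scaleR_add_right)
    then show ?thesis by (simp add: det_mul det_one_plus_outer poly_det_linear_pencil algebra_simps)
  qed
  then have "sigma_matrix (Suc j) (a *\<^sub>R outer v + B) = coeff ?p (Suc j)" by (rule sigma_matrix_eqI)
  then show ?thesis by (simp add: sigma_matrix_def algebra_simps)
qed

definition tangent_proj :: "real^'n \<Rightarrow> real^'n^'n" where
  "tangent_proj v = mat 1 - outer v"

lemma tangent_proj_mult_vec: "tangent_proj v *v x = x - (v \<bullet> x) *\<^sub>R v"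
  by (simp add: tangent_proj_def matrix_vector_mult_diff_rdistrib outer_mult_vec)

lemma transpose_tangent_proj [simp]: "transpose (tangent_proj v) = tangent_proj v"
  by (simp add: tangent_proj_def transpose_diff)

section \<open>Second order Taylor expansions\<close>

lemma has_real_derivative_along_line:
  fixes g :: "'a::real_normed_vector \<Rightarrow> real"
  assumes "(g has_derivative g') (at (z + s *\<^sub>R v))"
  shows "((\<lambda>s. g (z + s *\<^sub>R v)) has_real_derivative g' v) (at s)"
proof -
  have "((\<lambda>s. z + s *\<^sub>R v) has_derivative (\<lambda>h. h *\<^sub>R v)) (at s)"
    by (auto intro!: derivative_eq_intros)
  from has_derivative_compose[OF this assms]
  have "((\<lambda>s. g (z + s *\<^sub>R v)) has_derivative (\<lambda>h. g' (h *\<^sub>R v))) (at s)" .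
  moreover have "(\<lambda>h. g' (h *\<^sub>R v)) = (*) (g' v)"
    using linear_cmul[OF has_derivative_linear[OF assms]] by (auto simp: mult.commute)
  ultimately show ?thesis by (simp add: has_field_derivative_def)
qed

lemma onorm_inner_le: "onorm (\<lambda>k. v \<bullet> k) \<le> norm v"
  by (rule onorm_bound) (auto simp: Cauchy_Schwarz_ineq2)

lemma isCont_tendsto_nhds: "isCont f x \<Longrightarrow> (f \<longlongrightarrow> f x) (nhds x)"
  using tendsto_at_iff_tendsto_nhds[of f x] by (simp add: isCont_def)

lemma has_derivative_second_order_remainder:
  fixes g :: "'a::real_inner \<Rightarrow> real"
  assumes "(g has_derivative (\<lambda>k. p \<bullet> k)) (at (x + h))" "bounded_linear D"
    and selfadjoint: "\<And>h k. D h \<bullet> k = h \<bullet> D k"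
  shows "((\<lambda>h. g (x + h) - q \<bullet> h - (h \<bullet> D h) / 2) has_derivative (\<lambda>k. (p - q - D h) \<bullet> k)) (at h)"
proof -
  have "((\<lambda>h. x + h) has_derivative (\<lambda>k. k)) (at h)"
    by (auto intro!: derivative_eq_intros)
  from has_derivative_compose[OF this assms(1)]
  have "((\<lambda>h. g (x + h)) has_derivative (\<lambda>k. p \<bullet> k)) (at h)" .
  moreover note D = bounded_linear.has_derivative[OF assms(2) has_derivative_ident]
  ultimately have "((\<lambda>h. g (x + h) - q \<bullet> h - (h \<bullet> D h) / 2) has_derivative
      (\<lambda>k. p \<bullet> k - q \<bullet> k - (h \<bullet> D k + k \<bullet> D h) / 2)) (at h)"
    by (auto intro!: derivative_eq_intros D)
  moreover have "h \<bullet> D k = D h \<bullet> k" for k by (simp add: selfadjoint)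
  ultimately show ?thesis by (simp add: inner_diff inner_commute)
qed

lemma second_order_taylor:
  fixes g :: "'a::real_inner \<Rightarrow> real"
  assumes U: "open U" "x \<in> U"
    and gradient: "\<And>y. y \<in> U \<Longrightarrow> (g has_derivative (\<lambda>h. G y \<bullet> h)) (at y)"
    and hessian: "(G has_derivative D) (at x)" and selfadjoint: "\<And>h k. D h \<bullet> k = h \<bullet> D k"
    and "e > 0"
  shows "\<forall>\<^sub>F h in nhds 0. \<bar>g (x + h) - g x - G x \<bullet> h - (h \<bullet> D h) / 2\<bar> \<le> e * (norm h)\<^sup>2"
proof -
  obtain r where r: "r > 0"
      "\<And>y. norm (y - x) < r \<Longrightarrow> norm (G y - G x - D (y - x)) \<le> e * norm (y - x)"
    using hessian \<open>e > 0\<close> unfolding has_derivative_at_alt by blast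
  obtain s where s: "s > 0" "ball x s \<subseteq> U" using U open_contains_ball by blast
  define R where "R h = g (x + h) - G x \<bullet> h - (h \<bullet> D h) / 2" for h
  have R_deriv: "(R has_derivative (\<lambda>k. (G (x + h) - G x - D h) \<bullet> k)) (at h)" if "norm h < s" for h
  proof -
    have "x + h \<in> U" using that s(2) by (auto simp: dist_norm)
    from has_derivative_second_order_remainder[OF gradient[OF this]
        has_derivative_bounded_linear[OF hessian] selfadjoint]
    show ?thesis unfolding R_def .
  qed
  have "\<bar>R h - R 0\<bar> \<le> e * (norm h)\<^sup>2" if h: "norm h < min r s" for h
  proof -
    have "norm (R h - R 0) \<le> (e * norm h) * norm (h - 0)"
    proof (rule differentiable_bound)
      fix k :: 'a assume "k \<in> cball 0 (norm h)"
      then have k: "norm k \<le> norm h" by simp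
      then show "(R has_derivative (\<lambda>l. (G (x + k) - G x - D k) \<bullet> l)) (at k within cball 0 (norm h))"
        using h by (intro has_derivative_at_withinI[OF R_deriv]) simp
      have "norm (G (x + k) - G x - D k) \<le> e * norm k" using r(2)[of "x + k"] k h by simp
      also have "\<dots> \<le> e * norm h" using k \<open>e > 0\<close> by simp
      finally show "onorm (\<lambda>l. (G (x + k) - G x - D k) \<bullet> l) \<le> e * norm h"
        by (rule order_trans[OF onorm_inner_le])
    qed auto
    then show ?thesis by (simp add: power2_eq_square mult.assoc)
  qed
  moreover have "R h - R 0 = g (x + h) - g x - G x \<bullet> h - (h \<bullet> D h) / 2" for h
    by (simp add: R_def linear_0[OF has_derivative_linear[OF hessian]])
  moreover have "min r s > 0" using r s by simp
  ultimately show ?thesis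
    unfolding eventually_nhds_metric dist_norm by (metis diff_zero)
qed

definition C2_on ::
  "(real^'n) set \<Rightarrow> (real^'n \<Rightarrow> real) \<Rightarrow> (real^'n \<Rightarrow> real^'n) \<Rightarrow> (real^'n \<Rightarrow> real^'n^'n) \<Rightarrow> bool" where
  "C2_on U g G D \<longleftrightarrow> open U \<and>
     (\<forall>x\<in>U. (g has_derivative (\<lambda>h. G x \<bullet> h)) (at x)) \<and>
     (\<forall>x\<in>U. (G has_derivative (\<lambda>h. D x *v h)) (at x)) \<and>
     continuous_on U D \<and> (\<forall>x\<in>U. transpose (D x) = D x)"

lemma C2_onD:
  assumes "C2_on U g G D"
  shows "open U" "x \<in> U \<Longrightarrow> (g has_derivative (\<lambda>h. G x \<bullet> h)) (at x)"
    "x \<in> U \<Longrightarrow> (G has_derivative (\<lambda>h. D x *v h)) (at x)"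
    "continuous_on U D" "x \<in> U \<Longrightarrow> transpose (D x) = D x"
  using assms by (auto simp: C2_on_def)

lemma C2_on_continuous:
  assumes "C2_on U g G D"
  shows "continuous_on U g" "continuous_on U G"
  using C2_onD(2,3)[OF assms]
  by (meson continuous_at_imp_continuous_on has_derivative_continuous)+

lemma C2_on_taylor:
  assumes "C2_on U g G D" "x \<in> U" "e > 0"
  shows "\<forall>\<^sub>F h in nhds 0.
    \<bar>g (x + h) - g x - G x \<bullet> h - (h \<bullet> (D x *v h)) / 2\<bar> \<le> e * (norm h)\<^sup>2"
  using C2_onD[OF assms(1)] assms(2,3)
  by (intro second_order_taylor[of U]) (auto simp: inner_symmetric_matrix)

lemma quadratic_remainder_along_parabola:
  fixes R :: "'a::real_normed_vector \<Rightarrow> real"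
  assumes "\<And>e. e > 0 \<Longrightarrow> \<forall>\<^sub>F h in nhds 0. \<bar>R h\<bar> \<le> e * (norm h)\<^sup>2"
  shows "((\<lambda>t. R (t *\<^sub>R v + t\<^sup>2 *\<^sub>R a) / t\<^sup>2) \<longlongrightarrow> 0) (at 0)"
proof (rule tendstoI)
  fix e :: real assume "e > 0"
  let ?q = "\<lambda>t. t *\<^sub>R v + t\<^sup>2 *\<^sub>R a"
  define W where "W = (norm v + norm a)\<^sup>2 + 1"
  have "W > 0" by (simp add: W_def add_nonneg_pos)
  with \<open>e > 0\<close> have "e / W > 0" by simp
  have "(?q \<longlongrightarrow> 0) (at 0)" by (auto intro!: tendsto_eq_intros)
  from eventually_compose_filterlim[OF assms[OF \<open>e / W > 0\<close>] this]
  have "\<forall>\<^sub>F t in at 0. \<bar>R (?q t)\<bar> \<le> e / W * (norm (?q t))\<^sup>2" .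
  moreover have "\<forall>\<^sub>F t in at (0 :: real). \<bar>t\<bar> < 1"
    by (auto simp: eventually_at dist_real_def intro: exI[of _ 1])
  moreover have "\<forall>\<^sub>F t in at (0 :: real). t \<noteq> 0" by (simp add: eventually_at_filter)
  ultimately show "\<forall>\<^sub>F t in at 0. dist (R (?q t) / t\<^sup>2) 0 < e"
  proof eventually_elim
    case (elim t)
    have "norm (?q t) \<le> norm (t *\<^sub>R v) + norm (t\<^sup>2 *\<^sub>R a)" by (rule norm_triangle_ineq)
    also have "\<dots> \<le> \<bar>t\<bar> * (norm v + norm a)"
      using elim(2) mult_right_mono[of "\<bar>t\<bar>" 1 "\<bar>t\<bar> * norm a"]
      by (simp add: power2_eq_square algebra_simps abs_mult)
    finally have "(norm (?q t))\<^sup>2 \<le> t\<^sup>2 * (norm v + norm a)\<^sup>2"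
      using power_mono[of "norm (?q t)" "\<bar>t\<bar> * (norm v + norm a)" 2]
      by (simp add: power_mult_distrib)
    also have "\<dots> < t\<^sup>2 * W" using elim(3) by (simp add: W_def)
    finally have "e / W * (norm (?q t))\<^sup>2 < e / W * (t\<^sup>2 * W)"
      using \<open>e / W > 0\<close> by (rule mult_strict_left_mono)
    also have "\<dots> = e * t\<^sup>2" using \<open>W > 0\<close> by simp
    finally have "\<bar>R (?q t)\<bar> < e * t\<^sup>2" using elim(1) by linarith
    then show ?case using elim(3) by (simp add: divide_less_eq)
  qed
qed

lemma C2_on_along_parabola:
  assumes C2: "C2_on U g G D" and x: "x \<in> U" "g x = 0" "G x \<bullet> v = 0"
  shows "((\<lambda>t. g (x + (t *\<^sub>R v + t\<^sup>2 *\<^sub>R a)) / t\<^sup>2) \<longlongrightarrow> G x \<bullet> a + (v \<bullet> (D x *v v)) / 2) (at 0)"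
proof -
  define q where "q t = t *\<^sub>R v + t\<^sup>2 *\<^sub>R a" for t
  define R where "R h = g (x + h) - G x \<bullet> h - (h \<bullet> (D x *v h)) / 2" for h
  define Q where "Q t = G x \<bullet> a + ((v + t *\<^sub>R a) \<bullet> (D x *v (v + t *\<^sub>R a))) / 2" for t
  have "((\<lambda>t. R (q t) / t\<^sup>2) \<longlongrightarrow> 0) (at 0)"
    unfolding q_def using C2_on_taylor[OF C2 x(1)] x(2)
    by (intro quadratic_remainder_along_parabola) (simp add: R_def)
  moreover have "(Q \<longlongrightarrow> G x \<bullet> a + (v \<bullet> (D x *v v)) / 2) (at 0)"
    unfolding Q_def
    by (auto intro!: tendsto_eq_intros bounded_linear.tendsto[OF matrix_vector_mul_bounded_linear])
  ultimately have "((\<lambda>t. R (q t) / t\<^sup>2 + Q t) \<longlongrightarrow> 0 + (G x \<bullet> a + (v \<bullet> (D x *v v)) / 2)) (at 0)"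
    by (rule tendsto_add)
  moreover have "\<forall>\<^sub>F t in at (0 :: real). t \<noteq> 0" by (simp add: eventually_at_filter)
  then have "\<forall>\<^sub>F t in at 0. R (q t) / t\<^sup>2 + Q t = g (x + q t) / t\<^sup>2"
  proof eventually_elim
    case (elim t)
    have q_eq: "q t = t *\<^sub>R (v + t *\<^sub>R a)" by (simp add: q_def power2_eq_square scaleR_add_right)
    have "G x \<bullet> q t = t\<^sup>2 * (G x \<bullet> a)" using x(3) by (simp add: q_def inner_add)
    moreover have "q t \<bullet> (D x *v q t) = t\<^sup>2 * ((v + t *\<^sub>R a) \<bullet> (D x *v (v + t *\<^sub>R a)))"
      unfolding q_eq by (simp add: matrix_vector_mult_scaleR power2_eq_square)
    ultimately show ?case using elim by (simp add: R_def Q_def field_simps)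
  qed
  ultimately show ?thesis unfolding q_def add_0 by (rule Lim_transform_eventually)
qed

lemma lipschitz_gradient_first_order_remainder:
  fixes g :: "'a::real_inner \<Rightarrow> real"
  assumes S: "convex S" and gradient: "\<And>w. w \<in> S \<Longrightarrow> (g has_derivative (\<lambda>h. G w \<bullet> h)) (at w)"
    and lipschitz: "\<And>y w. y \<in> S \<Longrightarrow> w \<in> S \<Longrightarrow> norm (G w - G y) \<le> K * norm (w - y)"
    and "K \<ge> 0" and yz: "y \<in> S" "z \<in> S"
  shows "\<bar>g z - g y - G y \<bullet> (z - y)\<bar> \<le> K * (norm (z - y))\<^sup>2"
proof -
  have segment: "closed_segment y z \<subseteq> S" using S yz by (rule closed_segment_subset[rotated 2])
  have "norm (g z - g y - G y \<bullet> (z - y)) \<le> norm (z - y) * (K * norm (z - y))"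
  proof (rule differentiable_bound_linearization[where S = "closed_segment y z" and ?x0.0 = y])
    show "y + t *\<^sub>R (z - y) \<in> closed_segment y z" if "t \<in> {0..1}" for t
      using that by (auto simp: closed_segment_def algebra_simps intro!: exI[of _ t])
    fix w assume w: "w \<in> closed_segment y z"
    then show "(g has_derivative (\<lambda>h. G w \<bullet> h)) (at w within closed_segment y z)"
      using segment by (intro has_derivative_at_withinI[OF gradient]) blast
    have "norm (G w - G y) \<le> K * norm (w - y)" using w segment yz(1) by (intro lipschitz) auto
    also have "\<dots> \<le> K * norm (z - y)"
      using segment_bound(1)[OF w] \<open>K \<ge> 0\<close> by (intro mult_left_mono)
    finally show "onorm ((\<lambda>h. G w \<bullet> h) - (\<lambda>h. G y \<bullet> h)) \<le> K * norm (z - y)"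
      using order_trans[OF onorm_inner_le] by (simp add: fun_diff_def inner_diff_left[symmetric])
  qed simp
  then show ?thesis by (simp add: power2_eq_square mult_ac)
qed

lemma C2_on_uniform_first_order:
  assumes C2: "C2_on U g G D" and x: "x \<in> U"
  obtains r K where "r > 0" "ball x r \<subseteq> U"
    "\<And>y z. y \<in> ball x r \<Longrightarrow> z \<in> ball x r \<Longrightarrow> \<bar>g z - g y - G y \<bullet> (z - y)\<bar> \<le> K * (norm (z - y))\<^sup>2"
proof -
  note C2 = C2_onD[OF C2]
  define K where "K = norm (D x) + 1"
  have "K \<ge> 0" by (simp add: K_def)
  have "isCont (\<lambda>y. norm (D y)) x"
    using C2(1,4) x by (intro continuous_intros) (simp add: continuous_on_eq_continuous_at)
  from order_tendstoD(2)[OF isCont_tendsto_nhds[OF this]]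
  have "\<forall>\<^sub>F y in nhds x. norm (D y) < K" by (simp add: K_def)
  moreover have "\<forall>\<^sub>F y in nhds x. y \<in> U" using C2(1) x by (rule eventually_nhds_in_open)
  ultimately have "\<forall>\<^sub>F y in nhds x. norm (D y) < K \<and> y \<in> U" by eventually_elim simp
  then obtain r where r: "r > 0" and near: "\<And>y. y \<in> ball x r \<Longrightarrow> norm (D y) < K \<and> y \<in> U"
    unfolding eventually_nhds_metric by (auto simp: dist_commute)
  have lipschitz: "norm (G w - G y) \<le> K * norm (w - y)" if "y \<in> ball x r" "w \<in> ball x r" for y w
  proof (rule differentiable_bound[OF convex_ball _ _ that(2,1)])
    fix w assume w: "w \<in> ball x r"
    then show "(G has_derivative (*v) (D w)) (at w within ball x r)"
      using near by (intro has_derivative_at_withinI[OF C2(3)]) blast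
    show "onorm ((*v) (D w)) \<le> K"
      using near[OF w] norm_matrix_vector_mult_le[of "D w"]
      by (intro onorm_le) (meson less_imp_le mult_right_mono norm_ge_zero order_trans)
  qed
  have "(g has_derivative (\<lambda>h. G w \<bullet> h)) (at w)" if "w \<in> ball x r" for w
    using C2(2) near[OF that] by blast
  from lipschitz_gradient_first_order_remainder[OF convex_ball this lipschitz \<open>K \<ge> 0\<close>] r near
  show ?thesis by (intro that[of r K]) auto
qed

lemma C2_on_diff:
  assumes "C2_on U g G D" "C2_on U g' G' D'"
  shows "C2_on U (\<lambda>x. g x - g' x) (\<lambda>x. G x - G' x) (\<lambda>x. D x - D' x)"
proof -
  note C2 = C2_onD[OF assms(1)] and C2' = C2_onD[OF assms(2)]
  have "((\<lambda>x. g x - g' x) has_derivative (\<lambda>h. (G x - G' x) \<bullet> h)) (at x)" if "x \<in> U" for x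
    using has_derivative_diff[OF C2(2)[OF that] C2'(2)[OF that]] by (simp add: inner_diff_left)
  moreover have "((\<lambda>x. G x - G' x) has_derivative (\<lambda>h. (D x - D' x) *v h)) (at x)" if "x \<in> U" for x
    using has_derivative_diff[OF C2(3)[OF that] C2'(3)[OF that]]
    by (simp add: matrix_vector_mult_diff_rdistrib)
  ultimately show ?thesis
    using C2 C2' by (simp add: C2_on_def transpose_diff continuous_on_diff)
qed

lemma C2_on_quadratic:
  fixes A :: "real^'n^'n"
  assumes "open U" "transpose A = A"
  shows "C2_on U (\<lambda>x. c + p \<bullet> (x - x0) + ((x - x0) \<bullet> (A *v (x - x0))) / 2)
    (\<lambda>x. p + A *v (x - x0)) (\<lambda>_. A)"
proof -
  note A_deriv = bounded_linear.has_derivative[OF matrix_vector_mul_bounded_linear]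
  have "((\<lambda>x. c + p \<bullet> (x - x0) + ((x - x0) \<bullet> (A *v (x - x0))) / 2) has_derivative
      (\<lambda>h. (p + A *v (x - x0)) \<bullet> h)) (at x)" for x
  proof -
    have "((\<lambda>x. c + p \<bullet> (x - x0) + ((x - x0) \<bullet> (A *v (x - x0))) / 2) has_derivative
        (\<lambda>h. p \<bullet> h + (h \<bullet> (A *v (x - x0)) + (x - x0) \<bullet> (A *v h)) / 2)) (at x)"
      by (rule derivative_eq_intros A_deriv refl | simp add: algebra_simps)+
    moreover have "(x - x0) \<bullet> (A *v h) = (A *v (x - x0)) \<bullet> h" for h
      using inner_symmetric_matrix[OF assms(2)] by simp
    ultimately show ?thesis by (simp add: inner_add inner_commute)
  qed
  moreover have "((\<lambda>x. p + A *v (x - x0)) has_derivative (\<lambda>h. A *v h)) (at x)" for x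
    by (auto intro!: derivative_eq_intros A_deriv)
  ultimately show ?thesis using assms by (simp add: C2_on_def continuous_on_const)
qed

lemma continuous_on_matrix_mult [continuous_intros]:
  fixes A :: "'a::topological_space \<Rightarrow> real^'n^'m" and B :: "'a \<Rightarrow> real^'k^'n"
  assumes "continuous_on S A" "continuous_on S B"
  shows "continuous_on S (\<lambda>x. A x ** B x)"
  unfolding matrix_matrix_mult_def using assms by (auto intro!: continuous_intros)

lemma C2_on_affine_compose:
  fixes P :: "real^'n^'n" and p :: "real^'n"
  assumes C2: "C2_on U g G D"
  defines "T \<equiv> \<lambda>x. P *v (x - p)"
  shows "C2_on (T -` U) (\<lambda>x. g (T x)) (\<lambda>x. transpose P *v G (T x))
    (\<lambda>x. transpose P ** D (T x) ** P)"
proof -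
  note C2 = C2_onD[OF C2]
  have T_deriv: "(T has_derivative (\<lambda>h. P *v h)) (at x)" for x
    unfolding T_def
    by (auto intro!: derivative_eq_intros
        bounded_linear.has_derivative[OF matrix_vector_mul_bounded_linear])
  then have T_cont: "continuous_on S T" for S
    by (meson continuous_at_imp_continuous_on has_derivative_continuous)
  have "open (T -` U)" using C2(1) T_cont by (simp add: open_vimage)
  moreover have "((\<lambda>x. g (T x)) has_derivative (\<lambda>h. (transpose P *v G (T x)) \<bullet> h)) (at x)"
    if "x \<in> T -` U" for x
    using has_derivative_compose[OF T_deriv C2(2)[of "T x"]] that
    by (simp add: inner_matrix_vector_left del: transpose_matrix_vector)
  moreover have "((\<lambda>x. transpose P *v G (T x)) has_derivative
      (\<lambda>h. (transpose P ** D (T x) ** P) *v h)) (at x)" if "x \<in> T -` U" for x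
    using bounded_linear.has_derivative[OF matrix_vector_mul_bounded_linear
        has_derivative_compose[OF T_deriv C2(3)[of "T x"]], of "transpose P"] that
    by (simp add: matrix_vector_mul_assoc matrix_mul_assoc del: transpose_matrix_vector)
  moreover have "continuous_on (T -` U) (\<lambda>x. transpose P ** D (T x) ** P)"
    by (intro continuous_intros continuous_on_compose2[OF C2(4) T_cont]) auto
  moreover have "transpose (transpose P ** D (T x) ** P) = transpose P ** D (T x) ** P"
    if "x \<in> T -` U" for x
    using C2(5)[of "T x"] that by (simp add: matrix_transpose_mul matrix_mul_assoc)
  ultimately show ?thesis by (simp add: C2_on_def)
qed

section \<open>Symmetry of second derivatives\<close>

lemma second_difference_mean_value:
  fixes g :: "'a::real_normed_vector \<Rightarrow> real"
  assumes s: "s > 0"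
    and dv: "\<And>a b. a \<in> {0..s} \<Longrightarrow> b \<in> {0..s} \<Longrightarrow>
      ((\<lambda>a. g (x + a *\<^sub>R v + b *\<^sub>R w)) has_real_derivative g' (x + a *\<^sub>R v + b *\<^sub>R w)) (at a)"
    and dw: "\<And>a b. a \<in> {0..s} \<Longrightarrow> b \<in> {0..s} \<Longrightarrow>
      ((\<lambda>b. g' (x + a *\<^sub>R v + b *\<^sub>R w)) has_real_derivative g'' (x + a *\<^sub>R v + b *\<^sub>R w)) (at b)"
  shows "\<exists>a\<in>{0..s}. \<exists>b\<in>{0..s}. g (x + s *\<^sub>R v + s *\<^sub>R w) - g (x + s *\<^sub>R v) - g (x + s *\<^sub>R w) + g x
    = s\<^sup>2 * g'' (x + a *\<^sub>R v + b *\<^sub>R w)"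
proof -
  define p where "p a = g (x + a *\<^sub>R v + s *\<^sub>R w) - g (x + a *\<^sub>R v + 0 *\<^sub>R w)" for a
  have "\<exists>a>0. a < s \<and> p s - p 0
      = (s - 0) * (g' (x + a *\<^sub>R v + s *\<^sub>R w) - g' (x + a *\<^sub>R v + 0 *\<^sub>R w))"
    unfolding p_def using s by (intro MVT2 DERIV_diff dv) auto
  then obtain a where a: "0 < a" "a < s"
    "p s - p 0 = s * (g' (x + a *\<^sub>R v + s *\<^sub>R w) - g' (x + a *\<^sub>R v + 0 *\<^sub>R w))" by auto
  have "\<exists>b>0. b < s \<and> g' (x + a *\<^sub>R v + s *\<^sub>R w) - g' (x + a *\<^sub>R v + 0 *\<^sub>R w)
      = (s - 0) * g'' (x + a *\<^sub>R v + b *\<^sub>R w)"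
    using s a by (intro MVT2 dw) auto
  then obtain b where b: "0 < b" "b < s" "g' (x + a *\<^sub>R v + s *\<^sub>R w) - g' (x + a *\<^sub>R v + 0 *\<^sub>R w)
      = s * g'' (x + a *\<^sub>R v + b *\<^sub>R w)" by auto
  have "g (x + s *\<^sub>R v + s *\<^sub>R w) - g (x + s *\<^sub>R v) - g (x + s *\<^sub>R w) + g x = p s - p 0"
    by (simp add: p_def)
  also have "\<dots> = s\<^sup>2 * g'' (x + a *\<^sub>R v + b *\<^sub>R w)"
    by (simp only: a(3) b(3) power2_eq_square mult.assoc)
  finally show ?thesis using a b by (intro bexI[of _ a] bexI[of _ b]) auto
qed

lemma small_parallelogram:
  fixes x v w :: "'a::real_normed_vector"
  assumes "r > 0"
  obtains c where "c > 0" "\<And>a b s. a \<in> {0..s} \<Longrightarrow> b \<in> {0..s} \<Longrightarrow> s < c \<Longrightarrow>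
    dist (x + a *\<^sub>R v + b *\<^sub>R w) x < r"
proof
  let ?c = "r / (norm v + norm w + 1)"
  have pos: "norm v + norm w + 1 > 0" by (simp add: add_nonneg_pos)
  then show "?c > 0" using assms by simp
  show "dist (x + a *\<^sub>R v + b *\<^sub>R w) x < r" if "a \<in> {0..s}" "b \<in> {0..s}" "s < ?c" for a b s
  proof -
    have "dist (x + a *\<^sub>R v + b *\<^sub>R w) x = norm (a *\<^sub>R v + b *\<^sub>R w)"
      by (simp add: dist_norm add.assoc)
    also have "\<dots> \<le> a * norm v + b * norm w"
      using norm_triangle_ineq[of "a *\<^sub>R v" "b *\<^sub>R w"] that by simp
    also have "\<dots> \<le> ?c * norm v + ?c * norm w"
      using that by (intro add_mono mult_right_mono) auto
    also have "\<dots> < ?c * (norm v + norm w + 1)"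
      using \<open>?c > 0\<close> by (simp only: distrib_left mult_1_right)
    also have "\<dots> = r" using pos by simp
    finally show ?thesis .
  qed
qed

lemma second_difference_tendsto:
  fixes g :: "'a::real_normed_vector \<Rightarrow> real"
  assumes S: "open S" "x \<in> S"
    and dv: "\<And>y. y \<in> S \<Longrightarrow> (g has_derivative D y) (at y)"
    and dw: "\<And>y. y \<in> S \<Longrightarrow> ((\<lambda>z. D z v) has_derivative D' y) (at y)"
    and cont: "isCont (\<lambda>y. D' y w) x"
  shows "((\<lambda>s. (g (x + s *\<^sub>R v + s *\<^sub>R w) - g (x + s *\<^sub>R v) - g (x + s *\<^sub>R w) + g x) / s\<^sup>2)
    \<longlongrightarrow> D' x w) (at_right 0)"
proof (rule tendstoI)
  fix e :: real assume "e > 0"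
  have "\<forall>\<^sub>F y in nhds x. dist (D' y w) (D' x w) < e \<and> y \<in> S"
    using \<open>e > 0\<close> S
    by (intro eventually_conj tendstoD isCont_tendsto_nhds cont eventually_nhds_in_open)
  then obtain r where r: "r > 0" "\<And>y. dist y x < r \<Longrightarrow> dist (D' y w) (D' x w) < e \<and> y \<in> S"
    unfolding eventually_nhds_metric by blast
  obtain c where "c > 0" and near: "\<And>a b s. a \<in> {0..s} \<Longrightarrow> b \<in> {0..s} \<Longrightarrow> s < c \<Longrightarrow>
      dist (x + a *\<^sub>R v + b *\<^sub>R w) x < r"
    using small_parallelogram[OF r(1)] by metis
  have "dist ((g (x + s *\<^sub>R v + s *\<^sub>R w) - g (x + s *\<^sub>R v) - g (x + s *\<^sub>R w) + g x) / s\<^sup>2)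
      (D' x w) < e"
    if s: "0 < s" "s < c" for s
  proof -
    have "((\<lambda>a. g (x + a *\<^sub>R v + b *\<^sub>R w)) has_real_derivative D (x + a *\<^sub>R v + b *\<^sub>R w) v) (at a)"
      if "a \<in> {0..s}" "b \<in> {0..s}" for a b
      using has_real_derivative_along_line[of g _ "x + b *\<^sub>R w" a v] dv r(2)[OF near[OF that s(2)]]
      by (simp add: add_ac)
    moreover have "((\<lambda>b. D (x + a *\<^sub>R v + b *\<^sub>R w) v) has_real_derivative
        D' (x + a *\<^sub>R v + b *\<^sub>R w) w) (at b)"
      if "a \<in> {0..s}" "b \<in> {0..s}" for a b
      using has_real_derivative_along_line[OF dw] r(2)[OF near[OF that s(2)]] by blast
    ultimately obtain a b where "a \<in> {0..s}" "b \<in> {0..s}"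
      "g (x + s *\<^sub>R v + s *\<^sub>R w) - g (x + s *\<^sub>R v) - g (x + s *\<^sub>R w) + g x
        = s\<^sup>2 * D' (x + a *\<^sub>R v + b *\<^sub>R w) w"
      using second_difference_mean_value[OF s(1), of g x v w "\<lambda>y. D y v" "\<lambda>y. D' y w"] by blast
    then show ?thesis using r(2)[OF near[OF _ _ s(2)]] s(1) by simp
  qed
  then show "\<forall>\<^sub>F s in at_right 0. dist ((g (x + s *\<^sub>R v + s *\<^sub>R w) - g (x + s *\<^sub>R v)
      - g (x + s *\<^sub>R w) + g x) / s\<^sup>2) (D' x w) < e"
    unfolding eventually_at_right_field using \<open>c > 0\<close> by blast
qed

lemma gradient_has_derivative:
  fixes g :: "real^'n \<Rightarrow> real"
  assumes "g differentiable at x"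
  shows "(g has_derivative (\<lambda>h. (\<chi> i. partial i g x) \<bullet> h)) (at x)"
proof -
  have deriv: "(g has_derivative frechet_derivative g (at x)) (at x)"
    using assms by (simp add: frechet_derivative_works)
  have "frechet_derivative g (at x) h = (\<chi> i. partial i g x) \<bullet> h" for h
  proof -
    have "frechet_derivative g (at x) h = frechet_derivative g (at x) (\<Sum>i\<in>UNIV. h $ i *s axis i 1)"
      by (simp only: basis_expansion)
    also have "\<dots> = (\<Sum>i\<in>UNIV. h $ i * frechet_derivative g (at x) (axis i 1))"
      using has_derivative_linear[OF deriv]
      by (simp add: linear_sum linear_cmul scalar_mult_eq_scaleR)
    finally show ?thesis by (simp add: inner_vec_def partial_def mult.commute)
  qed
  then have "frechet_derivative g (at x) = (\<lambda>h. (\<chi> i. partial i g x) \<bullet> h)" by (rule ext)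
  with deriv show ?thesis by simp
qed

lemma partial_eqI: "(g has_derivative g') (at x) \<Longrightarrow> partial i g x = g' (axis i 1)"
  unfolding partial_def by (simp add: frechet_derivative_at[symmetric])

lemma Ck_on_2D:
  assumes "Ck_on 2 S g"
  shows "x \<in> S \<Longrightarrow> g differentiable at x" "x \<in> S \<Longrightarrow> partial i g differentiable at x"
    "continuous_on S (partial i (partial j g))"
proof -
  have "length is < 2 \<Longrightarrow> x \<in> S \<Longrightarrow> pds is g differentiable at x"
    "length is \<le> 2 \<Longrightarrow> continuous_on S (pds is g)" for "is"
    using assms unfolding Ck_on_def by blast+
  from this(1)[of "[]"] this(1)[of "[i]"] this(2)[of "[i, j]"]
  show "x \<in> S \<Longrightarrow> g differentiable at x" "x \<in> S \<Longrightarrow> partial i g differentiable at x"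
    "continuous_on S (partial i (partial j g))" by simp_all
qed

lemma mixed_partials_commute:
  fixes g :: "real^'n \<Rightarrow> real"
  assumes S: "open S" "x \<in> S" and "Ck_on 2 S g"
  shows "partial j (partial i g) x = partial i (partial j g) x"
proof -
  note Ck = Ck_on_2D[OF assms(3)]
  define \<Delta> where "\<Delta> i j s = g (x + s *\<^sub>R axis i 1 + s *\<^sub>R axis j 1) - g (x + s *\<^sub>R axis i 1)
    - g (x + s *\<^sub>R axis j 1) + g x" for i j :: 'n and s
  have "((\<lambda>s. \<Delta> i j s / s\<^sup>2) \<longlongrightarrow> partial j (partial i g) x) (at_right 0)" for i j
    unfolding \<Delta>_def partial_def[of j]
  proof (rule second_difference_tendsto[OF S, where D = "\<lambda>y. frechet_derivative g (at y)"])
    show "(g has_derivative frechet_derivative g (at y)) (at y)" if "y \<in> S" for y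
      using Ck(1)[OF that] by (simp add: frechet_derivative_works)
    show "((\<lambda>z. frechet_derivative g (at z) (axis i 1)) has_derivative
        frechet_derivative (partial i g) (at y)) (at y)" if "y \<in> S" for y
      using Ck(2)[OF that, of i] by (simp add: frechet_derivative_works partial_def[abs_def])
    show "isCont (\<lambda>y. frechet_derivative (partial i g) (at y) (axis j 1)) x"
      using Ck(3)[of j i] S by (simp add: continuous_on_eq_continuous_at partial_def[abs_def])
  qed
  moreover have "\<Delta> i j = \<Delta> j i" by (auto simp: \<Delta>_def algebra_simps)
  ultimately show ?thesis by (metis tendsto_unique trivial_limit_at_right_real)
qed

lemma Ck_on_2_imp_C2_on:
  assumes S: "open S" and Ck2: "Ck_on 2 S g"
  shows "C2_on S g (\<lambda>x. \<chi> i. partial i g x) (hess g)"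
proof -
  note Ck = Ck_on_2D[OF Ck2]
  have sym: "hess g x $ i $ j = hess g x $ j $ i" if "x \<in> S" for x i j
    using mixed_partials_commute[OF S that Ck2] by (simp add: hess_def)
  have "((\<lambda>x. \<chi> i. partial i g x) has_derivative (\<lambda>h. hess g x *v h)) (at x)" if x: "x \<in> S" for x
  proof -
    have "((\<lambda>x. \<chi> i. partial i g x) has_derivative
        (\<lambda>h. \<chi> i. (\<chi> j. partial j (partial i g) x) \<bullet> h)) (at x)"
      using gradient_has_derivative[OF Ck(2)[OF x]]
      by (subst has_derivative_componentwise_within) (auto simp: Basis_vec_def inner_axis)
    moreover have "(\<lambda>h. \<chi> i. (\<chi> j. partial j (partial i g) x) \<bullet> h) = (\<lambda>h. hess g x *v h)"
      using sym[OF x] by (auto simp: hess_def matrix_vector_mult_def inner_vec_def vec_eq_iff)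
    ultimately show ?thesis by simp
  qed
  moreover have "continuous_on S (hess g)"
    unfolding hess_def using Ck(3) by (intro continuous_on_vec_lambda) simp
  ultimately show ?thesis
    using S gradient_has_derivative[OF Ck(1)] sym by (simp add: C2_on_def transpose_def vec_eq_iff)
qed

lemma
  assumes C2: "C2_on S g G D" and y: "y \<in> S"
  shows C2_on_partial_deriv: "(partial i g has_derivative (\<lambda>h. (D y *v h) $ i)) (at y)"
    and C2_on_partial_partial: "partial j (partial i g) y = D y $ j $ i"
proof -
  show deriv: "(partial i g has_derivative (\<lambda>h. (D y *v h) $ i)) (at y)"
  proof (rule has_derivative_transform_within_open[OF _ C2_onD(1)[OF C2] y])
    show "((\<lambda>z. G z $ i) has_derivative (\<lambda>h. (D y *v h) $ i)) (at y)"
      by (rule bounded_linear.has_derivative[OF bounded_linear_vec_nth C2_onD(3)[OF C2 y]])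
    show "G z $ i = partial i g z" if "z \<in> S" for z
      using partial_eqI[OF C2_onD(2)[OF C2 that]] by (simp add: inner_axis)
  qed
  have "partial j (partial i g) y = (D y *v axis j 1) $ i" by (rule partial_eqI[OF deriv])
  also have "\<dots> = transpose (D y) $ j $ i"
    by (simp add: matrix_vector_mul_component inner_axis transpose_def)
  finally show "partial j (partial i g) y = D y $ j $ i" by (simp add: C2_onD(5)[OF C2 y])
qed

lemma C2_on_hess: "C2_on S g G D \<Longrightarrow> x \<in> S \<Longrightarrow> hess g x = D x"
  by (simp add: hess_def C2_on_partial_partial vec_eq_iff)

lemma C2_on_imp_Ck_on_2:
  assumes C2: "C2_on S g G D"
  shows "Ck_on 2 S g"
proof -
  have short_lists: "is = [] \<or> (\<exists>i. is = [i]) \<or> (\<exists>i j. is = [i, j])"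
      if "length is \<le> 2" for "is" :: "'n list"
    using that by (cases "is" rule: remdups_adj.cases) auto
  have differentiable: "pds is g differentiable at y" if "length is < 2" "y \<in> S" for "is" y
  proof -
    have "is = [] \<or> (\<exists>i. is = [i])" using that(1) short_lists[of "is"] by fastforce
    then show ?thesis
      using differentiableI[OF C2_onD(2)[OF C2 that(2)]]
        differentiableI[OF C2_on_partial_deriv[OF C2 that(2)]] by auto
  qed
  have "continuous_on S (\<lambda>y. D y $ j $ i)" for i j
    by (intro continuous_intros C2_onD(4)[OF C2])
  then have partial2_cont: "continuous_on S (partial j (partial i g))" for i j
    by (simp cong: continuous_on_cong add: C2_on_partial_partial[OF C2])
  have "continuous_on S (pds is g)" if "length is \<le> 2" for "is"
  proof (cases "length is < 2")
    case True
    then show ?thesis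
      by (intro continuous_at_imp_continuous_on ballI
          differentiable_imp_continuous_within differentiable)
  next
    case False
    then show ?thesis using short_lists[OF that] partial2_cont by auto
  qed
  with differentiable show ?thesis unfolding Ck_on_def by blast
qed

section \<open>Second order semijets and viscosity solutions\<close>

definition superjet :: "(real^'n \<Rightarrow> real) \<Rightarrow> real^'n \<Rightarrow> ((real^'n) \<times> (real^'n^'n)) set" where
  "superjet u x = {(p, A). transpose A = A \<and> (\<forall>e>0. \<forall>\<^sub>F h in nhds 0.
     u (x + h) \<le> u x + p \<bullet> h + (h \<bullet> (A *v h)) / 2 + e * (norm h)\<^sup>2)}"

definition subjet :: "(real^'n \<Rightarrow> real) \<Rightarrow> real^'n \<Rightarrow> ((real^'n) \<times> (real^'n^'n)) set" where
  "subjet u x = {(p, A). transpose A = A \<and> (\<forall>e>0. \<forall>\<^sub>F h in nhds 0.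
     u x + p \<bullet> h + (h \<bullet> (A *v h)) / 2 - e * (norm h)\<^sup>2 \<le> u (x + h))}"

lemma superjetI:
  assumes "transpose A = A" "\<And>e. e > 0 \<Longrightarrow> \<forall>\<^sub>F h in nhds 0.
    u (x + h) \<le> u x + p \<bullet> h + (h \<bullet> (A *v h)) / 2 + e * (norm h)\<^sup>2"
  shows "(p, A) \<in> superjet u x"
  using assms by (simp add: superjet_def)

lemma superjetD:
  assumes "(p, A) \<in> superjet u x"
  shows "transpose A = A" "e > 0 \<Longrightarrow> \<forall>\<^sub>F h in nhds 0.
    u (x + h) \<le> u x + p \<bullet> h + (h \<bullet> (A *v h)) / 2 + e * (norm h)\<^sup>2"
  using assms by (auto simp: superjet_def)

lemma subjet_iff_superjet: "(p, A) \<in> subjet u x \<longleftrightarrow> (- p, - A) \<in> superjet (\<lambda>y. - u y) x"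
proof -
  have "- u (x + h) \<le> - u x + - p \<bullet> h + (h \<bullet> (- A *v h)) / 2 + e * (norm h)\<^sup>2 \<longleftrightarrow>
      u x + p \<bullet> h + (h \<bullet> (A *v h)) / 2 - e * (norm h)\<^sup>2 \<le> u (x + h)" for h e
    by (auto simp: matrix_vector_mult_uminus)
  then show ?thesis
    unfolding superjet_def subjet_def
    by (simp only: mem_Collect_eq prod.case transpose_uminus neg_equal_iff_equal)
qed

lemma subjetI:
  assumes "transpose A = A" "\<And>e. e > 0 \<Longrightarrow> \<forall>\<^sub>F h in nhds 0.
    u x + p \<bullet> h + (h \<bullet> (A *v h)) / 2 - e * (norm h)\<^sup>2 \<le> u (x + h)"
  shows "(p, A) \<in> subjet u x"
  using assms by (simp add: subjet_def)

lemma subjetD: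
  assumes "(p, A) \<in> subjet u x"
  shows "transpose A = A" "e > 0 \<Longrightarrow> \<forall>\<^sub>F h in nhds 0.
    u x + p \<bullet> h + (h \<bullet> (A *v h)) / 2 - e * (norm h)\<^sup>2 \<le> u (x + h)"
  using assms by (auto simp: subjet_def)

lemma eventually_nhds_0_shift: "eventually P (nhds x) \<longleftrightarrow> (\<forall>\<^sub>F h in nhds 0. P (x + h))"
  for x :: "'a::real_normed_vector"
  using eventually_filtermap[of P "\<lambda>h. x + h" "nhds 0"]
  by (simp add: filtermap_nhds_shift[of "- x" 0, simplified] add.commute)

lemma
  shows superjet_add_const: "superjet (\<lambda>y. u y + r) x = superjet u x"
    and subjet_add_const: "subjet (\<lambda>y. u y + r) x = subjet u x"
proof -
  have "u (x + h) + r \<le> u x + r + a + b + c \<longleftrightarrow> u (x + h) \<le> u x + a + b + c"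
    "u x + r + a + b - c \<le> u (x + h) + r \<longleftrightarrow> u x + a + b - c \<le> u (x + h)" for a b c h
    by linarith+
  then show "superjet (\<lambda>y. u y + r) x = superjet u x" "subjet (\<lambda>y. u y + r) x = subjet u x"
    by (simp_all only: superjet_def subjet_def)
qed

lemma superjet_local_maximum:
  assumes "(p, A) \<in> superjet v x" "\<forall>\<^sub>F y in nhds x. u y - v y \<le> u x - v x"
  shows "(p, A) \<in> superjet u x"
proof (rule superjetI[OF superjetD(1)[OF assms(1)]])
  fix e :: real assume "e > 0"
  from superjetD(2)[OF assms(1) this] assms(2)[unfolded eventually_nhds_0_shift[of _ x]]
  show "\<forall>\<^sub>F h in nhds 0. u (x + h) \<le> u x + p \<bullet> h + (h \<bullet> (A *v h)) / 2 + e * (norm h)\<^sup>2"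
    by eventually_elim linarith
qed

lemma subjet_local_minimum:
  assumes "(p, A) \<in> subjet v x" "\<forall>\<^sub>F y in nhds x. u x - v x \<le> u y - v y"
  shows "(p, A) \<in> subjet u x"
  unfolding subjet_iff_superjet
proof (rule superjet_local_maximum)
  show "(- p, - A) \<in> superjet (\<lambda>y. - v y) x" using assms(1) by (simp add: subjet_iff_superjet)
  show "\<forall>\<^sub>F y in nhds x. - u y - - v y \<le> - u x - - v x" using assms(2) by eventually_elim simp
qed

lemma
  fixes A :: "real^'n^'n"
  shows quadratic_form_add_mat: "h \<bullet> ((A + c *\<^sub>R mat 1) *v h) = h \<bullet> (A *v h) + c * (norm h)\<^sup>2"
    and quadratic_form_diff_mat: "h \<bullet> ((A - c *\<^sub>R mat 1) *v h) = h \<bullet> (A *v h) - c * (norm h)\<^sup>2"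
  by (simp_all add: matrix_vector_mult_add_rdistrib matrix_vector_mult_diff_rdistrib
    scaleR_matrix_vector_assoc[symmetric] inner_add_right inner_diff_right power2_norm_eq_inner)

lemma taylor_compose_quadratic:
  fixes g g1 :: "real \<Rightarrow> real" and B :: "real^'n^'n"
  assumes V: "open V" "t \<in> V" and g: "\<And>s. s \<in> V \<Longrightarrow> (g has_real_derivative g1 s) (at s)"
    and g1: "(g1 has_real_derivative g2) (at t)" and B: "transpose B = B" and "e > 0"
  shows "\<forall>\<^sub>F h in nhds 0. \<bar>g (t + (p \<bullet> h + (h \<bullet> (B *v h)) / 2)) - g t - (g1 t *\<^sub>R p) \<bullet> h
    - (h \<bullet> ((g2 *\<^sub>R outer p + g1 t *\<^sub>R B) *v h)) / 2\<bar> \<le> e * (norm h)\<^sup>2"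
proof -
  define q where "q h = t + p \<bullet> h + (h \<bullet> (B *v h)) / 2" for h
  define G where "G h = g1 (q h) *\<^sub>R (p + B *v h)" for h
  have C2: "C2_on UNIV q (\<lambda>h. p + B *v h) (\<lambda>_. B)"
    unfolding q_def using C2_on_quadratic[of UNIV B t p 0] B by simp
  have "q 0 = t" by (simp add: q_def)
  have "((\<lambda>h. g (q h)) has_derivative (\<lambda>k. G h \<bullet> k)) (at h)" if "q h \<in> V" for h
    using has_derivative_compose[OF C2_onD(2)[OF C2, of h]
        has_field_derivative_imp_has_derivative[OF g[OF that]]]
    by (simp add: G_def)
  moreover have "(G has_derivative (\<lambda>k. (g2 *\<^sub>R outer p + g1 t *\<^sub>R B) *v k)) (at 0)"
  proof -
    have "((\<lambda>h. g1 (q h)) has_derivative (\<lambda>k. g2 * (p \<bullet> k))) (at 0)"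
      using has_derivative_compose[OF C2_onD(2)[OF C2, of 0], of g1 "(*) g2"] g1
      by (simp add: \<open>q 0 = t\<close> has_field_derivative_def)
    from has_derivative_scaleR[OF this C2_onD(3)[OF C2, of 0]]
    have "(G has_derivative (\<lambda>k. g1 t *\<^sub>R (B *v k) + (g2 * (p \<bullet> k)) *\<^sub>R p)) (at 0)"
      by (simp add: G_def[abs_def] \<open>q 0 = t\<close>)
    then show ?thesis
      by (simp add: matrix_vector_mult_add_rdistrib scaleR_matrix_vector_assoc[symmetric]
        outer_mult_vec add.commute)
  qed
  moreover have "open (q -` V)" using V(1) C2_on_continuous(1)[OF C2] by (simp add: open_vimage)
  moreover have "transpose (g2 *\<^sub>R outer p + g1 t *\<^sub>R B) = g2 *\<^sub>R outer p + g1 t *\<^sub>R B"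
    by (simp add: transpose_add transpose_scalar B)
  ultimately have "\<forall>\<^sub>F h in nhds 0. \<bar>g (q (0 + h)) - g (q 0) - G 0 \<bullet> h
      - (h \<bullet> ((g2 *\<^sub>R outer p + g1 t *\<^sub>R B) *v h)) / 2\<bar> \<le> e * (norm h)\<^sup>2"
    using \<open>e > 0\<close> V(2) \<open>q 0 = t\<close>
    by (intro second_order_taylor[of "q -` V"]) (auto simp: inner_symmetric_matrix)
  then show ?thesis by (simp add: q_def G_def add.assoc)
qed

lemma eventually_quadratic_in_open:
  fixes B :: "real^'n^'n"
  assumes "open V" "t \<in> V"
  shows "\<forall>\<^sub>F h in nhds 0. t + (p \<bullet> h + (h \<bullet> (B *v h)) / 2) \<in> V"
proof -
  have "isCont (\<lambda>h. t + (p \<bullet> h + (h \<bullet> (B *v h)) / 2)) 0"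
    by (intro continuous_intros linear_continuous_at)
      (simp_all add: matrix_vector_mul_bounded_linear)
  then show ?thesis
    by (rule topological_tendstoD[OF isCont_tendsto_nhds assms(1)]) (simp add: assms(2))
qed

lemma superjet_compose_antimono:
  fixes g g1 :: "real \<Rightarrow> real"
  assumes w: "(p, A) \<in> subjet w x" "isCont w x"
    and V: "open V" "w x \<in> V" and g: "\<And>s. s \<in> V \<Longrightarrow> (g has_real_derivative g1 s) (at s)"
    and g1: "(g1 has_real_derivative g2) (at (w x))"
    and anti: "\<And>s s'. s \<in> V \<Longrightarrow> s' \<in> V \<Longrightarrow> s \<le> s' \<Longrightarrow> g s' \<le> g s" and "g1 (w x) \<le> 0"
  shows "(g1 (w x) *\<^sub>R p, g2 *\<^sub>R outer p + g1 (w x) *\<^sub>R A) \<in> superjet (\<lambda>y. g (w y)) x"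
proof (rule superjetI)
  note A = subjetD(1)[OF w(1)]
  show "transpose (g2 *\<^sub>R outer p + g1 (w x) *\<^sub>R A) = g2 *\<^sub>R outer p + g1 (w x) *\<^sub>R A"
    by (simp add: transpose_add transpose_scalar A)
  fix e :: real assume "e > 0"
  define m where "m = \<bar>g1 (w x)\<bar> + 1"
  define c where "c = e / (2 * m)"
  have m_bounds: "m > 0" "- g1 (w x) \<le> m" by (simp_all add: m_def)
  then have "c > 0" using \<open>e > 0\<close> by (simp add: c_def)
  have "- g1 (w x) * c \<le> m * c" using \<open>c > 0\<close> m_bounds(2) by (intro mult_right_mono) auto
  also have "\<dots> = e / 2" using m_bounds(1) by (simp add: c_def)
  finally have slope: "- g1 (w x) * c * (norm h)\<^sup>2 \<le> e / 2 * (norm h)\<^sup>2" for h :: "real^'n"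
    by (rule mult_right_mono) simp
  define B where "B = A - (2 * c) *\<^sub>R mat 1"
  define q where "q h = w x + (p \<bullet> h + (h \<bullet> (B *v h)) / 2)" for h
  have B: "transpose B = B" by (simp add: B_def transpose_diff transpose_scalar A)
  have q_eq: "q h = w x + p \<bullet> h + (h \<bullet> (A *v h)) / 2 - c * (norm h)\<^sup>2" for h
    by (simp add: q_def B_def quadratic_form_diff_mat)
  have "\<forall>\<^sub>F h in nhds 0. q h \<in> V" unfolding q_def by (rule eventually_quadratic_in_open[OF V])
  moreover have "\<forall>\<^sub>F h in nhds 0. w (x + h) \<in> V"
    using topological_tendstoD[OF isCont_tendsto_nhds[OF w(2)] V]
    by (simp add: eventually_nhds_0_shift[of _ x])
  moreover have "\<forall>\<^sub>F h in nhds 0. q h \<le> w (x + h)"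
    unfolding q_eq using subjetD(2)[OF w(1) \<open>c > 0\<close>] .
  moreover have "\<forall>\<^sub>F h in nhds 0. \<bar>g (q h) - g (w x) - (g1 (w x) *\<^sub>R p) \<bullet> h
      - (h \<bullet> ((g2 *\<^sub>R outer p + g1 (w x) *\<^sub>R B) *v h)) / 2\<bar> \<le> e / 2 * (norm h)\<^sup>2"
    unfolding q_def using \<open>e > 0\<close> by (intro taylor_compose_quadratic[OF V g g1 B]) auto
  ultimately show "\<forall>\<^sub>F h in nhds 0. g (w (x + h)) \<le> g (w x) + (g1 (w x) *\<^sub>R p) \<bullet> h
      + (h \<bullet> ((g2 *\<^sub>R outer p + g1 (w x) *\<^sub>R A) *v h)) / 2 + e * (norm h)\<^sup>2"
  proof eventually_elim
    case (elim h)
    have "g2 *\<^sub>R outer p + g1 (w x) *\<^sub>R B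
        = (g2 *\<^sub>R outer p + g1 (w x) *\<^sub>R A) - (2 * (g1 (w x) * c)) *\<^sub>R mat 1"
      by (simp add: B_def scaleR_diff_right)
    then have "h \<bullet> ((g2 *\<^sub>R outer p + g1 (w x) *\<^sub>R B) *v h)
        = h \<bullet> ((g2 *\<^sub>R outer p + g1 (w x) *\<^sub>R A) *v h) - 2 * (g1 (w x) * c) * (norm h)\<^sup>2"
      by (simp only: quadratic_form_diff_mat)
    moreover have "g (w (x + h)) \<le> g (q h)" using elim(1,2,3) by (intro anti)
    ultimately show ?case using elim(4) slope[of h] unfolding abs_le_iff by linarith
  qed
qed

lemma subjet_compose_antimono:
  fixes g g1 :: "real \<Rightarrow> real"
  assumes w: "(p, A) \<in> superjet w x" "isCont w x"
    and V: "open V" "w x \<in> V" and g: "\<And>s. s \<in> V \<Longrightarrow> (g has_real_derivative g1 s) (at s)"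
    and g1: "(g1 has_real_derivative g2) (at (w x))"
    and anti: "\<And>s s'. s \<in> V \<Longrightarrow> s' \<in> V \<Longrightarrow> s \<le> s' \<Longrightarrow> g s' \<le> g s" and "g1 (w x) \<le> 0"
  shows "(g1 (w x) *\<^sub>R p, g2 *\<^sub>R outer p + g1 (w x) *\<^sub>R A) \<in> subjet (\<lambda>y. g (w y)) x"
proof -
  let ?V = "uminus -` V" and ?g = "\<lambda>s. - g (- s)" and ?g1 = "\<lambda>s. g1 (- s)"
  have "(- p, - A) \<in> subjet (\<lambda>y. - w y) x" using w(1) by (simp add: subjet_iff_superjet)
  moreover have "isCont (\<lambda>y. - w y) x" using w(2) by (intro continuous_intros)
  moreover have "open ?V" using V(1) by (intro open_vimage continuous_intros)
  moreover have "(?g has_real_derivative ?g1 s) (at s)" if "s \<in> ?V" for s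
    using DERIV_chain2[OF g[of "- s"] DERIV_minus[OF DERIV_ident]] that
    by (auto intro!: derivative_eq_intros)
  moreover have "(?g1 has_real_derivative - g2) (at (- w x))"
    using DERIV_chain2[OF _ DERIV_minus[OF DERIV_ident], of g1 g2 "- w x"] g1 by simp
  ultimately have "(?g1 (- w x) *\<^sub>R (- p), (- g2) *\<^sub>R outer (- p) + ?g1 (- w x) *\<^sub>R (- A))
      \<in> superjet (\<lambda>y. ?g (- w y)) x"
    using V(2) anti \<open>g1 (w x) \<le> 0\<close> by (intro superjet_compose_antimono[where V = ?V]) auto
  moreover have "outer (- p) = outer p" using outer_scaleR[of "- 1" p] by simp
  ultimately show ?thesis by (simp add: subjet_iff_superjet)
qed

lemma
  fixes B :: "real^'n^'n" and p x :: "real^'n" and c :: real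
  assumes "open \<Omega>" "transpose B = B" "\<And>j. j \<in> {1..k} \<Longrightarrow> sigma_matrix j B > 0"
  defines "\<psi> \<equiv> \<lambda>y. c + p \<bullet> (y - x) + ((y - x) \<bullet> (B *v (y - x))) / 2"
  shows k_admissible_quadratic: "k_admissible_on k \<Omega> \<psi>"
    and Sk_hess_quadratic: "Sk k (hess \<psi> y) = sigma_matrix k B"
proof -
  have hess_eq: "hess \<psi> z = B" for z
    unfolding \<psi>_def using C2_on_hess[OF C2_on_quadratic[OF open_UNIV assms(2)]] by simp
  then show "Sk k (hess \<psi> y) = sigma_matrix k B" using Sk_eq_sigma_matrix[OF assms(2)] by simp
  show "k_admissible_on k \<Omega> \<psi>"
    unfolding k_admissible_on_def Gamma_def hess_eq
    using C2_on_imp_Ck_on_2[OF C2_on_quadratic[OF assms(1,2)]] assms(3) Sk_eq_sigma_matrix[OF assms(2)]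
    by (simp add: \<psi>_def Sk_def)
qed

lemma eventually_sigma_matrix_pos:
  assumes "(A \<longlongrightarrow> B) F" "\<forall>j\<in>{1..k}. sigma_matrix j B > 0"
  shows "\<forall>\<^sub>F t in F. \<forall>j\<in>{1..k}. sigma_matrix j (A t) > 0"
  using assms(2) order_tendstoD(1)[OF tendsto_sigma_matrix[OF assms(1)]]
  by (intro eventually_ball_finite) auto

lemma eventually_touching_paraboloid:
  fixes s :: real and A :: "real^'n^'n"
  assumes \<Omega>: "open \<Omega>" and A: "transpose A = A" "\<forall>j\<in>{1..k}. sigma_matrix j A > 0"
    and s: "s * s = 1" and jet: "\<forall>e>0. \<forall>\<^sub>F h in nhds 0.
      s * (u (x + h) - u x - p \<bullet> h - (h \<bullet> (A *v h)) / 2) \<le> e * (norm h)\<^sup>2"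
  shows "\<forall>\<^sub>F e in at_right 0. \<exists>\<psi>. k_admissible_on k \<Omega> \<psi> \<and> \<psi> x = u x \<and>
    Sk k (hess \<psi> x) = sigma_matrix k (A + (2 * (s * e)) *\<^sub>R mat 1) \<and>
    (\<exists>r>0. \<forall>y\<in>\<Omega> \<inter> ball x r. s * (u y - \<psi> y) \<le> s * (u x - \<psi> x))"
proof -
  have "((\<lambda>e. A + (2 * (s * e)) *\<^sub>R mat 1) \<longlongrightarrow> A) (at_right 0)" by (auto intro!: tendsto_eq_intros)
  from eventually_sigma_matrix_pos[OF this A(2)] eventually_at_right_less[of "0::real"]
  show ?thesis
  proof eventually_elim
    case (elim e)
    define B where "B = A + (2 * (s * e)) *\<^sub>R mat 1"
    define \<psi> where "\<psi> = (\<lambda>y. u x + p \<bullet> (y - x) + ((y - x) \<bullet> (B *v (y - x))) / 2)"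
    have B: "transpose B = B" "\<And>j. j \<in> {1..k} \<Longrightarrow> sigma_matrix j B > 0"
      using elim(1) by (simp_all add: B_def transpose_add transpose_scalar A(1))
    have "k_admissible_on k \<Omega> \<psi>" "Sk k (hess \<psi> x) = sigma_matrix k B"
      unfolding \<psi>_def using k_admissible_quadratic[OF \<Omega> B] Sk_hess_quadratic[OF \<Omega> B] by blast+
    moreover have "\<psi> x = u x" by (simp add: \<psi>_def)
    moreover from jet elim(2) have "\<forall>\<^sub>F h in nhds 0.
      s * (u (x + h) - u x - p \<bullet> h - (h \<bullet> (A *v h)) / 2) \<le> e * (norm h)\<^sup>2" by blast
    then have "\<forall>\<^sub>F y in nhds x. s * (u y - \<psi> y) \<le> s * (u x - \<psi> x)"
      unfolding eventually_nhds_0_shift[of _ x]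
    proof eventually_elim
      case (elim h)
      have "\<psi> (x + h) = u x + p \<bullet> h + (h \<bullet> (A *v h)) / 2 + s * (e * (norm h)\<^sup>2)"
        by (simp add: \<psi>_def B_def quadratic_form_add_mat add_divide_distrib)
      then have "s * (u (x + h) - \<psi> (x + h)) =
          s * (u (x + h) - u x - p \<bullet> h - (h \<bullet> (A *v h)) / 2) - (s * s) * (e * (norm h)\<^sup>2)"
        by (simp only: algebra_simps)
      then show ?case using elim \<open>\<psi> x = u x\<close> s by simp
    qed
    then have "\<exists>r>0. \<forall>y\<in>\<Omega> \<inter> ball x r. s * (u y - \<psi> y) \<le> s * (u x - \<psi> x)"
      unfolding eventually_nhds_metric by (force simp: dist_commute)
    ultimately show ?case unfolding B_def by blast
  qed
qed

lemma visc_sub_superjet: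
  assumes \<Omega>: "open \<Omega>" "x \<in> \<Omega>" and u: "visc_sub k b f \<Omega> u" and jet: "(p, A) \<in> superjet u x"
    and pos: "\<forall>j\<in>{1..k}. sigma_matrix j A > 0"
  shows "b x * f (u x) \<le> sigma_matrix k A"
proof -
  have "\<forall>e>0. \<forall>\<^sub>F h in nhds 0.
      1 * (u (x + h) - u x - p \<bullet> h - (h \<bullet> (A *v h)) / 2) \<le> e * (norm h)\<^sup>2"
    using superjetD(2)[OF jet] by (simp add: algebra_simps)
  from eventually_touching_paraboloid[OF \<Omega>(1) superjetD(1)[OF jet] pos mult_1_right this]
  have "\<forall>\<^sub>F e in at_right 0. b x * f (u x) \<le> sigma_matrix k (A + (2 * (1 * e)) *\<^sub>R mat 1)"
  proof eventually_elim
    case (elim e)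
    then show ?case using u \<Omega> unfolding visc_sub_def mult_1 by (metis order_refl)
  qed
  moreover have "((\<lambda>e. A + (2 * (1 * e)) *\<^sub>R mat 1) \<longlongrightarrow> A) (at_right 0)"
    by (auto intro!: tendsto_eq_intros)
  ultimately show ?thesis by (intro tendsto_lowerbound[OF tendsto_sigma_matrix]) auto
qed

lemma visc_super_subjet:
  assumes \<Omega>: "open \<Omega>" "x \<in> \<Omega>" and u: "visc_super k b f \<Omega> u" and jet: "(p, A) \<in> subjet u x"
    and pos: "\<forall>j\<in>{1..k}. sigma_matrix j A > 0"
  shows "sigma_matrix k A \<le> b x * f (u x)"
proof -
  have jet': "\<forall>e>0. \<forall>\<^sub>F h in nhds 0.
      - 1 * (u (x + h) - u x - p \<bullet> h - (h \<bullet> (A *v h)) / 2) \<le> e * (norm h)\<^sup>2"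
    using subjetD(2)[OF jet] by (simp add: algebra_simps)
  have "(- 1 :: real) * - 1 = 1" by simp
  from eventually_touching_paraboloid[OF \<Omega>(1) subjetD(1)[OF jet] pos this jet']
  have "\<forall>\<^sub>F e in at_right 0. sigma_matrix k (A + (2 * (- 1 * e)) *\<^sub>R mat 1) \<le> b x * f (u x)"
  proof eventually_elim
    case (elim e)
    then show ?case
      using u \<Omega> unfolding visc_super_def mult_minus1 neg_le_iff_le by (metis order_refl)
  qed
  moreover have "((\<lambda>e. A + (2 * (- 1 * e)) *\<^sub>R mat 1) \<longlongrightarrow> A) (at_right 0)"
    by (auto intro!: tendsto_eq_intros)
  ultimately show ?thesis by (intro tendsto_upperbound[OF tendsto_sigma_matrix]) auto
qed

section \<open>Normal and second fundamental form of the boundary\<close>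

definition defining_function ::
  "(real^'n) set \<Rightarrow> (real^'n) set \<Rightarrow> (real^'n \<Rightarrow> real) \<Rightarrow> (real^'n \<Rightarrow> real^'n)
    \<Rightarrow> (real^'n \<Rightarrow> real^'n^'n) \<Rightarrow> bool" where
  "defining_function \<Omega> U g G D \<longleftrightarrow>
     C2_on U g G D \<and> (\<forall>x\<in>U. x \<in> \<Omega> \<longleftrightarrow> g x > 0) \<and> (\<forall>x\<in>U. G x \<noteq> 0)"

definition shape_matrix :: "real^'n \<Rightarrow> real^'n^'n \<Rightarrow> real^'n^'n" where
  "shape_matrix v D =
     - ((1 / norm v) *\<^sub>R (tangent_proj (sgn v) ** D ** tangent_proj (sgn v)))"

definition inner_normal :: "(real^'n) set \<Rightarrow> real^'n \<Rightarrow> real^'n" where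
  "inner_normal \<Omega> p = (THE v. \<exists>U g G D. p \<in> U \<and> defining_function \<Omega> U g G D \<and> v = sgn (G p))"

definition second_form :: "(real^'n) set \<Rightarrow> real^'n \<Rightarrow> real^'n^'n" where
  "second_form \<Omega> p =
     (THE A. \<exists>U g G D. p \<in> U \<and> defining_function \<Omega> U g G D \<and> A = shape_matrix (G p) (D p))"

lemma defining_functionD:
  assumes "defining_function \<Omega> U g G D"
  shows "C2_on U g G D" "open U" "x \<in> U \<Longrightarrow> x \<in> \<Omega> \<longleftrightarrow> g x > 0" "x \<in> U \<Longrightarrow> G x \<noteq> 0"
  using assms C2_onD(1) by (auto simp: defining_function_def)

lemma defining_function_frontier:
  assumes "open \<Omega>" and g: "defining_function \<Omega> U g G D" and x: "x \<in> U" "x \<in> frontier \<Omega>"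
  shows "g x = 0"
proof (rule antisym)
  have "x \<notin> \<Omega>" using assms(1) x(2) by (simp add: frontier_def interior_open)
  then show "g x \<le> 0" using defining_functionD(3)[OF g x(1)] by simp
  show "0 \<le> g x"
  proof (rule ccontr)
    let ?N = "{y \<in> U. g y < 0}"
    assume "\<not> 0 \<le> g x"
    then have "x \<in> ?N" using x(1) by simp
    moreover have "open ?N"
      using continuous_open_preimage[OF C2_on_continuous(1) _ open_lessThan, of U g G D 0]
        defining_functionD(1,2)[OF g] by (simp add: vimage_def Int_def)
    ultimately have "?N \<inter> \<Omega> \<noteq> {}"
      using x(2) open_Int_closure_eq_empty[of ?N \<Omega>] by (auto simp: frontier_def)
    then show False using defining_functionD(3)[OF g] by force
  qed
qed

lemma inner_unit_vectors_less_1: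
  fixes u v :: "'a::real_inner"
  assumes "norm u = 1" "norm v = 1" "u \<noteq> v"
  shows "u \<bullet> v < 1"
proof -
  have "0 < (u - v) \<bullet> (u - v)" using assms(3) by simp
  also have "\<dots> = 2 - 2 * (u \<bullet> v)" using assms(1,2) by (simp add: inner_diff inner_commute norm_eq_1)
  finally show ?thesis by simp
qed

lemma sgn_gradient_eq:
  fixes g g' :: "'a::real_inner \<Rightarrow> real"
  assumes g: "(g has_derivative (\<lambda>h. a \<bullet> h)) (at x)" "g x = 0" "a \<noteq> 0"
    and g': "(g' has_derivative (\<lambda>h. b \<bullet> h)) (at x)" "g' x = 0" "b \<noteq> 0"
    and sign: "\<forall>\<^sub>F y in nhds x. g y > 0 \<longrightarrow> g' y \<ge> 0"
  shows "sgn a = sgn b"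
proof (rule ccontr)
  assume "sgn a \<noteq> sgn b"
  then have less_1: "sgn a \<bullet> sgn b < 1"
    using g(3) g'(3) by (intro inner_unit_vectors_less_1) (auto simp: norm_sgn)
  define v where "v = sgn a - sgn b"
  have "a \<bullet> v = norm a * (sgn a \<bullet> v)" "b \<bullet> v = norm b * (sgn b \<bullet> v)"
    using g(3) g'(3) by (simp_all add: sgn_div_norm)
  moreover have "sgn a \<bullet> v = 1 - sgn a \<bullet> sgn b" "sgn b \<bullet> v = sgn a \<bullet> sgn b - 1"
    using g(3) g'(3) norm_sgn[of a] norm_sgn[of b]
    by (simp_all add: v_def inner_diff inner_commute norm_eq_1)
  ultimately have "a \<bullet> v > 0" "b \<bullet> v < 0"
    using less_1 g(3) g'(3) by (simp_all add: mult_less_0_iff)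
  have "((\<lambda>s. g (x + s *\<^sub>R v)) has_real_derivative a \<bullet> v) (at 0)"
    "((\<lambda>s. g' (x + s *\<^sub>R v)) has_real_derivative b \<bullet> v) (at 0)"
    using g(1) g'(1) by (auto intro: has_real_derivative_along_line)
  from DERIV_pos_inc_right[OF this(1) \<open>a \<bullet> v > 0\<close>] DERIV_neg_dec_right[OF this(2) \<open>b \<bullet> v < 0\<close>]
  have "\<forall>\<^sub>F s in at_right 0. g (x + s *\<^sub>R v) > 0" "\<forall>\<^sub>F s in at_right 0. g' (x + s *\<^sub>R v) < 0"
    using g(2) g'(2) by (auto simp: eventually_at_right_field)
  moreover have "((\<lambda>s. x + s *\<^sub>R v) \<longlongrightarrow> x) (at_right 0)" by (auto intro!: tendsto_eq_intros)
  with sign have "\<forall>\<^sub>F s in at_right 0. g (x + s *\<^sub>R v) > 0 \<longrightarrow> g' (x + s *\<^sub>R v) \<ge> 0"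
    by (rule eventually_compose_filterlim)
  ultimately have "\<forall>\<^sub>F s in at_right (0 :: real). False" by eventually_elim simp
  then show False by simp
qed

lemma sgn_gradient_defining_function:
  assumes g: "defining_function \<Omega> U g G D" "x \<in> U" "g x = 0"
    and g': "defining_function \<Omega> U' g' G' D'" "x \<in> U'" "g' x = 0"
  shows "sgn (G x) = sgn (G' x)"
proof (rule sgn_gradient_eq)
  show "(g has_derivative (\<lambda>h. G x \<bullet> h)) (at x)" "(g' has_derivative (\<lambda>h. G' x \<bullet> h)) (at x)"
    using C2_onD(2)[OF defining_functionD(1)] g g' by blast+
  have "\<forall>\<^sub>F y in nhds x. y \<in> U \<and> y \<in> U'"
    using g g' by (intro eventually_conj eventually_nhds_in_open defining_functionD(2))
  then show "\<forall>\<^sub>F y in nhds x. g y > 0 \<longrightarrow> g' y \<ge> 0"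
    by eventually_elim (use defining_functionD(3)[OF g(1)] defining_functionD(3)[OF g'(1)] in force)
  show "G x \<noteq> 0" "G' x \<noteq> 0"
    by (rule defining_functionD(4)[OF g(1,2)], rule defining_functionD(4)[OF g'(1,2)])
qed (fact g(3) g'(3))+

lemma second_order_sign_consistent:
  assumes g: "defining_function \<Omega> U g G D" "x \<in> U" "g x = 0" "G x \<bullet> v = 0"
    and g': "defining_function \<Omega> U' g' G' D'" "x \<in> U'" "g' x = 0" "G' x \<bullet> v = 0"
    and pos: "0 < G x \<bullet> a + (v \<bullet> (D x *v v)) / 2"
  shows "0 \<le> G' x \<bullet> a + (v \<bullet> (D' x *v v)) / 2"
proof (rule ccontr)
  assume neg: "\<not> 0 \<le> G' x \<bullet> a + (v \<bullet> (D' x *v v)) / 2"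
  have "\<forall>\<^sub>F t in at 0. 0 < g (x + (t *\<^sub>R v + t\<^sup>2 *\<^sub>R a)) / t\<^sup>2"
    using C2_on_along_parabola[OF defining_functionD(1)[OF g(1)] g(2-4)] pos
    by (rule order_tendstoD(1))
  moreover have "\<forall>\<^sub>F t in at 0. g' (x + (t *\<^sub>R v + t\<^sup>2 *\<^sub>R a)) / t\<^sup>2 < 0"
    using C2_on_along_parabola[OF defining_functionD(1)[OF g'(1)] g'(2-4)] neg
    by (intro order_tendstoD(2)) auto
  moreover have "\<forall>\<^sub>F t in at 0. x + (t *\<^sub>R v + t\<^sup>2 *\<^sub>R a) \<in> U \<inter> U'"
    using g(2) g'(2) defining_functionD(2)[OF g(1)] defining_functionD(2)[OF g'(1)]
    by (intro topological_tendstoD[of _ x]) (auto intro!: tendsto_eq_intros open_Int)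
  ultimately have "\<forall>\<^sub>F t in at (0 :: real). False"
  proof eventually_elim
    case (elim t)
    then have "g (x + (t *\<^sub>R v + t\<^sup>2 *\<^sub>R a)) > 0" "\<not> g' (x + (t *\<^sub>R v + t\<^sup>2 *\<^sub>R a)) > 0"
      by (auto simp: zero_less_divide_iff divide_less_0_iff)
    with elim(3) show False
      using defining_functionD(3)[OF g(1)] defining_functionD(3)[OF g'(1)] by blast
  qed
  then show False by simp
qed

lemma tangential_hessian_le:
  assumes g: "defining_function \<Omega> U g G D" "x \<in> U" "g x = 0"
    and g': "defining_function \<Omega> U' g' G' D'" "x \<in> U'" "g' x = 0"
    and tangent: "G x \<bullet> v = 0"
  shows "(v \<bullet> (D x *v v)) / norm (G x) \<le> (v \<bullet> (D' x *v v)) / norm (G' x)"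
proof (rule ccontr)
  define q where "q = (v \<bullet> (D x *v v)) / norm (G x)"
  define q' where "q' = (v \<bullet> (D' x *v v)) / norm (G' x)"
  define a where "a = (- (q + q') / 4) *\<^sub>R sgn (G x)"
  assume "\<not> (v \<bullet> (D x *v v)) / norm (G x) \<le> (v \<bullet> (D' x *v v)) / norm (G' x)"
  then have "q' < q" by (simp add: q_def q'_def)
  have nz: "norm (G x) > 0" "norm (G' x) > 0" using g g' by (auto dest: defining_functionD(4))
  have sgn_eq: "sgn (G x) = sgn (G' x)" by (rule sgn_gradient_defining_function[OF g g'])
  have inner_sgn: "w \<bullet> sgn w = norm w" for w :: "real^'n"
    by (cases "w = 0") (simp_all add: sgn_div_norm power2_norm_eq_inner[symmetric] power2_eq_square)
  have "sgn (G x) \<bullet> v = 0" using tangent by (simp add: sgn_div_norm)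
  then have tangent': "G' x \<bullet> v = 0" unfolding sgn_eq using nz by (simp add: sgn_div_norm)
  have "0 < norm (G x) * (q - q') / 4" using nz \<open>q' < q\<close> by simp
  also have "\<dots> = G x \<bullet> a + (v \<bullet> (D x *v v)) / 2"
    using nz by (simp add: a_def inner_sgn q_def field_simps)
  finally have "0 \<le> G' x \<bullet> a + (v \<bullet> (D' x *v v)) / 2"
    by (rule second_order_sign_consistent[OF g tangent g' tangent'])
  also have "\<dots> = norm (G' x) * (q' - q) / 4"
    using nz by (simp add: a_def sgn_eq inner_sgn q'_def field_simps)
  also have "\<dots> < 0" using nz \<open>q' < q\<close> by (simp add: mult_less_0_iff)
  finally show False by simp
qed

lemma transpose_shape_matrix:
  assumes "transpose D = D"
  shows "transpose (shape_matrix v D) = shape_matrix v D"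
  by (simp add: shape_matrix_def transpose_uminus transpose_scalar matrix_transpose_mul
    matrix_mul_assoc assms)

lemma shape_matrix_quadratic_form:
  fixes v w :: "real^'n"
  shows "w \<bullet> (shape_matrix v D *v w)
    = - ((tangent_proj (sgn v) *v w) \<bullet> (D *v (tangent_proj (sgn v) *v w))) / norm v"
proof -
  let ?T = "tangent_proj (sgn v)"
  have "w \<bullet> (shape_matrix v D *v w) = - (1 / norm v) * (w \<bullet> (?T *v (D *v (?T *v w))))"
    by (simp add: shape_matrix_def matrix_vector_mult_uminus scaleR_matrix_vector_assoc[symmetric]
      matrix_vector_mul_assoc matrix_mul_assoc)
  also have "w \<bullet> (?T *v (D *v (?T *v w))) = (?T *v w) \<bullet> (D *v (?T *v w))"
    by (simp only: inner_symmetric_matrix[OF transpose_tangent_proj])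
  finally show ?thesis by simp
qed

lemma inner_tangent_proj [simp]: "norm v = 1 \<Longrightarrow> v \<bullet> (tangent_proj v *v h) = 0"
  by (simp add: tangent_proj_mult_vec inner_diff norm_eq_1)

lemma shape_matrix_defining_function:
  assumes g: "defining_function \<Omega> U g G D" "x \<in> U" "g x = 0"
    and g': "defining_function \<Omega> U' g' G' D'" "x \<in> U'" "g' x = 0"
  shows "shape_matrix (G x) (D x) = shape_matrix (G' x) (D' x)"
proof (rule symmetric_matrix_eqI)
  show "transpose (shape_matrix (G x) (D x)) = shape_matrix (G x) (D x)"
    "transpose (shape_matrix (G' x) (D' x)) = shape_matrix (G' x) (D' x)"
    by (intro transpose_shape_matrix C2_onD(5)[OF defining_functionD(1)[OF g(1)] g(2)]
        C2_onD(5)[OF defining_functionD(1)[OF g'(1)] g'(2)])+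
  fix w
  define v where "v = tangent_proj (sgn (G x)) *v w"
  have sgn_eq: "sgn (G x) = sgn (G' x)" by (rule sgn_gradient_defining_function[OF g g'])
  have "G x \<noteq> 0" "G' x \<noteq> 0" using g g' by (auto dest: defining_functionD(4))
  then have "sgn (G x) \<bullet> v = 0" "sgn (G' x) \<bullet> v = 0"
    unfolding v_def sgn_eq[symmetric] by (simp_all add: norm_sgn)
  with \<open>G x \<noteq> 0\<close> \<open>G' x \<noteq> 0\<close> have "G x \<bullet> v = 0" "G' x \<bullet> v = 0" by (auto simp: sgn_div_norm)
  then have "(v \<bullet> (D x *v v)) / norm (G x) = (v \<bullet> (D' x *v v)) / norm (G' x)"
    using tangential_hessian_le[OF g g'] tangential_hessian_le[OF g' g] by (intro antisym)
  then show "w \<bullet> (shape_matrix (G x) (D x) *v w) = w \<bullet> (shape_matrix (G' x) (D' x) *v w)"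
    by (simp add: shape_matrix_quadratic_form v_def sgn_eq)
qed

lemma
  assumes \<Omega>: "open \<Omega>" and p: "p \<in> frontier \<Omega>" "p \<in> U" and g: "defining_function \<Omega> U g G D"
  shows inner_normal_eq: "inner_normal \<Omega> p = sgn (G p)"
    and second_form_eq: "second_form \<Omega> p = shape_matrix (G p) (D p)"
proof -
  have vanish: "g' p = 0" if "p \<in> U'" "defining_function \<Omega> U' g' G' D'" for U' g' G' D'
    by (rule defining_function_frontier[OF \<Omega> that(2,1) p(1)])
  show "inner_normal \<Omega> p = sgn (G p)"
    unfolding inner_normal_def
  proof (rule the_equality)
    fix v assume "\<exists>U' g' G' D'. p \<in> U' \<and> defining_function \<Omega> U' g' G' D' \<and> v = sgn (G' p)"
    then obtain U' g' G' D' where g': "p \<in> U'" "defining_function \<Omega> U' g' G' D'" "v = sgn (G' p)"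
      by blast
    show "v = sgn (G p)"
      unfolding g'(3)
      by (rule sgn_gradient_defining_function[OF g'(2,1) vanish[OF g'(1,2)] g p(2) vanish[OF p(2) g]])
  qed (use p(2) g in blast)
  show "second_form \<Omega> p = shape_matrix (G p) (D p)"
    unfolding second_form_def
  proof (rule the_equality)
    fix A assume "\<exists>U' g' G' D'. p \<in> U' \<and> defining_function \<Omega> U' g' G' D' \<and>
        A = shape_matrix (G' p) (D' p)"
    then obtain U' g' G' D' where g': "p \<in> U'" "defining_function \<Omega> U' g' G' D'"
      "A = shape_matrix (G' p) (D' p)" by blast
    show "A = shape_matrix (G p) (D p)"
      unfolding g'(3)
      by (rule shape_matrix_defining_function[OF g'(2,1) vanish[OF g'(1,2)] g p(2) vanish[OF p(2) g]])
  qed (use p(2) g in blast)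
qed

text \<open>An adapted defining function agrees to second order with the signed distance to the
  boundary at \<open>p\<close>.\<close>

definition adapted_defining_function ::
  "(real^'n) set \<Rightarrow> real^'n \<Rightarrow> (real^'n) set \<Rightarrow> (real^'n \<Rightarrow> real) \<Rightarrow> (real^'n \<Rightarrow> real^'n)
    \<Rightarrow> (real^'n \<Rightarrow> real^'n^'n) \<Rightarrow> bool" where
  "adapted_defining_function \<Omega> p U g G D \<longleftrightarrow>
     p \<in> U \<and> defining_function \<Omega> U g G D \<and> norm (G p) = 1 \<and> D p *v G p = 0"

lemma shape_matrix_adapted:
  assumes "norm v = 1" "D *v v = 0" "transpose D = D"
  shows "shape_matrix v D = - D"
proof (rule symmetric_matrix_eqI)
  show "transpose (shape_matrix v D) = shape_matrix v D"
    by (rule transpose_shape_matrix[OF assms(3)])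
  show "transpose (- D) = - D" by (simp add: transpose_uminus assms(3))
  fix w
  have "v \<bullet> (D *v w) = 0" using inner_symmetric_matrix[OF assms(3), of v w] assms(2) by simp
  then show "w \<bullet> (shape_matrix v D *v w) = w \<bullet> (- D *v w)"
    using assms(1,2)
    by (simp add: shape_matrix_quadratic_form tangent_proj_mult_vec sgn_div_norm
      matrix_vector_mult_uminus
      matrix_vector_mult_diff_distrib matrix_vector_mult_scaleR inner_diff_left)
qed

lemma
  assumes "open \<Omega>" "p \<in> frontier \<Omega>" "adapted_defining_function \<Omega> p U g G D"
  shows inner_normal_adapted: "inner_normal \<Omega> p = G p"
    and second_form_adapted: "second_form \<Omega> p = - D p"
proof -
  have g: "p \<in> U" "defining_function \<Omega> U g G D" "norm (G p) = 1" "D p *v G p = 0"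
    using assms(3) by (auto simp: adapted_defining_function_def)
  show "inner_normal \<Omega> p = G p"
    using inner_normal_eq[OF assms(1,2) g(1,2)] g(3) by (simp add: sgn_div_norm)
  have "transpose (D p) = D p" by (rule C2_onD(5)[OF defining_functionD(1)[OF g(2)] g(1)])
  with g(3,4) show "second_form \<Omega> p = - D p"
    unfolding second_form_eq[OF assms(1,2) g(1,2)] by (rule shape_matrix_adapted)
qed

lemma
  assumes chart: "boundary_chart \<Omega> p Q i0 \<phi> r" and y: "y \<in> ball 0 r"
  shows boundary_chart_partial: "partial i0 \<phi> y = 0"
    and boundary_chart_hess: "hess \<phi> y *v axis i0 1 = 0"
proof -
  have C2: "C2_on (ball 0 r) \<phi> (\<lambda>x. \<chi> i. partial i \<phi> x) (hess \<phi>)"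
    using chart by (intro Ck_on_2_imp_C2_on) (auto simp: boundary_chart_def)
  have vertical: "\<phi> z = \<phi> (z - (z $ i0) *\<^sub>R axis i0 1)" for z
    using chart unfolding boundary_chart_def by blast
  have zero: "partial i0 \<phi> y = 0" if "y \<in> ball 0 r" for y
  proof -
    have "\<phi> (y + s *\<^sub>R axis i0 1) = \<phi> y" for s
      by (subst (1 2) vertical) (simp add: algebra_simps)
    moreover have "((\<lambda>s. \<phi> (y + s *\<^sub>R axis i0 1)) has_real_derivative
        (\<chi> i. partial i \<phi> y) \<bullet> axis i0 1) (at 0)"
      using C2_onD(2)[OF C2 that] by (intro has_real_derivative_along_line) simp
    ultimately have "((\<lambda>s :: real. \<phi> y) has_real_derivative partial i0 \<phi> y) (at 0)"
      by (simp add: inner_axis)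
    then show ?thesis using DERIV_const DERIV_unique by blast
  qed
  show "partial i0 \<phi> y = 0" by (rule zero[OF y])
  have "((\<lambda>_. 0) has_derivative (\<lambda>_. 0)) (at y)" by (rule has_derivative_const)
  then have "(partial i0 \<phi> has_derivative (\<lambda>_. 0)) (at y)"
    by (rule has_derivative_transform_within_open[OF _ open_ball y]) (simp add: zero)
  then have "partial i (partial i0 \<phi>) y = 0" for i by (rule partial_eqI)
  then show "hess \<phi> y *v axis i0 1 = 0"
    by (simp add: vec_eq_iff matrix_vector_mul_component inner_axis hess_def)
qed

lemma boundary_chart_defining_function:
  fixes \<Omega> :: "(real^'n) set"
  assumes chart: "boundary_chart \<Omega> p Q i0 \<phi> r"
  defines "grad \<equiv> \<lambda>y. axis i0 1 - (\<chi> i. partial i \<phi> y)" and "T \<equiv> \<lambda>x. transpose Q *v (x - p)"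
  shows "defining_function \<Omega> (T -` ball 0 r) (\<lambda>x. axis i0 1 \<bullet> T x - \<phi> (T x))
    (\<lambda>x. Q *v grad (T x)) (\<lambda>x. Q ** (0 - hess \<phi> (T x)) ** transpose Q)"
proof -
  let ?e = "axis i0 1 :: real^'n" and ?U = "T -` ball 0 r"
  have Q: "orthogonal_matrix Q" and Ck: "Ck_on 2 (ball 0 r) \<phi>"
    and sign: "\<And>y. y \<in> ball 0 r \<Longrightarrow> p + Q *v y \<in> \<Omega> \<longleftrightarrow> \<phi> y < y $ i0"
    using chart by (auto simp: boundary_chart_def)
  have "C2_on (ball 0 r) (\<lambda>y. ?e \<bullet> y - \<phi> y) grad (\<lambda>y. 0 - hess \<phi> y)"
    unfolding grad_def
      using C2_on_quadratic[of "ball 0 r" 0 0 ?e 0] Ck_on_2_imp_C2_on[OF open_ball Ck]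
    by (intro C2_on_diff) (auto simp: transpose_def vec_eq_iff)
  from C2_on_affine_compose[OF this, of "transpose Q" p]
  have "C2_on ?U (\<lambda>x. ?e \<bullet> T x - \<phi> (T x)) (\<lambda>x. Q *v grad (T x))
      (\<lambda>x. Q ** (0 - hess \<phi> (T x)) ** transpose Q)"
    by (simp add: T_def del: transpose_matrix_vector)
  moreover have "x \<in> \<Omega> \<longleftrightarrow> ?e \<bullet> T x - \<phi> (T x) > 0" if "x \<in> ?U" for x
  proof -
    have "Q ** transpose Q = mat 1" using Q by (simp add: orthogonal_matrix_def)
    then have "p + Q *v T x = x"
      by (simp add: T_def matrix_vector_mul_assoc del: transpose_matrix_vector)
    then show ?thesis using sign[of "T x"] that by (simp add: inner_axis')
  qed
  moreover have "Q *v grad (T x) \<noteq> 0" if "x \<in> ?U" for x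
  proof -
    have "grad (T x) $ i0 = 1"
      using boundary_chart_partial[OF chart, of "T x"] that by (simp add: grad_def)
    then have "grad (T x) \<noteq> 0" by force
    moreover have "norm (Q *v grad (T x)) = norm (grad (T x))"
      using Q by (intro orthogonal_transformation_norm) (simp add: orthogonal_transformation_matrix)
    ultimately show ?thesis by auto
  qed
  ultimately show ?thesis by (simp add: defining_function_def)
qed

lemma boundary_chart_adapted:
  fixes \<Omega> :: "(real^'n) set"
  assumes chart: "boundary_chart \<Omega> p Q i0 \<phi> r"
  shows "\<exists>U g G D. adapted_defining_function \<Omega> p U g G D \<and> D p = - (Q ** hess \<phi> 0 ** transpose Q)"
proof -
  let ?e = "axis i0 1 :: real^'n"
  have Q: "orthogonal_matrix Q" and "0 < r" and "\<And>i. partial i \<phi> 0 = 0"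
    using chart by (auto simp: boundary_chart_def)
  define T where "T x = transpose Q *v (x - p)" for x
  define G where "G x = Q *v (?e - (\<chi> i. partial i \<phi> (T x)))" for x
  define D where "D x = Q ** (0 - hess \<phi> (T x)) ** transpose Q" for x
  have "T p = 0" "p \<in> T -` ball 0 r" using \<open>0 < r\<close> by (simp_all add: T_def)
  have "defining_function \<Omega> (T -` ball 0 r) (\<lambda>x. ?e \<bullet> T x - \<phi> (T x)) G D"
    using boundary_chart_defining_function[OF chart]
    by (simp add: T_def[abs_def] G_def[abs_def] D_def[abs_def])
  moreover have "?e - (\<chi> i. partial i \<phi> 0) = ?e"
    using \<open>\<And>i. partial i \<phi> 0 = 0\<close> by (simp add: vec_eq_iff)
  then have G_p: "G p = Q *v ?e" by (simp add: G_def \<open>T p = 0\<close>)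
  then have "norm (G p) = 1"
    using Q by (simp add: orthogonal_transformation_norm orthogonal_transformation_matrix)
  moreover have "D p *v G p = 0"
  proof -
    have "D p *v G p = Q *v ((0 - hess \<phi> 0) *v ((transpose Q ** Q) *v ?e))"
      by (simp add: D_def G_p \<open>T p = 0\<close> matrix_vector_mul_assoc matrix_mul_assoc)
    also have "\<dots> = 0" using boundary_chart_hess[OF chart, of 0] \<open>0 < r\<close> Q
      by (simp add: orthogonal_matrix_def matrix_vector_mult_uminus)
    finally show ?thesis .
  qed
  moreover have "D p = - (Q ** hess \<phi> 0 ** transpose Q)"
  proof -
    have "(- A) ** B = - (A ** B)" "A ** (- B) = - (A ** B)" for A B :: "real^'n^'n"
      by (simp_all add: matrix_matrix_mult_def vec_eq_iff sum_negf)
    then show ?thesis by (simp add: D_def \<open>T p = 0\<close>)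
  qed
  ultimately show ?thesis
    using \<open>p \<in> T -` ball 0 r\<close> unfolding adapted_defining_function_def by blast
qed

lemma C31_boundary_adapted:
  assumes "C31_boundary \<Omega>" "p \<in> frontier \<Omega>"
  shows "\<exists>U g G D. adapted_defining_function \<Omega> p U g G D"
  using assms boundary_chart_adapted unfolding C31_boundary_def by metis

lemma sigma_matrix_second_form:
  assumes \<Omega>: "open \<Omega>" "C31_boundary \<Omega>" and p: "p \<in> frontier \<Omega>"
  shows "sigma_matrix j (second_form \<Omega> p) = curv_sigma \<Omega> j p"
proof -
  define \<phi> where "\<phi> = (SOME \<phi>. \<exists>Q i0 r. boundary_chart \<Omega> p Q i0 \<phi> r)"
  have "\<exists>\<phi> Q i0 r. boundary_chart \<Omega> p Q i0 \<phi> r" using \<Omega>(2) p unfolding C31_boundary_def by blast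
  then have "\<exists>Q i0 r. boundary_chart \<Omega> p Q i0 \<phi> r" unfolding \<phi>_def by (rule someI_ex)
  then obtain Q i0 r where chart: "boundary_chart \<Omega> p Q i0 \<phi> r" by blast
  then have Q: "orthogonal_matrix Q" and r: "0 < r" and Ck: "Ck_on 2 (ball 0 r) \<phi>"
    by (auto simp: boundary_chart_def)
  obtain U g G D where "adapted_defining_function \<Omega> p U g G D" "D p = - (Q ** hess \<phi> 0 ** transpose Q)"
    using boundary_chart_adapted[OF chart] by blast
  then have "second_form \<Omega> p = Q ** hess \<phi> 0 ** transpose Q"
    using second_form_adapted[OF \<Omega>(1) p] by simp
  moreover have "transpose (hess \<phi> 0) = hess \<phi> 0"
    using C2_onD(5)[OF Ck_on_2_imp_C2_on[OF open_ball Ck]] r by simp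
  ultimately have "sigma_matrix j (second_form \<Omega> p) = Sk j (hess \<phi> 0)"
    by (simp add: sigma_matrix_orthogonal_conjugate[OF Q] Sk_eq_sigma_matrix)
  then show ?thesis by (simp add: curv_sigma_def \<phi>_def)
qed

lemma locally_bounded_imp_bounded_on_compact:
  fixes F :: "'a::topological_space \<Rightarrow> real"
  assumes "compact S" and local: "\<And>x. x \<in> S \<Longrightarrow> \<exists>U K. open U \<and> x \<in> U \<and> (\<forall>y\<in>S \<inter> U. F y \<le> K)"
  shows "\<exists>K>0. \<forall>y\<in>S. F y \<le> K"
proof -
  obtain U K where U: "\<And>x. x \<in> S \<Longrightarrow> open (U x)" "\<And>x. x \<in> S \<Longrightarrow> x \<in> U x"
    and local_bound: "\<And>x y. x \<in> S \<Longrightarrow> y \<in> S \<inter> U x \<Longrightarrow> F y \<le> K x"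
    using local by metis
  obtain T where T: "T \<subseteq> S" "finite T" "S \<subseteq> (\<Union>x\<in>T. U x)"
    using compactE_image[OF assms(1), of S U] U by blast
  have "F y \<le> (\<Sum>x\<in>T. \<bar>K x\<bar>) + 1" if y: "y \<in> S" for y
  proof -
    obtain x where x: "x \<in> T" "y \<in> U x" using T(3) y by blast
    then have "F y \<le> \<bar>K x\<bar>" using local_bound[of x y] T(1) y by fastforce
    also have "\<dots> \<le> (\<Sum>x\<in>T. \<bar>K x\<bar>)" using T(2) x(1) by (intro member_le_sum) auto
    finally show ?thesis by simp
  qed
  moreover have "(\<Sum>x\<in>T. \<bar>K x\<bar>) + 1 > 0" by (intro add_nonneg_pos sum_nonneg) auto
  ultimately show ?thesis by blast
qed

lemma continuous_on_tangent_proj: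
  assumes "continuous_on S v"
  shows "continuous_on S (\<lambda>x. tangent_proj (v x))"
  unfolding tangent_proj_def outer_def using assms by (auto intro!: continuous_intros)

locale C2_domain =
  fixes \<Omega> :: "(real^'n) set"
  assumes open_\<Omega>: "open \<Omega>" and bounded_\<Omega>: "bounded \<Omega>" and nonempty_\<Omega>: "\<Omega> \<noteq> {}"
    and adapted_exists: "\<And>p. p \<in> frontier \<Omega> \<Longrightarrow> \<exists>U g G D. adapted_defining_function \<Omega> p U g G D"
begin

abbreviation "\<nu> \<equiv> inner_normal \<Omega>"
abbreviation "C \<equiv> second_form \<Omega>"

lemma frontier_nonempty: "frontier \<Omega> \<noteq> {}"
  using bounded_\<Omega> nonempty_\<Omega> not_bounded_UNIV by (auto simp: frontier_eq_empty)

lemma compact_frontier_\<Omega>: "compact (frontier \<Omega>)"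
  using bounded_\<Omega> by (simp add: compact_frontier_bounded)

lemma adaptedE:
  assumes "p \<in> frontier \<Omega>"
  obtains U g G D where "p \<in> U" "defining_function \<Omega> U g G D" "g p = 0" "G p = \<nu> p" "D p = - C p"
    "norm (\<nu> p) = 1" "transpose (C p) = C p" "C p *v \<nu> p = 0"
proof -
  obtain U g G D where g: "adapted_defining_function \<Omega> p U g G D"
    using adapted_exists[OF assms] by blast
  note frame = inner_normal_adapted[OF open_\<Omega> assms g] second_form_adapted[OF open_\<Omega> assms g]
  have g': "p \<in> U" "defining_function \<Omega> U g G D" "norm (G p) = 1" "D p *v G p = 0"
    using g by (auto simp: adapted_defining_function_def)
  have "transpose (D p) = D p" by (rule C2_onD(5)[OF defining_functionD(1)[OF g'(2)] g'(1)])
  then show ?thesis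
    using g' frame defining_function_frontier[OF open_\<Omega> g'(2,1) assms]
    by (intro that[of U g G D]) (simp_all add: transpose_uminus matrix_vector_mult_uminus)
qed

lemma
  assumes "p \<in> frontier \<Omega>"
  shows norm_normal: "norm (\<nu> p) = 1" and transpose_second_form: "transpose (C p) = C p"
    and second_form_normal: "C p *v \<nu> p = 0"
  using adaptedE[OF assms] by metis+

lemma continuous_on_frontierI:
  assumes local: "\<And>U g G D. defining_function \<Omega> U g G D \<Longrightarrow> continuous_on (frontier \<Omega> \<inter> U) F"
  shows "continuous_on (frontier \<Omega>) F"
  unfolding continuous_on_eq_continuous_within
proof
  fix p assume p: "p \<in> frontier \<Omega>"
  obtain U g G D where g: "p \<in> U" "defining_function \<Omega> U g G D" using adaptedE[OF p] by metis
  have "continuous (at p within (frontier \<Omega> \<inter> U)) F"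
    using local[OF g(2)] p g(1) by (auto simp: continuous_on_eq_continuous_within)
  moreover have "at p within (frontier \<Omega> \<inter> U) = at p within frontier \<Omega>"
    by (rule at_within_nhd[OF g(1) defining_functionD(2)[OF g(2)]]) auto
  ultimately show "continuous (at p within frontier \<Omega>) F" by simp
qed

lemma
  shows continuous_on_inner_normal: "continuous_on (frontier \<Omega>) \<nu>"
    and continuous_on_second_form: "continuous_on (frontier \<Omega>) C"
proof -
  have "continuous_on (frontier \<Omega> \<inter> U) \<nu> \<and> continuous_on (frontier \<Omega> \<inter> U) C"
    if g: "defining_function \<Omega> U g G D" for U g G D
  proof -
    note C2 = defining_functionD(1)[OF g]
    note cont = C2_on_continuous(2)[OF C2] C2_onD(4)[OF C2]
    have sgn_cont: "continuous_on U (\<lambda>x. sgn (G x))"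
      unfolding sgn_div_norm
      by (intro continuous_intros cont) (simp add: defining_functionD(4)[OF g])
    then have "continuous_on U (\<lambda>x. shape_matrix (G x) (D x))"
      unfolding shape_matrix_def
      by (intro continuous_intros continuous_on_tangent_proj cont)
        (simp_all add: defining_functionD(4)[OF g])
    then have "continuous_on (frontier \<Omega> \<inter> U) C"
      by (rule continuous_on_eq[OF continuous_on_subset]) (auto simp: second_form_eq[OF open_\<Omega> _ _ g])
    moreover have "continuous_on (frontier \<Omega> \<inter> U) \<nu>"
      by (rule continuous_on_eq[OF continuous_on_subset[OF sgn_cont]])
        (auto simp: inner_normal_eq[OF open_\<Omega> _ _ g])
    ultimately show ?thesis by blast
  qed
  then show "continuous_on (frontier \<Omega>) \<nu>" "continuous_on (frontier \<Omega>) C"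
    by (blast intro: continuous_on_frontierI)+
qed

lemma boundary_second_order:
  assumes p: "p \<in> frontier \<Omega>" and "e > 0"
  shows "\<forall>\<^sub>F h in nhds 0. p + h \<in> \<Omega> \<longrightarrow> (h \<bullet> (C p *v h)) / 2 - e * (norm h)\<^sup>2 < \<nu> p \<bullet> h"
    and "\<forall>\<^sub>F h in nhds 0. p + h \<notin> \<Omega> \<longrightarrow> \<nu> p \<bullet> h \<le> (h \<bullet> (C p *v h)) / 2 + e * (norm h)\<^sup>2"
proof -
  obtain U g G D where g: "p \<in> U" "defining_function \<Omega> U g G D" "g p = 0" "G p = \<nu> p" "D p = - C p"
    using adaptedE[OF p] by metis
  have taylor: "\<forall>\<^sub>F h in nhds 0. \<bar>g (p + h) - \<nu> p \<bullet> h + (h \<bullet> (C p *v h)) / 2\<bar> \<le> e * (norm h)\<^sup>2"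
    using C2_on_taylor[OF defining_functionD(1)[OF g(2)] g(1) \<open>e > 0\<close>]
    by (simp add: g matrix_vector_mult_uminus)
  have "\<forall>\<^sub>F h in nhds 0. p + h \<in> U"
    using eventually_nhds_in_open[OF defining_functionD(2)[OF g(2)] g(1)]
    by (simp add: eventually_nhds_0_shift[of _ p])
  then have sign: "\<forall>\<^sub>F h in nhds 0. p + h \<in> \<Omega> \<longleftrightarrow> g (p + h) > 0"
    by eventually_elim (rule defining_functionD(3)[OF g(2)])
  show "\<forall>\<^sub>F h in nhds 0. p + h \<in> \<Omega> \<longrightarrow> (h \<bullet> (C p *v h)) / 2 - e * (norm h)\<^sup>2 < \<nu> p \<bullet> h"
    using taylor sign by eventually_elim (auto simp: abs_le_iff)
  show "\<forall>\<^sub>F h in nhds 0. p + h \<notin> \<Omega> \<longrightarrow> \<nu> p \<bullet> h \<le> (h \<bullet> (C p *v h)) / 2 + e * (norm h)\<^sup>2"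
    using taylor sign by eventually_elim (auto simp: abs_le_iff)
qed

lemma normal_chord_locally_quadratic:
  assumes p: "p \<in> frontier \<Omega>"
  shows "\<exists>r>0. \<exists>K. \<forall>x\<in>frontier \<Omega> \<inter> ball p r. \<forall>z\<in>frontier \<Omega> \<inter> ball p r.
    \<bar>\<nu> x \<bullet> (z - x)\<bar> \<le> K * (norm (z - x))\<^sup>2"
proof -
  obtain U g G D where g: "p \<in> U" "defining_function \<Omega> U g G D" and "G p = \<nu> p" "norm (\<nu> p) = 1"
    using adaptedE[OF p] by metis
  note C2 = defining_functionD(1)[OF g(2)]
  obtain r K where r: "r > 0" "ball p r \<subseteq> U"
    and first_order: "\<And>y z. y \<in> ball p r \<Longrightarrow> z \<in> ball p r \<Longrightarrow>
        \<bar>g z - g y - G y \<bullet> (z - y)\<bar> \<le> K * (norm (z - y))\<^sup>2"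
    using C2_on_uniform_first_order[OF C2 g(1)] by metis
  have "isCont (\<lambda>x. norm (G x)) p"
    using C2_on_continuous(2)[OF C2] C2_onD(1)[OF C2] g(1)
    by (intro continuous_intros) (simp add: continuous_on_eq_continuous_at)
  from order_tendstoD(1)[OF isCont_tendsto_nhds[OF this], of "1/2"]
  obtain s where s: "s > 0" "\<And>x. x \<in> ball p s \<Longrightarrow> 1 / 2 < norm (G x)"
    using \<open>G p = \<nu> p\<close> \<open>norm (\<nu> p) = 1\<close> unfolding eventually_nhds_metric by (auto simp: dist_commute)
  have "\<bar>\<nu> x \<bullet> (z - x)\<bar> \<le> 2 * K * (norm (z - x))\<^sup>2"
    if x: "x \<in> frontier \<Omega>" "x \<in> ball p (min r s)" and z: "z \<in> frontier \<Omega>" "z \<in> ball p (min r s)" for x z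
  proof -
    have xU: "x \<in> U" "z \<in> U" using x z r(2) by auto
    then have "g x = 0" "g z = 0" using x z defining_function_frontier[OF open_\<Omega> g(2)] by auto
    then have "\<bar>G x \<bullet> (z - x)\<bar> \<le> K * (norm (z - x))\<^sup>2" using first_order[of x z] x z by simp
    moreover have "G x = norm (G x) *\<^sub>R \<nu> x"
      unfolding inner_normal_eq[OF open_\<Omega> x(1) xU(1) g(2)]
      using defining_functionD(4)[OF g(2) xU(1)] by (simp add: sgn_div_norm)
    then have "\<bar>G x \<bullet> (z - x)\<bar> = norm (G x) * \<bar>\<nu> x \<bullet> (z - x)\<bar>"
      by (metis abs_mult abs_norm_cancel inner_scaleR_left)
    moreover have "1 / 2 * \<bar>\<nu> x \<bullet> (z - x)\<bar> \<le> norm (G x) * \<bar>\<nu> x \<bullet> (z - x)\<bar>"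
      using s(2)[of x] x by (intro mult_right_mono) auto
    ultimately show ?thesis by simp
  qed
  then show ?thesis using r(1) s(1) by (intro exI[of _ "min r s"] conjI exI[of _ "2 * K"]) auto
qed

lemma normal_chord_quotient_le:
  assumes "x \<in> frontier \<Omega>" and far: "c > 0" "c < norm (z - x)"
  shows "\<bar>\<nu> x \<bullet> (z - x)\<bar> / (norm (z - x))\<^sup>2 \<le> 1 / c"
proof -
  have "\<bar>\<nu> x \<bullet> (z - x)\<bar> \<le> norm (z - x)"
    using Cauchy_Schwarz_ineq2[of "\<nu> x" "z - x"] norm_normal[OF assms(1)] by simp
  then have "\<bar>\<nu> x \<bullet> (z - x)\<bar> / (norm (z - x))\<^sup>2 \<le> norm (z - x) / (norm (z - x))\<^sup>2"
    by (simp add: divide_right_mono)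
  also have "\<dots> = 1 / norm (z - x)" by (simp add: power2_eq_square)
  also have "\<dots> \<le> 1 / c" using far by (intro frac_le) auto
  finally show ?thesis .
qed

lemma normal_chord_quadratic:
  "\<exists>K>0. \<forall>x\<in>frontier \<Omega>. \<forall>z\<in>frontier \<Omega>. \<bar>\<nu> x \<bullet> (z - x)\<bar> \<le> K * (norm (z - x))\<^sup>2"
proof -
  define F where "F = (\<lambda>(x, z). \<bar>\<nu> x \<bullet> (z - x)\<bar> / (norm (z - x))\<^sup>2)"
  have "\<exists>W K. open W \<and> (p, q) \<in> W \<and> (\<forall>y\<in>(frontier \<Omega> \<times> frontier \<Omega>) \<inter> W. F y \<le> K)"
    if pq: "p \<in> frontier \<Omega>" "q \<in> frontier \<Omega>" for p q
  proof (cases "p = q")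
    case True
    obtain r K where r: "r > 0" "\<And>x z. x \<in> frontier \<Omega> \<inter> ball p r \<Longrightarrow> z \<in> frontier \<Omega> \<inter> ball p r \<Longrightarrow>
        \<bar>\<nu> x \<bullet> (z - x)\<bar> \<le> K * (norm (z - x))\<^sup>2"
      using normal_chord_locally_quadratic[OF pq(1)] by blast
    have "F (x, z) \<le> \<bar>K\<bar>" if "x \<in> frontier \<Omega> \<inter> ball p r" "z \<in> frontier \<Omega> \<inter> ball p r" for x z
    proof (cases "x = z")
      case False
      then have "F (x, z) \<le> K" using r(2)[OF that] by (simp add: F_def divide_le_eq)
      then show ?thesis by simp
    qed (simp add: F_def)
    then show ?thesis
      using r(1) True
      by (intro exI[of _ "ball p r \<times> ball p r"] exI[of _ "\<bar>K\<bar>"]) (auto intro: open_Times)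
  next
    case False
    define c where "c = dist q p / 2"
    have "c > 0" using False by (simp add: c_def)
    let ?W = "{y :: (real^'n) \<times> (real^'n). c < dist (snd y) (fst y)}"
    have "open ?W" by (intro open_Collect_less continuous_intros)
    moreover have "F (x, z) \<le> 1 / c" if "x \<in> frontier \<Omega>" "(x, z) \<in> ?W" for x z
      using normal_chord_quotient_le[OF that(1) \<open>c > 0\<close>, of z] that(2)
      by (simp add: F_def dist_norm)
    ultimately show ?thesis
      using \<open>c > 0\<close> by (intro exI[of _ ?W] exI[of _ "1 / c"]) (auto simp: c_def)
  qed
  then obtain K where quotient_le: "K > 0" "\<And>x z. x \<in> frontier \<Omega> \<Longrightarrow> z \<in> frontier \<Omega> \<Longrightarrow> F (x, z) \<le> K"
    using locally_bounded_imp_bounded_on_compact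
        [OF compact_Times[OF compact_frontier_\<Omega> compact_frontier_\<Omega>], of F]
    by auto
  have "\<bar>\<nu> x \<bullet> (z - x)\<bar> \<le> K * (norm (z - x))\<^sup>2" if "x \<in> frontier \<Omega>" "z \<in> frontier \<Omega>" for x z
    using quotient_le(2)[OF that] by (cases "x = z") (simp_all add: F_def divide_le_eq)
  with quotient_le(1) show ?thesis by blast
qed

end

section \<open>Second order jets of the distance to the boundary\<close>

lemma dist_bd_nonneg [simp]: "0 \<le> dist_bd \<Omega> x"
  by (simp add: dist_bd_def infdist_nonneg)

lemma dist_bd_le: "p \<in> frontier \<Omega> \<Longrightarrow> dist_bd \<Omega> x \<le> norm (x - p)"
  unfolding dist_bd_def by (metis dist_norm infdist_le)

lemma dist_bd_attained:
  assumes "frontier \<Omega> \<noteq> {}"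
  obtains p where "p \<in> frontier \<Omega>" "dist_bd \<Omega> x = norm (x - p)"
  using infdist_attains_inf[OF frontier_closed assms, of x] unfolding dist_bd_def dist_norm by blast

lemma dist_bd_le_add: "dist_bd \<Omega> y \<le> dist_bd \<Omega> x + norm (y - x)"
  unfolding dist_bd_def by (metis dist_norm infdist_triangle)

lemma continuous_on_dist_bd [continuous_intros]: "continuous_on S (dist_bd \<Omega>)"
  unfolding dist_bd_def by (intro continuous_intros)

lemma isCont_dist_bd: "isCont (dist_bd \<Omega>) x"
  using continuous_on_dist_bd[of UNIV \<Omega>] by (simp add: continuous_on_eq_continuous_at)

lemma dist_bd_pos:
  assumes "open \<Omega>" "frontier \<Omega> \<noteq> {}" "x \<in> \<Omega>"
  shows "dist_bd \<Omega> x > 0"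
proof -
  have "x \<notin> frontier \<Omega>" using assms by (simp add: frontier_def interior_open)
  then show ?thesis unfolding dist_bd_def
    using infdist_pos_not_in_closed[OF frontier_closed assms(2)] by blast
qed

lemma dist_bd_le_norm_diff:
  assumes "x \<in> \<Omega>" "y \<notin> \<Omega>"
  shows "dist_bd \<Omega> x \<le> norm (y - x)"
proof -
  have "closed_segment x y \<inter> frontier \<Omega> \<noteq> {}"
    using assms by (intro connected_Int_frontier) auto
  then obtain z where z: "z \<in> closed_segment x y" "z \<in> frontier \<Omega>" by blast
  have "dist_bd \<Omega> x \<le> norm (z - x)"
    using dist_bd_le[OF z(2), of x] by (simp add: norm_minus_commute)
  also have "\<dots> \<le> norm (y - x)" by (rule segment_bound(1)[OF z(1)])
  finally show ?thesis .
qed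

lemma eventually_nhds_0_norm_less: "r > 0 \<Longrightarrow> \<forall>\<^sub>F h in nhds 0. norm h < r"
  by (auto simp: eventually_nhds_metric)

lemma tangent_proj_decompose: "tangent_proj v *v h + (v \<bullet> h) *\<^sub>R v = h"
  by (simp add: tangent_proj_mult_vec)

lemma norm_tangent_add_normal:
  assumes "norm v = 1" "v \<bullet> \<tau> = 0"
  shows "(norm (\<tau> + t *\<^sub>R v))\<^sup>2 = (norm \<tau>)\<^sup>2 + t\<^sup>2"
proof -
  have "v \<bullet> v = 1" using assms by (simp add: norm_eq_1)
  then show ?thesis unfolding power2_norm_eq_inner using assms(2)
    by (simp add: inner_add inner_commute power2_eq_square)
qed

lemma inner_tangent_proj_self:
  assumes "norm v = 1"
  shows "h \<bullet> (tangent_proj v *v h) = (norm (tangent_proj v *v h))\<^sup>2"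
proof -
  have "v \<bullet> v = 1" using assms by (simp add: norm_eq_1)
  then show ?thesis
    unfolding power2_norm_eq_inner tangent_proj_mult_vec
    by (simp add: inner_diff inner_commute)
qed

lemma norm_tangent_proj_le:
  assumes "norm v = 1"
  shows "norm (tangent_proj v *v h) \<le> norm h"
proof (rule power2_le_imp_le)
  have "(norm h)\<^sup>2 = (norm (tangent_proj v *v h))\<^sup>2 + (v \<bullet> h)\<^sup>2"
    using norm_tangent_add_normal[OF assms inner_tangent_proj[OF assms], of h "v \<bullet> h"]
    by (simp add: tangent_proj_decompose)
  then show "(norm (tangent_proj v *v h))\<^sup>2 \<le> (norm h)\<^sup>2" by simp
qed simp

lemma quadratic_form_add_kernel:
  fixes A :: "real^'n^'n"
  assumes "transpose A = A" "A *v v = 0"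
  shows "(w + t *\<^sub>R v) \<bullet> (A *v (w + t *\<^sub>R v)) = w \<bullet> (A *v w)"
  using inner_symmetric_matrix[OF assms(1), of v w]
  by (simp add: matrix_vector_right_distrib matrix_vector_mult_scaleR assms(2) inner_add)

lemma quadratic_form_tangent_proj:
  fixes A :: "real^'n^'n"
  assumes "transpose A = A" "A *v v = 0"
  shows "(tangent_proj v *v h) \<bullet> (A *v (tangent_proj v *v h)) = h \<bullet> (A *v h)"
  using quadratic_form_add_kernel[OF assms, of "tangent_proj v *v h" "v \<bullet> h"]
  by (simp add: tangent_proj_decompose)

lemma quadratic_form_plus_tangent_proj:
  fixes A :: "real^'n^'n"
  assumes A: "transpose A = A" "A *v v = 0" and "norm v = 1"
  shows "h \<bullet> ((A + \<eta> *\<^sub>R tangent_proj v) *v h)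
    = (tangent_proj v *v h) \<bullet> (A *v (tangent_proj v *v h)) + \<eta> * (norm (tangent_proj v *v h))\<^sup>2"
  using inner_tangent_proj_self[OF \<open>norm v = 1\<close>]
  by (simp add: matrix_vector_mult_add_rdistrib scaleR_matrix_vector_assoc[symmetric]
    inner_add_right quadratic_form_tangent_proj[OF A])

definition paraboloid :: "real^'n^'n \<Rightarrow> real \<Rightarrow> real^'n \<Rightarrow> real" where
  "paraboloid A \<eta> w = (w \<bullet> (A *v w)) / 2 + \<eta> / 4 * (norm w)\<^sup>2"

context
  fixes A :: "real^'n^'n" and \<eta> K :: real
  assumes sym: "transpose A = A" and "\<eta> > 0" and K: "norm A + \<eta> \<le> K"
begin

lemma bilinear_form_plus_scaled_norms_le:
  "\<bar>x \<bullet> (A *v y)\<bar> + \<eta> * (norm x * norm y) \<le> K * (norm x * norm y)"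
proof -
  have "\<bar>x \<bullet> (A *v y)\<bar> \<le> norm A * (norm x * norm y)"
    using abs_bilinear_form_le[of x A y] by (simp add: mult.assoc)
  then show ?thesis using mult_right_mono[OF K, of "norm x * norm y"] by (simp add: algebra_simps)
qed

lemma abs_paraboloid_le: "\<bar>paraboloid A \<eta> x\<bar> + \<eta> / 4 * (norm x)\<^sup>2 \<le> K * (norm x)\<^sup>2"
proof -
  have "\<eta> * (norm x)\<^sup>2 \<ge> 0" using \<open>\<eta> > 0\<close> by simp
  moreover have "\<bar>x \<bullet> (A *v x)\<bar> + \<eta> * (norm x)\<^sup>2 \<le> K * (norm x)\<^sup>2"
    using bilinear_form_plus_scaled_norms_le[of x x] by (simp add: power2_eq_square)
  ultimately show ?thesis unfolding paraboloid_def by (simp add: abs_le_iff)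
qed

lemma paraboloid_increment_le:
  "paraboloid A \<eta> v \<le> paraboloid A \<eta> w + \<eta> / 4 * (norm w)\<^sup>2 + (K + K\<^sup>2 / \<eta>) * (norm (v - w))\<^sup>2"
proof -
  define e where "e = v - w"
  have "paraboloid A \<eta> v = paraboloid A \<eta> w + (w \<bullet> (A *v e) + \<eta> / 2 * (w \<bullet> e)) + paraboloid A \<eta> e"
    using inner_symmetric_matrix[OF sym, of w e]
    by (simp add: paraboloid_def e_def power2_norm_eq_inner matrix_vector_mult_diff_distrib inner_diff
      inner_commute diff_divide_distrib add_divide_distrib algebra_simps)
  moreover have "w \<bullet> (A *v e) + \<eta> / 2 * (w \<bullet> e) \<le> K * norm w * norm e"
  proof -
    have "\<eta> * (w \<bullet> e) \<le> \<eta> * (norm w * norm e)" "0 \<le> \<eta> * (norm w * norm e)"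
      using \<open>\<eta> > 0\<close> by (simp_all add: norm_cauchy_schwarz)
    then show ?thesis using bilinear_form_plus_scaled_norms_le[of w e] by (simp add: mult.assoc)
  qed
  moreover have "paraboloid A \<eta> e \<le> K * (norm e)\<^sup>2"
  proof -
    have "0 \<le> \<eta> / 4 * (norm e)\<^sup>2" using \<open>\<eta> > 0\<close> by simp
    then show ?thesis using abs_paraboloid_le[of e] by linarith
  qed
  moreover have "K * norm w * norm e \<le> \<eta> / 4 * (norm w)\<^sup>2 + K\<^sup>2 / \<eta> * (norm e)\<^sup>2"
  proof -
    have "0 \<le> (\<eta> / 2 * norm w - K * norm e)\<^sup>2" by simp
    then have "\<eta> * (K * norm w * norm e) \<le> \<eta> * (\<eta> / 4 * (norm w)\<^sup>2 + K\<^sup>2 / \<eta> * (norm e)\<^sup>2)"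
      using \<open>\<eta> > 0\<close> by (simp add: power2_eq_square algebra_simps)
    then show ?thesis using \<open>\<eta> > 0\<close> by (simp only: mult_le_cancel_left_pos)
  qed
  ultimately show ?thesis unfolding e_def[symmetric] distrib_right by linarith
qed

text \<open>Seen from the point at height \<open>a\<close> over \<open>w\<close>, no point below the flat paraboloid is much closer
  than the point of the paraboloid over \<open>w\<close>.\<close>

lemma paraboloid_distance:
  assumes low: "3 * a * (K + K\<^sup>2 / \<eta>) \<le> 1" and flat: "K * (norm v)\<^sup>2 + 2 * K * (norm w)\<^sup>2 \<le> a"
    and below: "c \<le> paraboloid A \<eta> v"
  shows "(a - (paraboloid A \<eta> w + \<eta> / 4 * (norm w)\<^sup>2))\<^sup>2 \<le> (norm (w - v))\<^sup>2 + (a - c)\<^sup>2"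
proof -
  define q where "q = paraboloid A \<eta>"
  define q' where "q' = q w + \<eta> / 4 * (norm w)\<^sup>2"
  define T where "T = 2 * a - q v - q'"
  have "K > 0" using K \<open>\<eta> > 0\<close> norm_ge_zero[of A] by linarith
  have "0 \<le> T" "T \<le> 3 * a" "0 \<le> a - q v"
  proof -
    have "0 \<le> K * (norm w)\<^sup>2" "0 \<le> \<eta> / 4 * (norm w)\<^sup>2" "0 \<le> \<eta> / 4 * (norm v)\<^sup>2"
      using \<open>K > 0\<close> \<open>\<eta> > 0\<close> by simp_all
    then show "0 \<le> T" "T \<le> 3 * a" "0 \<le> a - q v"
      using abs_paraboloid_le[of v] abs_paraboloid_le[of w] flat
      unfolding T_def q'_def q_def by linarith+
  qed
  have "- ((K + K\<^sup>2 / \<eta>) * (norm (v - w))\<^sup>2) \<le> q' - q v"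
    using paraboloid_increment_le[of v w] by (simp add: q'_def q_def)
  from mult_left_mono[OF this \<open>0 \<le> T\<close>]
  have "- (T * (K + K\<^sup>2 / \<eta>) * (norm (v - w))\<^sup>2) \<le> T * (q' - q v)" by (simp add: mult.assoc)
  moreover have "T * (K + K\<^sup>2 / \<eta>) * (norm (v - w))\<^sup>2 \<le> 1 * (norm (v - w))\<^sup>2"
  proof (rule mult_right_mono)
    have "T * (K + K\<^sup>2 / \<eta>) \<le> 3 * a * (K + K\<^sup>2 / \<eta>)"
      using \<open>T \<le> 3 * a\<close> \<open>K > 0\<close> \<open>\<eta> > 0\<close> by (intro mult_right_mono) auto
    with low show "T * (K + K\<^sup>2 / \<eta>) \<le> 1" by linarith
  qed simp
  moreover have "(a - q v)\<^sup>2 - (a - q')\<^sup>2 = T * (q' - q v)"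
    by (simp add: T_def power2_eq_square algebra_simps)
  moreover have "(a - q v)\<^sup>2 \<le> (a - c)\<^sup>2"
    using \<open>0 \<le> a - q v\<close> below by (intro power_mono) (auto simp: q_def)
  ultimately show ?thesis by (simp add: q'_def q_def norm_minus_commute)
qed

end

context C2_domain
begin

abbreviation "d \<equiv> dist_bd \<Omega>"

lemma d_pos: "x \<in> \<Omega> \<Longrightarrow> d x > 0"
  by (rule dist_bd_pos[OF open_\<Omega> frontier_nonempty])

lemma nearest_point_normal:
  assumes x: "x \<in> \<Omega>" and p: "p \<in> frontier \<Omega>" "d x = norm (x - p)"
  shows "x = p + d x *\<^sub>R \<nu> p"
proof -
  obtain U g G D where g: "p \<in> U" "defining_function \<Omega> U g G D" "g p = 0" "G p = \<nu> p"
    using adaptedE[OF p(1)] by metis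
  have "x \<noteq> p" using d_pos[OF x] p(2) by auto
  have "sgn (2 *\<^sub>R (x - p)) = sgn (\<nu> p)"
  proof (rule sgn_gradient_eq)
    show "((\<lambda>y. (d x)\<^sup>2 - (y - x) \<bullet> (y - x)) has_derivative (\<lambda>h. (2 *\<^sub>R (x - p)) \<bullet> h)) (at p)"
      by (rule derivative_eq_intros refl | simp add: inner_diff inner_commute algebra_simps)+
    show "(g has_derivative (\<lambda>h. \<nu> p \<bullet> h)) (at p)"
      using C2_onD(2)[OF defining_functionD(1)[OF g(2)] g(1)] by (simp add: g(4))
    show "(d x)\<^sup>2 - (p - x) \<bullet> (p - x) = 0"
      unfolding p(2) by (simp add: power2_norm_eq_inner inner_diff inner_commute)
    have "\<forall>\<^sub>F y in nhds p. y \<in> U" using g by (intro eventually_nhds_in_open defining_functionD(2))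
    then show "\<forall>\<^sub>F y in nhds p. 0 < (d x)\<^sup>2 - (y - x) \<bullet> (y - x) \<longrightarrow> 0 \<le> g y"
    proof eventually_elim
      case (elim y)
      have "y \<in> \<Omega>" if "(norm (y - x))\<^sup>2 < (d x)\<^sup>2"
        using power_less_imp_less_base[OF that] dist_bd_le_norm_diff[OF x, of y] by fastforce
      then show ?case using defining_functionD(3)[OF g(2) elim] by (auto simp: power2_norm_eq_inner)
    qed
    show "\<nu> p \<noteq> 0" using norm_normal[OF p(1)] by auto
  qed (use g(3) \<open>x \<noteq> p\<close> in auto)
  then have "(x - p) /\<^sub>R norm (x - p) = \<nu> p"
    using norm_normal[OF p(1)] by (simp add: sgn_scaleR sgn_div_norm)
  then have "x - p = norm (x - p) *\<^sub>R \<nu> p"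
    using \<open>x \<noteq> p\<close> by (metis divideR_right norm_eq_zero right_minus_eq)
  then show ?thesis unfolding p(2) by (simp add: algebra_simps)
qed

lemma eventually_lifted_tangent_point_outside:
  assumes p: "p \<in> frontier \<Omega>" and "e > 0"
  defines "t \<equiv> \<lambda>h. (h \<bullet> (C p *v h)) / 2 - e * (norm h)\<^sup>2"
  shows "\<forall>\<^sub>F h in nhds 0. \<bar>t h\<bar> \<le> norm h \<and> p + (tangent_proj (\<nu> p) *v h + t h *\<^sub>R \<nu> p) \<notin> \<Omega>"
proof -
  note unit = norm_normal[OF p] and sym = transpose_second_form[OF p]
    and kernel = second_form_normal[OF p]
  let ?T = "tangent_proj (\<nu> p)"
  define k where "k h = ?T *v h + t h *\<^sub>R \<nu> p" for h
  have "isCont k 0" "isCont (\<lambda>h. norm (C p) * norm h + e * norm h) 0"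
    unfolding k_def t_def
    by (intro continuous_intros linear_continuous_at; simp add: matrix_vector_mul_bounded_linear)+
  from this[THEN isCont_tendsto_nhds]
  have lim: "(k \<longlongrightarrow> 0) (nhds 0)" "((\<lambda>h. norm (C p) * norm h + e * norm h) \<longlongrightarrow> 0) (nhds 0)"
    by (simp_all add: k_def t_def)
  have "\<forall>\<^sub>F l in nhds 0. p + l \<in> \<Omega> \<longrightarrow> (l \<bullet> (C p *v l)) / 2 - e / 2 * (norm l)\<^sup>2 < \<nu> p \<bullet> l"
    using \<open>e > 0\<close> by (intro boundary_second_order(1)[OF p]) simp
  from eventually_compose_filterlim[OF this lim(1)] order_tendstoD(2)[OF lim(2) zero_less_one]
  show ?thesis
  proof eventually_elim
    case (elim h)
    have "\<bar>h \<bullet> (C p *v h)\<bar> \<le> norm (C p) * norm h * norm h" by (rule abs_bilinear_form_le)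
    moreover have "0 \<le> norm (C p) * norm h * norm h" "0 \<le> e * (norm h)\<^sup>2" using \<open>e > 0\<close> by auto
    ultimately have "\<bar>t h\<bar> \<le> (norm (C p) * norm h + e * norm h) * norm h"
      by (simp add: t_def abs_le_iff power2_eq_square algebra_simps)
    also have "\<dots> \<le> 1 * norm h" using elim(2) by (intro mult_right_mono) auto
    finally have t_le: "\<bar>t h\<bar> \<le> norm h" by simp
    have "(norm (k h))\<^sup>2 = (norm (?T *v h))\<^sup>2 + (t h)\<^sup>2"
      unfolding k_def by (rule norm_tangent_add_normal[OF unit inner_tangent_proj[OF unit]])
    also have "\<dots> \<le> (norm h)\<^sup>2 + (norm h)\<^sup>2"
      using norm_tangent_proj_le[OF unit, of h] t_le
      by (intro add_mono power_mono abs_le_square_iff[THEN iffD1]) auto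
    finally have "e / 2 * (norm (k h))\<^sup>2 \<le> e / 2 * (2 * (norm h)\<^sup>2)"
      using \<open>e > 0\<close> by (intro mult_left_mono) auto
    moreover have "k h \<bullet> (C p *v k h) = h \<bullet> (C p *v h)"
      unfolding k_def quadratic_form_add_kernel[OF sym kernel]
      by (rule quadratic_form_tangent_proj[OF sym kernel])
    moreover have "\<nu> p \<bullet> k h = t h" using unit by (simp add: k_def inner_add norm_eq_1)
    ultimately have "p + k h \<notin> \<Omega>" using elim(1) by (auto simp: t_def)
    with t_le show ?case by (simp add: k_def)
  qed
qed

lemma superjet_dist_bd:
  assumes x: "x \<in> \<Omega>" and p: "p \<in> frontier \<Omega>" "d x = norm (x - p)"
  shows "(\<nu> p, - C p) \<in> superjet d x"
proof (rule superjetI)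
  show "transpose (- C p) = - C p" by (simp add: transpose_uminus transpose_second_form[OF p(1)])
  fix e :: real assume "e > 0"
  note unit = norm_normal[OF p(1)]
  define t where "t h = (h \<bullet> (C p *v h)) / 2 - e * (norm h)\<^sup>2" for h
  have "\<forall>\<^sub>F h in nhds 0. x + h \<in> \<Omega>"
    using eventually_nhds_in_open[OF open_\<Omega> x] by (simp add: eventually_nhds_0_shift[of _ x])
  moreover have "\<forall>\<^sub>F h in nhds (0 :: real^'n). norm h < d x / 2"
    using d_pos[OF x] by (intro eventually_nhds_0_norm_less) simp
  moreover note eventually_lifted_tangent_point_outside[OF p(1) \<open>e > 0\<close>, folded t_def]
  ultimately show "\<forall>\<^sub>F h in nhds 0. d (x + h) \<le>
      d x + \<nu> p \<bullet> h + (h \<bullet> (- C p *v h)) / 2 + e * (norm h)\<^sup>2"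
  proof eventually_elim
    case (elim h)
    define k where "k = tangent_proj (\<nu> p) *v h + t h *\<^sub>R \<nu> p"
    have "d x *\<^sub>R \<nu> p = x - p" using nearest_point_normal[OF x p] by (simp add: algebra_simps)
    then have "p + k - (x + h) = (t h - d x - \<nu> p \<bullet> h) *\<^sub>R \<nu> p"
      by (simp add: k_def tangent_proj_mult_vec scaleR_left_diff_distrib)
    then have "norm (p + k - (x + h)) = \<bar>t h - d x - \<nu> p \<bullet> h\<bar>" by (simp add: unit)
    also have "\<dots> = d x + \<nu> p \<bullet> h - t h"
    proof -
      have "\<bar>\<nu> p \<bullet> h\<bar> \<le> norm h" using Cauchy_Schwarz_ineq2[of "\<nu> p" h] unit by simp
      then show ?thesis using elim(2,3) by linarith
    qed
    finally have "d (x + h) \<le> d x + \<nu> p \<bullet> h - t h"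
      using dist_bd_le_norm_diff[OF elim(1), of "p + k"] elim(3) by (simp add: k_def)
    then show ?case by (simp add: t_def matrix_vector_mult_uminus)
  qed
qed

lemma nearest_points_close:
  assumes chord: "\<bar>\<nu> p \<bullet> (z - p)\<bar> \<le> K * (norm (z - p))\<^sup>2" "4 * K * d x \<le> 1"
    and x: "x \<in> \<Omega>" and p: "p \<in> frontier \<Omega>" "d x = norm (x - p)"
    and z: "d y = norm (y - z)"
  shows "(norm (z - p))\<^sup>2 \<le> 8 * norm (y - x) * (d x + norm (y - x))"
proof -
  have "norm (x - z) \<le> norm (y - x) + norm (y - z)"
    using norm_triangle_ineq4[of "y - z" "y - x"] by simp
  also have "\<dots> \<le> d x + 2 * norm (y - x)" using dist_bd_le_add[of \<Omega> y x] z by simp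
  finally have "(norm (x - z))\<^sup>2 \<le> (d x + 2 * norm (y - x))\<^sup>2" by (intro power_mono) auto
  moreover have "(norm (x - z))\<^sup>2 = (d x)\<^sup>2 - 2 * d x * (\<nu> p \<bullet> (z - p)) + (norm (z - p))\<^sup>2"
  proof -
    have norm_diff: "(norm (a - b))\<^sup>2 = (norm a)\<^sup>2 - 2 * (a \<bullet> b) + (norm b)\<^sup>2" for a b :: "real^'n"
      unfolding power2_norm_eq_inner by (simp add: inner_diff inner_commute)
    have "x - z = d x *\<^sub>R \<nu> p - (z - p)"
      using nearest_point_normal[OF x p] by (simp add: algebra_simps)
    then have "(norm (x - z))\<^sup>2 = (norm (d x *\<^sub>R \<nu> p - (z - p)))\<^sup>2" by (rule arg_cong)
    then show ?thesis unfolding norm_diff by (simp add: norm_normal[OF p(1)])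
  qed
  moreover have "2 * d x * (\<nu> p \<bullet> (z - p)) \<le> (norm (z - p))\<^sup>2 / 2"
  proof -
    have "2 * d x * (\<nu> p \<bullet> (z - p)) \<le> 2 * d x * (K * (norm (z - p))\<^sup>2)"
      using chord(1) by (intro mult_left_mono) auto
    also have "\<dots> = (4 * K * d x) * ((norm (z - p))\<^sup>2 / 2)" by simp
    also have "\<dots> \<le> 1 * ((norm (z - p))\<^sup>2 / 2)" using chord(2) by (intro mult_right_mono) auto
    finally show ?thesis by simp
  qed
  ultimately show ?thesis by (simp add: power2_eq_square algebra_simps)
qed

lemma boundary_below_paraboloid:
  assumes p: "p \<in> frontier \<Omega>" and "\<eta> > 0"
  shows "\<forall>\<^sub>F h in nhds 0. p + h \<in> frontier \<Omega> \<longrightarrow>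
    \<nu> p \<bullet> h \<le> paraboloid (C p) \<eta> (tangent_proj (\<nu> p) *v h)"
proof -
  let ?T = "tangent_proj (\<nu> p)"
  note unit = norm_normal[OF p]
  obtain K where "K > 0" and chord: "\<And>z. z \<in> frontier \<Omega> \<Longrightarrow> \<bar>\<nu> p \<bullet> (z - p)\<bar> \<le> K * (norm (z - p))\<^sup>2"
    using normal_chord_quadratic p by blast
  have "\<forall>\<^sub>F h in nhds 0. p + h \<notin> \<Omega> \<longrightarrow> \<nu> p \<bullet> h \<le> (h \<bullet> (C p *v h)) / 2 + \<eta> / 8 * (norm h)\<^sup>2"
    using \<open>\<eta> > 0\<close> by (intro boundary_second_order(2)[OF p]) simp
  moreover have "\<forall>\<^sub>F h in nhds (0 :: real^'n). norm h < 1 / (2 * K)"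
    using \<open>K > 0\<close> by (intro eventually_nhds_0_norm_less) simp
  ultimately show ?thesis
  proof (eventually_elim, intro impI)
    case (elim h)
    let ?c = "\<nu> p \<bullet> h"
    assume on_frontier: "p + h \<in> frontier \<Omega>"
    then have "p + h \<notin> \<Omega>" using open_\<Omega> by (simp add: frontier_def interior_open)
    have "K * norm h \<le> 1 / 2" using elim(2) \<open>K > 0\<close> by (simp add: field_simps)
    from mult_right_mono[OF this, of "norm h"] have "\<bar>?c\<bar> \<le> norm h / 2"
      using chord[OF on_frontier] by (simp add: power2_eq_square mult.assoc)
    then have "?c\<^sup>2 \<le> (norm h)\<^sup>2 / 4"
      using power_mono[of "\<bar>?c\<bar>" "norm h / 2" 2] by (simp add: power_divide)
    moreover have "(norm h)\<^sup>2 = (norm (?T *v h))\<^sup>2 + ?c\<^sup>2"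
      using norm_tangent_add_normal[OF unit inner_tangent_proj[OF unit], of h ?c]
      by (simp add: tangent_proj_decompose)
    ultimately have "(norm h)\<^sup>2 \<le> 2 * (norm (?T *v h))\<^sup>2"
      using zero_le_power2[of "norm h"] by linarith
    then have "\<eta> / 8 * (norm h)\<^sup>2 \<le> \<eta> / 8 * (2 * (norm (?T *v h))\<^sup>2)"
      using \<open>\<eta> > 0\<close> by (intro mult_left_mono) auto
    moreover have "?c \<le> (h \<bullet> (C p *v h)) / 2 + \<eta> / 8 * (norm h)\<^sup>2"
      using elim(1) \<open>p + h \<notin> \<Omega>\<close> by blast
    ultimately show "?c \<le> paraboloid (C p) \<eta> (?T *v h)"
      by (simp add: paraboloid_def
          quadratic_form_tangent_proj[OF transpose_second_form[OF p] second_form_normal[OF p]])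
  qed
qed

lemma norm_diff_tangent_normal:
  assumes x: "x \<in> \<Omega>" and p: "p \<in> frontier \<Omega>" "d x = norm (x - p)"
  shows "(norm (x + h - z))\<^sup>2
    = (norm (tangent_proj (\<nu> p) *v h - tangent_proj (\<nu> p) *v (z - p)))\<^sup>2
      + (d x + \<nu> p \<bullet> h - \<nu> p \<bullet> (z - p))\<^sup>2"
proof -
  note unit = norm_normal[OF p(1)]
  let ?w = "tangent_proj (\<nu> p) *v h - tangent_proj (\<nu> p) *v (z - p)"
  have "x + h - z = ?w + (d x + \<nu> p \<bullet> h - \<nu> p \<bullet> (z - p)) *\<^sub>R \<nu> p"
    using nearest_point_normal[OF x p] by (simp add: tangent_proj_mult_vec algebra_simps)
  moreover have "\<nu> p \<bullet> ?w = 0" by (simp add: inner_diff_right unit)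
  ultimately show ?thesis using norm_tangent_add_normal[OF unit] by simp
qed

text \<open>Small \<open>d x\<close> makes the nearest boundary point unique, so that the nearest points of \<open>x + h\<close>
  stay close to \<open>p\<close>, where the boundary lies below a paraboloid.\<close>

lemma eventually_nearest_point_below_paraboloid:
  assumes chord: "\<forall>z\<in>frontier \<Omega>. \<bar>\<nu> p \<bullet> (z - p)\<bar> \<le> K * (norm (z - p))\<^sup>2" "4 * K * d x \<le> 1"
    and x: "x \<in> \<Omega>" and p: "p \<in> frontier \<Omega>" "d x = norm (x - p)" and "\<eta> > 0" "L \<ge> 0"
  defines "T \<equiv> tangent_proj (\<nu> p)"
  shows "\<forall>\<^sub>F h in nhds 0. \<forall>z\<in>frontier \<Omega>. d (x + h) = norm (x + h - z) \<longrightarrow>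
    \<nu> p \<bullet> (z - p) \<le> paraboloid (C p) \<eta> (T *v (z - p)) \<and>
    L * (norm (T *v (z - p)))\<^sup>2 + 2 * L * (norm (T *v h))\<^sup>2 \<le> d x + \<nu> p \<bullet> h"
proof -
  note unit = norm_normal[OF p(1)]
  obtain r where r: "r > 0" "\<And>l. norm l < r \<Longrightarrow> p + l \<in> frontier \<Omega> \<Longrightarrow>
      \<nu> p \<bullet> l \<le> paraboloid (C p) \<eta> (T *v l)"
    using boundary_below_paraboloid[OF p(1) \<open>\<eta> > 0\<close>] unfolding eventually_nhds_metric T_def by auto
  define \<omega> where "\<omega> h = 8 * norm h * (d x + norm h)" for h :: "real^'n"
  have "isCont \<omega> 0" "isCont (\<lambda>h. L * \<omega> h + 2 * L * (norm h)\<^sup>2 - (d x + \<nu> p \<bullet> h)) 0"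
    unfolding \<omega>_def by (intro continuous_intros)+
  from this[THEN isCont_tendsto_nhds] have lim: "(\<omega> \<longlongrightarrow> 0) (nhds 0)"
    "((\<lambda>h. L * \<omega> h + 2 * L * (norm h)\<^sup>2 - (d x + \<nu> p \<bullet> h)) \<longlongrightarrow> - d x) (nhds 0)"
    by (simp_all add: \<omega>_def)
  then have "\<forall>\<^sub>F h in nhds 0. \<omega> h < r\<^sup>2"
      "\<forall>\<^sub>F h in nhds 0. L * \<omega> h + 2 * L * (norm h)\<^sup>2 - (d x + \<nu> p \<bullet> h) < 0"
    using order_tendstoD(2)[OF lim(1), of "r\<^sup>2"] order_tendstoD(2)[OF lim(2), of 0] r(1) d_pos[OF x]
    by simp_all
  then show ?thesis
  proof (eventually_elim, intro ballI impI conjI)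
    case (elim h)
    fix z assume z: "z \<in> frontier \<Omega>" "d (x + h) = norm (x + h - z)"
    have close: "(norm (z - p))\<^sup>2 \<le> \<omega> h"
      using nearest_points_close[OF chord(1)[rule_format, OF z(1)] chord(2) x p z(2)]
      by (simp add: \<omega>_def)
    then have "norm (z - p) < r" using elim(1) r(1) by (simp add: power2_less_imp_less)
    then show "\<nu> p \<bullet> (z - p) \<le> paraboloid (C p) \<eta> (T *v (z - p))"
      using r(2)[of "z - p"] z(1) by simp
    have T_le: "(norm (T *v l))\<^sup>2 \<le> (norm l)\<^sup>2" for l
      unfolding T_def using norm_tangent_proj_le[OF unit] by (intro power_mono) auto
    have "L * (norm (T *v (z - p)))\<^sup>2 + 2 * L * (norm (T *v h))\<^sup>2 \<le> L * \<omega> h + 2 * L * (norm h)\<^sup>2"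
      using \<open>L \<ge> 0\<close> order_trans[OF T_le close] T_le by (intro add_mono mult_left_mono) auto
    then show "L * (norm (T *v (z - p)))\<^sup>2 + 2 * L * (norm (T *v h))\<^sup>2 \<le> d x + \<nu> p \<bullet> h"
      using elim(2) by simp
  qed
qed

lemma subjet_dist_bd_near:
  assumes chord: "\<forall>z\<in>frontier \<Omega>. \<bar>\<nu> p \<bullet> (z - p)\<bar> \<le> K * (norm (z - p))\<^sup>2" "4 * K * d x \<le> 1"
    and curvature: "norm (C p) + \<eta> \<le> L" "3 * d x * (L + L\<^sup>2 / \<eta>) < 1"
    and x: "x \<in> \<Omega>" and p: "p \<in> frontier \<Omega>" "d x = norm (x - p)" and "\<eta> > 0"
  shows "(\<nu> p, - (C p + \<eta> *\<^sub>R tangent_proj (\<nu> p))) \<in> subjet d x"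
proof (rule subjetI)
  note unit = norm_normal[OF p(1)] and sym = transpose_second_form[OF p(1)]
      and kernel = second_form_normal[OF p(1)]
  let ?T = "tangent_proj (\<nu> p)" and ?q = "paraboloid (C p) \<eta>"
  show "transpose (- (C p + \<eta> *\<^sub>R ?T)) = - (C p + \<eta> *\<^sub>R ?T)"
    by (simp add: transpose_uminus transpose_diff transpose_scalar sym)
  fix e :: real assume "e > 0"
  have "L \<ge> 0" using curvature(1) \<open>\<eta> > 0\<close> norm_ge_zero[of "C p"] by linarith
  define a where "a h = d x + \<nu> p \<bullet> h" for h
  have "isCont (\<lambda>h. 3 * a h * (L + L\<^sup>2 / \<eta>)) 0" unfolding a_def by (intro continuous_intros)
  from isCont_tendsto_nhds[OF this]
  have "((\<lambda>h. 3 * a h * (L + L\<^sup>2 / \<eta>)) \<longlongrightarrow> 3 * d x * (L + L\<^sup>2 / \<eta>)) (nhds 0)"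
    by (simp add: a_def)
  from order_tendstoD(2)[OF this curvature(2)]
    eventually_nearest_point_below_paraboloid[OF chord x p \<open>\<eta> > 0\<close> \<open>L \<ge> 0\<close>]
  show "\<forall>\<^sub>F h in nhds 0.
      d x + \<nu> p \<bullet> h + (h \<bullet> (- (C p + \<eta> *\<^sub>R ?T) *v h)) / 2 - e * (norm h)\<^sup>2 \<le> d (x + h)"
  proof eventually_elim
    case (elim h)
    obtain z where z: "z \<in> frontier \<Omega>" "d (x + h) = norm (x + h - z)"
      using dist_bd_attained[OF frontier_nonempty] by blast
    define v where "v = ?T *v (z - p)"
    define c where "c = \<nu> p \<bullet> (z - p)"
    have "c \<le> ?q v" "L * (norm v)\<^sup>2 + 2 * L * (norm (?T *v h))\<^sup>2 \<le> a h"
      using elim(2) z by (simp_all add: c_def v_def a_def)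
    then have "(a h - (?q (?T *v h) + \<eta> / 4 * (norm (?T *v h))\<^sup>2))\<^sup>2 \<le>
        (norm (?T *v h - v))\<^sup>2 + (a h - c)\<^sup>2"
      using elim(1) by (intro paraboloid_distance[OF sym \<open>\<eta> > 0\<close> curvature(1)]) auto
    also have "\<dots> = (norm (x + h - z))\<^sup>2"
      unfolding v_def c_def a_def by (rule norm_diff_tangent_normal[OF x p, symmetric])
    finally have "a h - (?q (?T *v h) + \<eta> / 4 * (norm (?T *v h))\<^sup>2) \<le> d (x + h)"
      unfolding z(2) by (rule power2_le_imp_le) simp
    moreover have "0 \<le> e * (norm h)\<^sup>2" using \<open>e > 0\<close> by simp
    ultimately show ?case
      unfolding matrix_vector_mult_uminus inner_minus_right
        quadratic_form_plus_tangent_proj[OF sym kernel unit]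
        a_def paraboloid_def by (simp add: diff_divide_distrib)
  qed
qed

lemma second_form_bounded: "\<exists>K. \<forall>p\<in>frontier \<Omega>. norm (C p) \<le> K"
  using compact_imp_bounded
      [OF compact_continuous_image[OF continuous_on_second_form compact_frontier_\<Omega>]]
  by (auto simp: bounded_iff)

lemma subjet_dist_bd:
  assumes "\<eta> > 0"
  shows "\<exists>\<delta>>0. \<forall>x\<in>\<Omega>. d x < \<delta> \<longrightarrow> (\<forall>p\<in>frontier \<Omega>. d x = norm (x - p) \<longrightarrow>
    (\<nu> p, - (C p + \<eta> *\<^sub>R tangent_proj (\<nu> p))) \<in> subjet d x)"
proof -
  obtain K where "K > 0"
    and chord: "\<And>p z. p \<in> frontier \<Omega> \<Longrightarrow> z \<in> frontier \<Omega> \<Longrightarrow> \<bar>\<nu> p \<bullet> (z - p)\<bar> \<le> K * (norm (z - p))\<^sup>2"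
    using normal_chord_quadratic by blast
  obtain K' where second_form_le: "\<And>p. p \<in> frontier \<Omega> \<Longrightarrow> norm (C p) \<le> K'"
    using second_form_bounded by blast
  define L where "L = \<bar>K'\<bar> + \<eta>"
  have "L > 0" using \<open>\<eta> > 0\<close> by (simp add: L_def add_nonneg_pos)
  then have "L + L\<^sup>2 / \<eta> > 0" using \<open>\<eta> > 0\<close> by (simp add: add_pos_pos)
  define \<delta> where "\<delta> = min (1 / (4 * K)) (1 / (3 * (L + L\<^sup>2 / \<eta>)))"
  have "\<delta> > 0" using \<open>K > 0\<close> \<open>L + L\<^sup>2 / \<eta> > 0\<close> by (simp add: \<delta>_def)
  moreover have "(\<nu> p, - (C p + \<eta> *\<^sub>R tangent_proj (\<nu> p))) \<in> subjet d x"
    if "x \<in> \<Omega>" "d x < \<delta>" "p \<in> frontier \<Omega>" "d x = norm (x - p)" for x p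
  proof (rule subjet_dist_bd_near[OF _ _ _ _ that(1,3,4) \<open>\<eta> > 0\<close>])
    show "\<forall>z\<in>frontier \<Omega>. \<bar>\<nu> p \<bullet> (z - p)\<bar> \<le> K * (norm (z - p))\<^sup>2" using chord[OF that(3)] by blast
    have "d x < 1 / (4 * K)" "d x < 1 / (3 * (L + L\<^sup>2 / \<eta>))" using that(2) by (simp_all add: \<delta>_def)
    then show "4 * K * d x \<le> 1" "3 * d x * (L + L\<^sup>2 / \<eta>) < 1"
      using \<open>K > 0\<close> \<open>L + L\<^sup>2 / \<eta> > 0\<close> by (simp_all add: less_divide_eq mult_ac)
    show "norm (C p) + \<eta> \<le> L" using second_form_le[OF that(3)] by (simp add: L_def)
  qed
  ultimately show ?thesis by blast
qed

end

section \<open>The blow-up profile\<close>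

lemma
  fixes h :: "real \<Rightarrow> real"
  assumes "t > 0" and mono: "mono_on {0<..t} h" and pos: "\<And>s. 0 < s \<Longrightarrow> s \<le> t \<Longrightarrow> h s > 0"
  shows mono_pos_integrable: "h integrable_on {0..t}"
    and mono_pos_integral_pos: "0 < integral {0..t} h"
    and mono_pos_integral_le: "integral {0..t} h \<le> t * h t"
proof -
  define g where "g s = (if s \<le> 0 then 0 else h s)" for s
  have "mono_on {0..t} g"
    using pos mono by (auto simp: mono_on_def g_def intro: less_imp_le)
  then have g: "g integrable_on {0..t}" by (rule integrable_on_mono_on)
  then show "h integrable_on {0..t}"
    by (rule integrable_spike_finite[of "{0}", rotated 2]) (auto simp: g_def)
  have integral_eq: "integral {0..t} h = integral {0..t} g"
    by (rule integral_spike[of "{0}"]) (auto simp: g_def)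
  have "integral {0..t} g \<le> integral {0..t} (\<lambda>_. h t)"
    using g mono pos \<open>t > 0\<close> by (intro integral_le) (auto simp: g_def mono_on_def less_imp_le)
  then show "integral {0..t} h \<le> t * h t" using integral_eq \<open>t > 0\<close> by simp
  have "g integrable_on {t/2..t}" by (rule integrable_on_subinterval[OF g]) (use \<open>t > 0\<close> in auto)
  have "0 < integral {t/2..t} (\<lambda>_. h (t/2))" using pos[of "t/2"] \<open>t > 0\<close> by simp
  also have "\<dots> \<le> integral {t/2..t} g"
    using \<open>g integrable_on {t/2..t}\<close> mono \<open>t > 0\<close>
    by (intro integral_le) (auto simp: g_def mono_on_def)
  also have "\<dots> \<le> integral {0..t} g"
    using g \<open>g integrable_on {t/2..t}\<close> pos \<open>t > 0\<close>
    by (intro integral_subset_le) (auto simp: g_def less_imp_le)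
  finally show "0 < integral {0..t} h" using integral_eq by simp
qed

lemma has_real_derivative_integral_interior:
  fixes h :: "real \<Rightarrow> real"
  assumes int: "\<And>t. t \<in> {a<..<c} \<Longrightarrow> h integrable_on {a..t}" and cont: "continuous_on {a<..<c} h"
    and t: "t \<in> {a<..<c}"
  shows "((\<lambda>x. integral {a..x} h) has_real_derivative h t) (at t)"
proof -
  obtain l u where lu: "a < l" "l < t" "t < u" "u < c"
    using t dense by (metis greaterThanLessThan_iff)
  have "continuous_on {l..u} h" by (rule continuous_on_subset[OF cont]) (use lu in auto)
  then have "((\<lambda>x. integral {l..x} h) has_real_derivative h t) (at t within {l..u})"
    by (rule integral_has_real_derivative) (use lu in auto)
  then have "((\<lambda>x. integral {l..x} h) has_real_derivative h t) (at t)"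
    using lu by (simp add: at_within_Icc_at)
  then have "((\<lambda>x. integral {a..l} h + integral {l..x} h) has_real_derivative 0 + h t) (at t)"
    by (intro DERIV_add DERIV_const)
  moreover have "integral {a..l} h + integral {l..x} h = integral {a..x} h" if "x \<in> {l<..<u}" for x
    using that lu int[of x] by (intro Henstock_Kurzweil_Integration.integral_combine) auto
  ultimately show ?thesis
    using lu has_field_derivative_transform_within_open[of _ _ t "{l<..<u}" "\<lambda>x. integral {a..x} h"]
    by auto
qed

lemma integral_to_infinity:
  fixes g :: "real \<Rightarrow> real"
  assumes "g integrable_on {s..}"
  shows "((\<lambda>x. integral {s..x} g) \<longlongrightarrow> integral {s..} g) at_top"
proof (rule tendstoI)
  fix e :: real assume "e > 0"
  have "(g has_integral integral {s..} g) {s..}" using assms by (simp add: integrable_integral)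
  then obtain B where B: "B > 0" "\<And>a b. ball 0 B \<subseteq> cbox a b \<Longrightarrow>
      norm (integral (cbox a b) (\<lambda>x. if x \<in> {s..} then g x else 0) - integral {s..} g) < e"
    using \<open>e > 0\<close> unfolding has_integral_alt' by blast
  have "dist (integral {s..x} g) (integral {s..} g) < e" if x: "x \<ge> max B \<bar>s\<bar>" for x
  proof -
    have "integral {-x..x} (\<lambda>x. if x \<in> {s..} then g x else 0) = integral ({-x..x} \<inter> {s..}) g"
      using integral_restrict_Int[of "{-x..x}" "{s..}" g] by (simp add: Int_commute)
    also have "{-x..x} \<inter> {s..} = {s..x}" using x by auto
    finally have "integral {-x..x} (\<lambda>x. if x \<in> {s..} then g x else 0) = integral {s..x} g" .
    moreover have "ball 0 B \<subseteq> cbox (- x) x" using x by (auto simp: dist_real_def)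
    ultimately show ?thesis using B(2)[of "- x" x] by (simp add: dist_norm)
  qed
  then show "\<forall>\<^sub>F x in at_top. dist (integral {s..x} g) (integral {s..} g) < e"
    using eventually_at_top_linorder by blast
qed

locale keller_osserman =
  fixes k :: nat and f :: "real \<Rightarrow> real"
  assumes f_cont: "continuous_on {0<..} f" and f_pos: "\<And>s. s > 0 \<Longrightarrow> f s > 0"
    and f_mono: "mono_on {0<..} f"
    and inverse_H_integrable: "\<And>s. s > 0 \<Longrightarrow> (\<lambda>\<tau>. 1 / Hf k f \<tau>) integrable_on {s..}"
begin

abbreviation "H \<equiv> Hf k f"
abbreviation "\<Phi> \<equiv> Phi k f"
abbreviation "\<phi> \<equiv> varphi k f"

lemma Fint_deriv: "t > 0 \<Longrightarrow> (Fint f has_real_derivative f t) (at t)"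
proof -
  assume "t > 0"
  have "f integrable_on {0..s}" if "s > 0" for s
    by (rule mono_pos_integrable[OF that mono_on_subset[OF f_mono]]) (auto intro: f_pos)
  then show ?thesis
    unfolding Fint_def using \<open>t > 0\<close>
    by (intro has_real_derivative_integral_interior[where c = "t + 1",
        OF _ continuous_on_subset[OF f_cont]]) auto
qed

lemma Fint_pos: "t > 0 \<Longrightarrow> Fint f t > 0"
  unfolding Fint_def
  by (rule mono_pos_integral_pos[OF _ mono_on_subset[OF f_mono]]) (auto intro: f_pos)

lemma H_pos: "t > 0 \<Longrightarrow> H t > 0"
  using Fint_pos[of t] by (simp add: Hf_def)

lemma H_deriv: "t > 0 \<Longrightarrow> (H has_real_derivative f t / H t ^ k) (at t)"
proof -
  assume t: "t > 0"
  define n where "n = real (k + 1)"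
  have n_pos: "n > 0" by (simp add: n_def)
  have Fint_scaled_pos: "n * Fint f t > 0" using Fint_pos[OF t] n_pos by simp
  have H_eq: "H = (\<lambda>t. (n * Fint f t) powr (1 / n))" by (simp add: Hf_def n_def fun_eq_iff)
  have "((\<lambda>t. n * Fint f t) has_real_derivative n * f t) (at t)"
    by (rule DERIV_cmult[OF Fint_deriv[OF t]])
  from DERIV_powr[OF this Fint_scaled_pos DERIV_const[of "1 / n"]]
  have deriv: "(H has_real_derivative H t * (f t / (n * Fint f t))) (at t)"
    using n_pos by (simp add: H_eq)
  have H_power: "H t ^ k * H t = n * Fint f t"
  proof -
    have "H t ^ k * H t = H t powr n"
      using H_pos[OF t] by (simp add: n_def powr_realpow[symmetric] powr_add)
    also have "\<dots> = n * Fint f t" using n_pos Fint_scaled_pos by (simp add: H_eq powr_powr)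
    finally show ?thesis .
  qed
  have "H t * (f t / (n * Fint f t)) = f t / H t ^ k"
    unfolding H_power[symmetric] using H_pos[OF t] by simp
  with deriv show ?thesis by simp
qed

lemma H_cont: "continuous_on {0<..} H"
  by (intro continuous_at_imp_continuous_on) (auto intro: DERIV_isCont H_deriv)

lemma inverse_H_cont:
  assumes "S \<subseteq> {0<..}"
  shows "continuous_on S (\<lambda>\<tau>. 1 / H \<tau>)"
proof -
  have "H \<tau> \<noteq> 0" if "\<tau> \<in> S" for \<tau> using H_pos[of \<tau>] assms that by auto
  then show ?thesis by (intro continuous_intros continuous_on_subset[OF H_cont] assms) blast
qed

lemma \<Phi>_split:
  assumes "0 < a" "a \<le> s"
  shows "\<Phi> s = \<Phi> a - integral {a..s} (\<lambda>\<tau>. 1 / H \<tau>)"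
proof -
  let ?g = "\<lambda>\<tau>. 1 / H \<tau>"
  have "?g integrable_on {a..s}"
    using assms by (intro integrable_continuous_real inverse_H_cont) auto
  moreover have "?g integrable_on {s..}" using inverse_H_integrable assms by simp
  ultimately have "integral ({a..s} \<union> {s..}) ?g = integral {a..s} ?g + integral {s..} ?g"
    by (rule integral_Un) (rule negligible_subset[of "{s}"], auto)
  moreover have "{a..s} \<union> {s..} = {a..}" using assms by auto
  ultimately show ?thesis by (simp add: Phi_def)
qed

lemma \<Phi>_deriv:
  assumes "s > 0"
  shows "(\<Phi> has_real_derivative - (1 / H s)) (at s)"
proof -
  have "((\<lambda>x. integral {s/2..x} (\<lambda>\<tau>. 1 / H \<tau>)) has_real_derivative 1 / H s) (at s)"
    using assms
    by (intro has_real_derivative_integral_interior[where c = "s + 1"]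
        integrable_continuous_real inverse_H_cont) auto
  then have "((\<lambda>x. \<Phi> (s/2) - integral {s/2..x} (\<lambda>\<tau>. 1 / H \<tau>)) has_real_derivative 0 - 1 / H s) (at s)"
    by (intro DERIV_diff DERIV_const)
  then have "(\<Phi> has_real_derivative 0 - 1 / H s) (at s)"
    by (rule has_field_derivative_transform_within_open[where S = "{s/2<..}",
        OF _ _ _ \<Phi>_split[symmetric]])
      (use assms in auto)
  then show ?thesis by simp
qed

lemma \<Phi>_strict_antimono:
  assumes "0 < s" "s < t"
  shows "\<Phi> t < \<Phi> s"
proof (rule DERIV_neg_imp_decreasing[OF assms(2)])
  fix x assume "s \<le> x"
  then have "x > 0" using assms(1) by simp
  then have "- (1 / H x) < 0" using H_pos by simp
  then show "\<exists>y. (\<Phi> has_real_derivative y) (at x) \<and> y < 0" using \<Phi>_deriv[OF \<open>x > 0\<close>] by blast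
qed

lemma \<Phi>_cont: "continuous_on {0<..} \<Phi>"
  by (intro continuous_at_imp_continuous_on) (auto intro: DERIV_isCont \<Phi>_deriv)

lemma \<Phi>_tendsto_0: "(\<Phi> \<longlongrightarrow> 0) at_top"
proof -
  have "((\<lambda>x. \<Phi> 1 - integral {1..x} (\<lambda>\<tau>. 1 / H \<tau>)) \<longlongrightarrow> \<Phi> 1 - \<Phi> 1) at_top"
    unfolding Phi_def
    by (intro tendsto_diff tendsto_const integral_to_infinity inverse_H_integrable) simp
  moreover have "\<forall>\<^sub>F x in at_top. \<Phi> 1 - integral {1..x} (\<lambda>\<tau>. 1 / H \<tau>) = \<Phi> x"
    by (rule eventually_at_top_linorderI[of 1], rule \<Phi>_split[symmetric]) auto
  ultimately have "(\<Phi> \<longlongrightarrow> \<Phi> 1 - \<Phi> 1) at_top" by (rule Lim_transform_eventually)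
  then show ?thesis by simp
qed

lemma \<Phi>_pos: "s > 0 \<Longrightarrow> \<Phi> s > 0"
proof -
  assume s: "s > 0"
  have "\<Phi> (s + 1) \<ge> 0"
    by (rule tendsto_upperbound[OF \<Phi>_tendsto_0])
      (auto intro!: eventually_at_top_linorderI[of "s + 2"]
        less_imp_le[OF \<Phi>_strict_antimono] add_pos_nonneg s)
  then show ?thesis using \<Phi>_strict_antimono[of s "s + 1"] s by simp
qed

lemma \<phi>_\<Phi>:
  assumes "s > 0"
  shows "\<phi> (\<Phi> s) = s"
  unfolding varphi_def
proof (rule the_equality)
  show "r = s" if "0 < r \<and> \<Phi> r = \<Phi> s" for r
    using that assms \<Phi>_strict_antimono[of r s] \<Phi>_strict_antimono[of s r]
    by (cases r s rule: linorder_cases) auto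
qed (use assms in simp)

lemma
  assumes "a > 0" "0 < t" "t < \<Phi> a"
  shows \<phi>_greater: "\<phi> t > a" and \<Phi>_\<phi>: "\<Phi> (\<phi> t) = t"
proof -
  have "\<forall>\<^sub>F c in at_top. \<Phi> c < t \<and> c > a"
    using order_tendstoD(2)[OF \<Phi>_tendsto_0 assms(2)] eventually_gt_at_top[of a]
    by eventually_elim simp
  then obtain c where beyond: "\<Phi> c < t" "c > a" by (auto dest: eventually_happens)
  have "\<exists>s\<ge>a. s \<le> c \<and> \<Phi> s = t"
    by (rule IVT2') (use beyond assms in \<open>auto intro: continuous_on_subset[OF \<Phi>_cont]\<close>)
  then obtain s where s: "a \<le> s" "\<Phi> s = t" by blast
  then have "s > a" using assms by (cases "s = a") auto
  then show "\<phi> t > a" "\<Phi> (\<phi> t) = t" using \<phi>_\<Phi>[of s] assms(1) s by auto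
qed

lemma \<phi>_deriv:
  assumes "a > 0" "0 < t" "t < \<Phi> a"
  shows "(\<phi> has_real_derivative - H (\<phi> t)) (at t)"
proof -
  have pos: "\<phi> t > 0" using \<phi>_greater[OF assms] assms(1) by simp
  have "(\<phi> has_derivative (\<lambda>h. - H (\<phi> t) * h)) (at (\<Phi> (\<phi> t)))"
    by (rule has_derivative_inverse_strong[OF _ _ \<Phi>_cont \<phi>_\<Phi>
        \<Phi>_deriv[OF pos, unfolded has_field_derivative_def]])
      (use pos H_pos[OF pos] in auto)
  then show ?thesis unfolding \<Phi>_\<phi>[OF assms] by (simp only: has_field_derivative_def)
qed

lemma eventually_less_\<Phi>: "s > 0 \<Longrightarrow> \<forall>\<^sub>F t in at_right 0. t < \<Phi> s"
  using \<Phi>_pos by (intro order_tendstoD[OF tendsto_ident_at])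

lemma \<phi>_at_top: "filterlim \<phi> at_top (at_right 0)"
  unfolding filterlim_at_top
proof
  fix Z :: real
  have "\<forall>\<^sub>F t in at_right 0. t < \<Phi> (max 1 Z)" by (intro eventually_less_\<Phi>) simp
  with eventually_at_right_less[of "0 :: real"] show "\<forall>\<^sub>F t in at_right 0. Z \<le> \<phi> t"
    by eventually_elim (use \<phi>_greater[of "max 1 Z"] in force)
qed

end

locale keller_osserman_limit = keller_osserman +
  fixes Cf :: real
  assumes Cf_pos: "Cf > 0" and deriv_H_\<Phi>: "((\<lambda>s. deriv H s * \<Phi> s) \<longlongrightarrow> Cf) at_top"
begin

lemma eventually_\<Phi>_H_le: "\<forall>\<^sub>F s in at_top. \<Phi> s * H s \<le> (Cf + 1) * s"
proof -
  have "\<forall>\<^sub>F s in at_top. deriv H s * \<Phi> s < Cf + 1" by (rule order_tendstoD[OF deriv_H_\<Phi>]) simp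
  then obtain s0 where s0: "\<And>s. s \<ge> s0 \<Longrightarrow> deriv H s * \<Phi> s < Cf + 1"
    by (auto simp: eventually_at_top_linorder)
  define r where "r = max 1 s0"
  have "\<Phi> s * H s \<le> (Cf + 1) * s" if s: "s \<ge> max r (\<Phi> r * H r)" for s
  proof -
    have "r \<le> s" using s by simp
    then have "Cf * r - \<Phi> r * H r \<le> Cf * s - \<Phi> s * H s"
    proof (rule DERIV_nonneg_imp_nondecreasing)
      fix x assume x: "r \<le> x" "x \<le> s"
      then have "x > 0" by (simp add: r_def)
      have "((\<lambda>s. Cf * s - \<Phi> s * H s) has_real_derivative
          Cf * 1 - (- (1 / H x) * H x + (f x / H x ^ k) * \<Phi> x)) (at x)"
        by (intro DERIV_diff DERIV_cmult DERIV_ident DERIV_mult \<Phi>_deriv H_deriv \<open>x > 0\<close>)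
      moreover have "(f x / H x ^ k) * \<Phi> x < Cf + 1"
        using s0[of x] x DERIV_imp_deriv[OF H_deriv[OF \<open>x > 0\<close>]] by (simp add: r_def)
      then have "Cf * 1 - (- (1 / H x) * H x + (f x / H x ^ k) * \<Phi> x) \<ge> 0"
        using H_pos[OF \<open>x > 0\<close>] by simp
      ultimately show "\<exists>y. ((\<lambda>s. Cf * s - \<Phi> s * H s) has_real_derivative y) (at x) \<and> 0 \<le> y" by blast
    qed
    moreover have "\<Phi> r * H r \<le> s" "0 \<le> Cf * r" using s Cf_pos by (simp_all add: r_def)
    ultimately show ?thesis by (simp add: algebra_simps)
  qed
  then show ?thesis by (rule eventually_at_top_linorderI)
qed

lemma powr_\<phi>_mono:
  "\<exists>t0>0. \<forall>t t'. 0 < t \<longrightarrow> t \<le> t' \<longrightarrow> t' < t0 \<longrightarrow> t powr (Cf + 1) * \<phi> t \<le> t' powr (Cf + 1) * \<phi> t'"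
proof -
  obtain r where r: "\<And>s. s \<ge> r \<Longrightarrow> \<Phi> s * H s \<le> (Cf + 1) * s"
    using eventually_\<Phi>_H_le by (auto simp: eventually_at_top_linorder)
  define c where "c = Cf + 1"
  define a where "a = max 1 r"
  have "a > 0" by (simp add: a_def)
  have "t powr c * \<phi> t \<le> t' powr c * \<phi> t'" if t: "0 < t" "t \<le> t'" "t' < \<Phi> a" for t t'
  proof (rule DERIV_nonneg_imp_nondecreasing[OF t(2)])
    fix x assume x: "t \<le> x" "x \<le> t'"
    have x': "0 < x" "x < \<Phi> a" using x t by auto
    have "((\<lambda>x. x powr c) has_real_derivative c * x powr (c - 1)) (at x)"
      using has_real_derivative_powr[OF x'(1), of c] by simp
    from DERIV_mult[OF this \<phi>_deriv[OF \<open>a > 0\<close> x']]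
    have "((\<lambda>x. x powr c * \<phi> x) has_real_derivative
        c * x powr (c - 1) * \<phi> x + - H (\<phi> x) * x powr c) (at x)" .
    moreover have "x * H (\<phi> x) \<le> c * \<phi> x"
      using r[of "\<phi> x"] \<phi>_greater[OF \<open>a > 0\<close> x'] \<Phi>_\<phi>[OF \<open>a > 0\<close> x'] by (simp add: a_def c_def)
    then have "x powr (c - 1) * (x * H (\<phi> x)) \<le> x powr (c - 1) * (c * \<phi> x)"
      by (intro mult_left_mono) auto
    moreover have "x powr (c - 1) * x = x powr c"
      using x'(1) by (simp add: powr_mult_base mult.commute)
    ultimately have "((\<lambda>x. x powr c * \<phi> x) has_real_derivative
        c * x powr (c - 1) * \<phi> x + - H (\<phi> x) * x powr c) (at x)"
      "0 \<le> c * x powr (c - 1) * \<phi> x + - H (\<phi> x) * x powr c"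
      by (simp_all add: algebra_simps) (metis mult.assoc mult.commute)
    then show "\<exists>y. ((\<lambda>x. x powr c * \<phi> x) has_real_derivative y) (at x) \<and> 0 \<le> y" by blast
  qed
  then show ?thesis using \<Phi>_pos[OF \<open>a > 0\<close>] by (auto simp: c_def intro!: exI[of _ "\<Phi> a"])
qed

end

locale blowup_profile = keller_osserman_limit +
  fixes m M :: "real \<Rightarrow> real" and \<delta>0 Cm :: real
  assumes k_ge_1: "1 \<le> k" and \<delta>0_pos: "\<delta>0 > 0"
    and m_differentiable: "\<And>t. 0 < t \<Longrightarrow> t < \<delta>0 \<Longrightarrow> m differentiable (at t)"
    and m_pos: "\<And>t. 0 < t \<Longrightarrow> t < \<delta>0 \<Longrightarrow> m t > 0" and m_mono: "mono_on {0<..<\<delta>0} m"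
    and M_eq: "\<And>t. 0 < t \<Longrightarrow> t < \<delta>0 \<Longrightarrow> M t = integral {0..t} m"
    and M_over_m_deriv: "((\<lambda>t. deriv (\<lambda>s. M s / m s) t) \<longlongrightarrow> Cm) (at_right 0)"
begin

lemma m_le: "0 < s \<Longrightarrow> s \<le> t \<Longrightarrow> t < \<delta>0 \<Longrightarrow> m s \<le> m t"
  using m_mono by (simp add: mono_on_def)

lemma m_deriv: "0 < t \<Longrightarrow> t < \<delta>0 \<Longrightarrow> (m has_real_derivative deriv m t) (at t)"
  using m_differentiable DERIV_deriv_iff_real_differentiable by blast

lemma
  assumes t: "0 < t" "t < \<delta>0"
  shows M_deriv: "(M has_real_derivative m t) (at t)" and M_pos: "M t > 0" and M_le: "M t \<le> t * m t"
proof -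
  have m_on: "mono_on {0<..s} m" "\<And>r. 0 < r \<Longrightarrow> r \<le> s \<Longrightarrow> m r > 0" if "s < \<delta>0" for s
    using that m_pos by (auto intro: mono_on_subset[OF m_mono])
  show "M t > 0" "M t \<le> t * m t"
    unfolding M_eq[OF t]
    by (rule mono_pos_integral_pos[OF t(1) m_on[OF t(2)]], assumption+,
        rule mono_pos_integral_le[OF t(1) m_on[OF t(2)]])
  have "m integrable_on {0..s}" if "s \<in> {0<..<\<delta>0}" for s
    using that by (intro mono_pos_integrable[OF _ m_on]) auto
  moreover have "continuous_on {0<..<\<delta>0} m"
    using DERIV_isCont[OF m_deriv] by (intro continuous_at_imp_continuous_on) auto
  ultimately have "((\<lambda>x. integral {0..x} m) has_real_derivative m t) (at t)"
    using t by (intro has_real_derivative_integral_interior[where c = \<delta>0]) auto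
  then show "(M has_real_derivative m t) (at t)"
    by (rule has_field_derivative_transform_within_open[where S = "{0<..<\<delta>0}"]) (use t M_eq in auto)
qed

lemma eventually_near_0: "\<forall>\<^sub>F t in at_right 0. 0 < t \<and> t < \<delta>0"
  using \<delta>0_pos unfolding eventually_at_right_field by blast

lemma M_over_m_tendsto_0: "((\<lambda>t. M t / m t) \<longlongrightarrow> 0) (at_right 0)"
proof (rule tendsto_sandwich[of "\<lambda>_. 0" _ _ "\<lambda>t. t"])
  show "\<forall>\<^sub>F t in at_right 0. 0 \<le> M t / m t" "\<forall>\<^sub>F t in at_right 0. M t / m t \<le> t"
    using eventually_near_0
    by (eventually_elim, use M_pos M_le m_pos in \<open>force simp: divide_le_eq\<close>)+
qed (auto intro: tendsto_eq_intros)

lemma M_tendsto_0: "(M \<longlongrightarrow> 0) (at_right 0)"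
proof (rule tendsto_sandwich[of "\<lambda>_. 0" _ _ "\<lambda>t. t * m (\<delta>0 / 2)"])
  show "\<forall>\<^sub>F t in at_right 0. 0 \<le> M t"
    using eventually_near_0 by eventually_elim (use M_pos in \<open>force intro: less_imp_le\<close>)
  have "\<forall>\<^sub>F t in at_right 0. 0 < t \<and> t < \<delta>0 / 2"
    using \<delta>0_pos unfolding eventually_at_right_field by (intro exI[of _ "\<delta>0 / 2"]) auto
  then show "\<forall>\<^sub>F t in at_right 0. M t \<le> t * m (\<delta>0 / 2)"
  proof eventually_elim
    case (elim t)
    have "M t \<le> t * m t" using M_le elim \<delta>0_pos by simp
    also have "\<dots> \<le> t * m (\<delta>0 / 2)"
      using elim \<delta>0_pos m_le[of t "\<delta>0 / 2"] by (intro mult_left_mono) auto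
    finally show ?case .
  qed
qed (auto intro!: tendsto_eq_intros)

lemma scaled_M_at_right_0:
  assumes "\<xi> > 0"
  shows "filterlim (\<lambda>t. \<xi> * M t) (at_right 0) (at_right 0)"
proof -
  have "((\<lambda>t. \<xi> * M t) \<longlongrightarrow> 0) (at_right 0)" using M_tendsto_0 by (auto intro!: tendsto_eq_intros)
  moreover have "\<forall>\<^sub>F t in at_right 0. \<xi> * M t \<in> {0<..} \<and> \<xi> * M t \<noteq> 0"
    using eventually_near_0 by eventually_elim (use M_pos assms in force)
  ultimately show ?thesis by (simp add: filterlim_at)
qed

lemma deriv_M_over_m:
  assumes "0 < t" "t < \<delta>0"
  shows "deriv (\<lambda>s. M s / m s) t = 1 - M t * deriv m t / (m t)\<^sup>2"
proof -
  have "((\<lambda>s. M s / m s) has_real_derivative (m t * m t - M t * deriv m t) / (m t * m t)) (at t)"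
    by (rule DERIV_divide[OF M_deriv[OF assms] m_deriv[OF assms]]) (use m_pos[OF assms] in simp)
  then have "deriv (\<lambda>s. M s / m s) t = (m t * m t - M t * deriv m t) / (m t * m t)"
    by (rule DERIV_imp_deriv)
  then show ?thesis using m_pos[OF assms] by (simp add: field_simps power2_eq_square)
qed

definition profile :: "real \<Rightarrow> real \<Rightarrow> real" where
  "profile \<xi> t = \<phi> (\<xi> * M t)"

definition H_slope :: "real \<Rightarrow> real \<Rightarrow> real" where
  "H_slope \<xi> t = f (profile \<xi> t) / H (profile \<xi> t) ^ k"

definition slope :: "real \<Rightarrow> real \<Rightarrow> real" where
  "slope \<xi> t = \<xi> * m t * H (profile \<xi> t)"

definition weight :: "real \<Rightarrow> real \<Rightarrow> real" where
  "weight \<xi> t = slope \<xi> t * (\<xi> * m t * H_slope \<xi> t)"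

definition convexity :: "real \<Rightarrow> real \<Rightarrow> real" where
  "convexity \<xi> t = weight \<xi> t - \<xi> * deriv m t * H (profile \<xi> t)"

definition source :: "real \<Rightarrow> real \<Rightarrow> real" where
  "source \<xi> t = \<xi> ^ (k + 1) * (m t ^ (k + 1) * f (profile \<xi> t))"

definition profile_domain :: "real \<Rightarrow> real \<Rightarrow> bool" where
  "profile_domain \<xi> t \<longleftrightarrow> 0 < t \<and> t < \<delta>0 \<and> \<xi> * M t < \<Phi> 1"

lemma eventually_profile_domain:
  assumes "\<xi> > 0"
  shows "\<forall>\<^sub>F t in at_right 0. profile_domain \<xi> t"
proof -
  have "\<forall>\<^sub>F t in at_right 0. \<xi> * M t < \<Phi> 1"
    by (rule eventually_compose_filterlim[OF eventually_less_\<Phi> scaled_M_at_right_0[OF assms]]) simp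
  with eventually_near_0 show ?thesis by eventually_elim (simp add: profile_domain_def)
qed

lemma profile_at_top: "\<xi> > 0 \<Longrightarrow> filterlim (profile \<xi>) at_top (at_right 0)"
  unfolding profile_def using filterlim_compose[OF \<phi>_at_top scaled_M_at_right_0] .

context
  fixes \<xi> t :: real
  assumes \<xi>: "\<xi> > 0" and t: "profile_domain \<xi> t"
begin

lemma
  shows profile_gt_1: "profile \<xi> t > 1" and \<Phi>_profile: "\<Phi> (profile \<xi> t) = \<xi> * M t"
    and profile_deriv: "(profile \<xi> has_real_derivative - slope \<xi> t) (at t)"
proof -
  have t': "0 < t" "t < \<delta>0" "\<xi> * M t < \<Phi> 1" using t by (simp_all add: profile_domain_def)
  have pos: "0 < \<xi> * M t" using M_pos t' \<xi> by simp
  show "profile \<xi> t > 1" "\<Phi> (profile \<xi> t) = \<xi> * M t"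
    unfolding profile_def
    by (rule \<phi>_greater[OF zero_less_one pos t'(3)], rule \<Phi>_\<phi>[OF zero_less_one pos t'(3)])
  have "((\<lambda>t. \<xi> * M t) has_real_derivative \<xi> * m t) (at t)"
    by (rule DERIV_cmult[OF M_deriv[OF t'(1,2)]])
  from DERIV_chain2[OF \<phi>_deriv[OF zero_less_one pos t'(3)] this]
  show "(profile \<xi> has_real_derivative - slope \<xi> t) (at t)"
    by (simp add: profile_def[abs_def] slope_def mult_ac)
qed

lemma
  shows H_slope_pos: "H_slope \<xi> t > 0" and slope_pos: "slope \<xi> t > 0"
    and weight_pos: "weight \<xi> t > 0" and source_pos: "source \<xi> t > 0"
proof -
  have m: "m t > 0" using m_pos t by (simp add: profile_domain_def)
  have H: "H (profile \<xi> t) > 0" and f: "f (profile \<xi> t) > 0"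
    using H_pos f_pos profile_gt_1 by simp_all
  then show "H_slope \<xi> t > 0" by (simp add: H_slope_def)
  with m H \<xi> show "slope \<xi> t > 0" "weight \<xi> t > 0" by (simp_all add: slope_def weight_def)
  from m f \<xi> show "source \<xi> t > 0" by (simp add: source_def)
qed

lemma slope_deriv: "(slope \<xi> has_real_derivative - convexity \<xi> t) (at t)"
proof -
  have m: "(m has_real_derivative deriv m t) (at t)"
    using m_deriv t by (simp add: profile_domain_def)
  have "((\<lambda>t. H (profile \<xi> t)) has_real_derivative H_slope \<xi> t * - slope \<xi> t) (at t)"
    unfolding H_slope_def using profile_gt_1 by (intro DERIV_chain2[OF H_deriv profile_deriv]) simp
  then have "(slope \<xi> has_real_derivative
      \<xi> * deriv m t * H (profile \<xi> t) + H_slope \<xi> t * - slope \<xi> t * (\<xi> * m t)) (at t)"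
    unfolding slope_def[abs_def] by (intro DERIV_mult DERIV_cmult m)
  then show ?thesis by (simp add: convexity_def weight_def mult_ac)
qed

lemma weight_slope_eq_source: "weight \<xi> t * slope \<xi> t ^ (k - 1) = source \<xi> t"
proof -
  have power_k: "x ^ k = x * x ^ (k - 1)" for x :: real using k_ge_1 by (simp add: power_eq_if)
  have "H (profile \<xi> t) > 0" using H_pos profile_gt_1 by simp
  then show ?thesis
    by (simp add: weight_def slope_def source_def H_slope_def power_k power_mult_distrib field_simps)
qed

lemma slope_over_weight: "slope \<xi> t / weight \<xi> t = (M t / m t) / (H_slope \<xi> t * (\<xi> * M t))"
proof -
  have "M t > 0" using M_pos t by (simp add: profile_domain_def)
  then show ?thesis using slope_pos by (simp add: weight_def)
qed

lemma convexity_over_weight: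
  "convexity \<xi> t / weight \<xi> t = 1 - (1 - deriv (\<lambda>s. M s / m s) t) / (H_slope \<xi> t * (\<xi> * M t))"
proof -
  have "0 < t" "t < \<delta>0" using t by (simp_all add: profile_domain_def)
  then have "M t > 0" "m t > 0" "deriv (\<lambda>s. M s / m s) t = 1 - M t * deriv m t / (m t)\<^sup>2"
    using M_pos m_pos deriv_M_over_m by simp_all
  moreover have "H (profile \<xi> t) > 0" using H_pos profile_gt_1 by simp
  ultimately show ?thesis
    using weight_pos H_slope_pos \<xi>
    by (simp add: convexity_def diff_divide_distrib) (simp add: weight_def slope_def power2_eq_square)
qed

end

lemma H_slope_M_tendsto:
  assumes \<xi>: "\<xi> > 0"
  shows "((\<lambda>t. H_slope \<xi> t * (\<xi> * M t)) \<longlongrightarrow> Cf) (at_right 0)"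
proof (rule Lim_transform_eventually[OF filterlim_compose[OF deriv_H_\<Phi> profile_at_top[OF \<xi>]]])
  show "\<forall>\<^sub>F t in at_right 0. deriv H (profile \<xi> t) * \<Phi> (profile \<xi> t) = H_slope \<xi> t * (\<xi> * M t)"
    using eventually_profile_domain[OF \<xi>]
  proof eventually_elim
    case (elim t)
    have "profile \<xi> t > 0" using profile_gt_1[OF \<xi> elim] by simp
    then show ?case
      using \<Phi>_profile[OF \<xi> elim] by (simp add: H_slope_def DERIV_imp_deriv[OF H_deriv])
  qed
qed

lemma slope_over_weight_tendsto:
  assumes \<xi>: "\<xi> > 0"
  shows "((\<lambda>t. slope \<xi> t / weight \<xi> t) \<longlongrightarrow> 0) (at_right 0)"
proof (rule Lim_transform_eventually)
  show "((\<lambda>t. (M t / m t) / (H_slope \<xi> t * (\<xi> * M t))) \<longlongrightarrow> 0) (at_right 0)"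
    using tendsto_divide[OF M_over_m_tendsto_0 H_slope_M_tendsto[OF \<xi>]] Cf_pos by simp
  show "\<forall>\<^sub>F t in at_right 0. (M t / m t) / (H_slope \<xi> t * (\<xi> * M t)) = slope \<xi> t / weight \<xi> t"
    using eventually_profile_domain[OF \<xi>]
    by eventually_elim (rule slope_over_weight[OF \<xi>, symmetric])
qed

lemma convexity_over_weight_tendsto:
  assumes \<xi>: "\<xi> > 0"
  shows "((\<lambda>t. convexity \<xi> t / weight \<xi> t) \<longlongrightarrow> 1 - (1 - Cm) / Cf) (at_right 0)"
proof (rule Lim_transform_eventually)
  show "((\<lambda>t. 1 - (1 - deriv (\<lambda>s. M s / m s) t) / (H_slope \<xi> t * (\<xi> * M t)))
      \<longlongrightarrow> 1 - (1 - Cm) / Cf) (at_right 0)"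
    using Cf_pos by (intro tendsto_intros M_over_m_deriv H_slope_M_tendsto[OF \<xi>]) simp
  show "\<forall>\<^sub>F t in at_right 0.
      1 - (1 - deriv (\<lambda>s. M s / m s) t) / (H_slope \<xi> t * (\<xi> * M t)) = convexity \<xi> t / weight \<xi> t"
    using eventually_profile_domain[OF \<xi>]
    by eventually_elim (rule convexity_over_weight[OF \<xi>, symmetric])
qed

lemma profile_antimono:
  assumes \<xi>: "\<xi> > 0" and domain: "\<And>s. 0 < s \<Longrightarrow> s < t0 \<Longrightarrow> profile_domain \<xi> s"
    and st: "0 < s" "s \<le> t" "t < t0"
  shows "profile \<xi> t \<le> profile \<xi> s"
proof (rule DERIV_nonpos_imp_nonincreasing[OF st(2)])
  fix x assume "s \<le> x" "x \<le> t"
  then have "profile_domain \<xi> x" using st by (intro domain) auto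
  then show "\<exists>y. (profile \<xi> has_real_derivative y) (at x) \<and> y \<le> 0"
    using profile_deriv[OF \<xi>] slope_pos[OF \<xi>]
    by (intro exI[of _ "- slope \<xi> x"]) (simp add: less_imp_le)
qed

lemma profile_cont:
  assumes \<xi>: "\<xi> > 0" and domain: "\<And>s. 0 < s \<Longrightarrow> s < t0 \<Longrightarrow> profile_domain \<xi> s"
  shows "continuous_on {0<..<t0} (profile \<xi>)"
  using DERIV_isCont[OF profile_deriv[OF \<xi> domain]]
  by (intro continuous_at_imp_continuous_on) auto

lemma profile_le_scaled:
  assumes "0 < \<xi>" "\<xi> \<le> \<xi>'"
  shows "\<forall>\<^sub>F t in at_right 0. profile \<xi> t \<le> (\<xi>' / \<xi>) powr (Cf + 1) * profile \<xi>' t"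
proof -
  obtain t0 where t0: "t0 > 0" "\<And>t t'. 0 < t \<Longrightarrow> t \<le> t' \<Longrightarrow> t' < t0 \<Longrightarrow>
      t powr (Cf + 1) * \<phi> t \<le> t' powr (Cf + 1) * \<phi> t'"
    using powr_\<phi>_mono by blast
  have "((\<lambda>t. \<xi>' * M t) \<longlongrightarrow> \<xi>' * 0) (at_right 0)" by (intro tendsto_intros M_tendsto_0)
  then have "\<forall>\<^sub>F t in at_right 0. \<xi>' * M t < t0" by (rule order_tendstoD) (use t0 in simp)
  with eventually_near_0 show ?thesis
  proof eventually_elim
    case (elim t)
    have M: "M t > 0" using M_pos elim by simp
    have "(\<xi> * M t) powr (Cf + 1) * profile \<xi> t \<le> (\<xi>' * M t) powr (Cf + 1) * profile \<xi>' t"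
      unfolding profile_def using M assms elim by (intro t0(2)) auto
    then have "\<xi> powr (Cf + 1) * profile \<xi> t \<le> \<xi>' powr (Cf + 1) * profile \<xi>' t"
      using M assms by (simp add: powr_mult mult.assoc)
    then show ?case using assms by (simp add: powr_divide field_simps)
  qed
qed

lemma source_density_pos:
  assumes "\<xi> > 0" "profile_domain \<xi> t"
  shows "0 < m t ^ (k + 1) * f (profile \<xi> t)"
proof -
  have "0 < \<xi> ^ (k + 1)" using assms(1) by simp
  with source_pos[OF assms] show ?thesis unfolding source_def by (rule zero_less_mult_pos)
qed

end

section \<open>Comparison with barriers on boundary strips\<close>

lemma compact_dist_bd_strip:
  assumes \<Omega>: "open \<Omega>" "bounded \<Omega>" and "0 < s"
  shows "compact {x \<in> \<Omega>. s \<le> dist_bd \<Omega> x \<and> dist_bd \<Omega> x \<le> \<delta>}"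
proof -
  have "x \<in> \<Omega>" if "x \<in> closure \<Omega>" "s \<le> dist_bd \<Omega> x" for x
  proof (rule ccontr)
    assume "x \<notin> \<Omega>"
    then have "x \<in> frontier \<Omega>" using that \<Omega> by (simp add: frontier_def interior_open)
    then have "dist_bd \<Omega> x = 0" by (simp add: dist_bd_def)
    then show False using that \<open>0 < s\<close> by simp
  qed
  then have "{x \<in> \<Omega>. s \<le> dist_bd \<Omega> x \<and> dist_bd \<Omega> x \<le> \<delta>} = closure \<Omega> \<inter> (dist_bd \<Omega> -` {s..\<delta>})"
    using closure_subset by auto
  moreover have "closed (dist_bd \<Omega> -` {s..\<delta>})"
    unfolding dist_bd_def
    by (intro continuous_closed_vimage continuous_infdist continuous_ident) auto
  ultimately show ?thesis using \<Omega> by (simp add: compact_Int_closed compact_closure)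
qed

lemma dist_bd_strip_maximum_principle:
  fixes w :: "real^'n \<Rightarrow> real"
  assumes \<Omega>: "open \<Omega>" "bounded \<Omega>" and "0 \<le> a"
    and cont: "continuous_on {x \<in> \<Omega>. a < dist_bd \<Omega> x \<and> dist_bd \<Omega> x \<le> \<delta>} w"
    and inner: "\<exists>s>a. \<forall>y\<in>\<Omega>. a < dist_bd \<Omega> y \<longrightarrow> dist_bd \<Omega> y < s \<longrightarrow> dist_bd \<Omega> y \<le> \<delta> \<longrightarrow> w y \<le> c"
    and outer: "\<And>y. y \<in> \<Omega> \<Longrightarrow> dist_bd \<Omega> y = \<delta> \<Longrightarrow> w y \<le> c"
    and no_maximum: "\<And>z. z \<in> \<Omega> \<Longrightarrow> a < dist_bd \<Omega> z \<Longrightarrow> dist_bd \<Omega> z < \<delta> \<Longrightarrow> c < w z \<Longrightarrow>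
      \<forall>\<^sub>F y in nhds z. w y \<le> w z \<Longrightarrow> False"
    and x: "x \<in> \<Omega>" "a < dist_bd \<Omega> x" "dist_bd \<Omega> x \<le> \<delta>"
  shows "w x \<le> c"
proof (rule ccontr)
  let ?d = "dist_bd \<Omega>"
  assume "\<not> w x \<le> c"
  obtain s where s: "s > a" "\<And>y. y \<in> \<Omega> \<Longrightarrow> a < ?d y \<Longrightarrow> ?d y < s \<Longrightarrow> ?d y \<le> \<delta> \<Longrightarrow> w y \<le> c"
    using inner by blast
  let ?D = "{y \<in> \<Omega>. s \<le> ?d y \<and> ?d y \<le> \<delta>}"
  have "compact ?D" using \<Omega> s(1) \<open>0 \<le> a\<close> by (intro compact_dist_bd_strip) auto
  moreover have "x \<in> ?D" using s(2)[of x] x \<open>\<not> w x \<le> c\<close> by force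
  moreover have "continuous_on ?D w" by (rule continuous_on_subset[OF cont]) (use s(1) in auto)
  ultimately obtain z where z: "z \<in> ?D" "\<And>y. y \<in> ?D \<Longrightarrow> w y \<le> w z"
    using continuous_attains_sup[of ?D w] by blast
  have "c < w z" using z(2)[OF \<open>x \<in> ?D\<close>] \<open>\<not> w x \<le> c\<close> by simp
  then have "?d z \<noteq> \<delta>" using outer[of z] z(1) by auto
  then have "a < ?d z" "?d z < \<delta>" using z(1) s(1) by auto
  have le_max: "w y \<le> w z" if "y \<in> \<Omega>" "a < ?d y" "?d y < \<delta>" for y
    using z(2)[of y] s(2)[of y] that \<open>c < w z\<close> by (cases "s \<le> ?d y") auto
  have "\<forall>\<^sub>F y in nhds z. a < ?d y" "\<forall>\<^sub>F y in nhds z. ?d y < \<delta>"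
    using \<open>a < ?d z\<close> \<open>?d z < \<delta>\<close> isCont_tendsto_nhds[OF isCont_dist_bd]
    by (auto intro: order_tendstoD)
  moreover have "\<forall>\<^sub>F y in nhds z. y \<in> \<Omega>" using z(1) \<Omega>(1) by (intro eventually_nhds_in_open) auto
  ultimately have "\<forall>\<^sub>F y in nhds z. y \<in> \<Omega> \<and> a < ?d y \<and> ?d y < \<delta>" by (simp add: eventually_conj_iff)
  then have "\<forall>\<^sub>F y in nhds z. w y \<le> w z" by eventually_elim (use le_max in blast)
  with no_maximum[of z] z(1) \<open>a < ?d z\<close> \<open>?d z < \<delta>\<close> \<open>c < w z\<close> show False by blast
qed

lemma bounded_above_on_dist_bd_strip:
  fixes u :: "real^'n \<Rightarrow> real"
  assumes \<Omega>: "open \<Omega>" "bounded \<Omega>" and u: "continuous_on \<Omega> u" and "0 < s"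
  obtains c where "c \<ge> 0" "\<And>x. x \<in> \<Omega> \<Longrightarrow> s \<le> dist_bd \<Omega> x \<Longrightarrow> dist_bd \<Omega> x \<le> \<delta> \<Longrightarrow> u x \<le> c"
proof -
  have "compact (u ` {x \<in> \<Omega>. s \<le> dist_bd \<Omega> x \<and> dist_bd \<Omega> x \<le> \<delta>})"
    by (intro compact_continuous_image continuous_on_subset[OF u] compact_dist_bd_strip assms) auto
  then obtain c where "\<And>x. x \<in> \<Omega> \<Longrightarrow> s \<le> dist_bd \<Omega> x \<Longrightarrow> dist_bd \<Omega> x \<le> \<delta> \<Longrightarrow> \<bar>u x\<bar> \<le> c"
    using compact_imp_bounded bounded_real by (metis (mono_tags, lifting) imageI mem_Collect_eq)
  then show ?thesis by (intro that[of "\<bar>c\<bar>"]) (force simp: abs_le_iff)+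
qed

lemma filterlim_dist_bd: "filterlim (dist_bd \<Omega>) (at_right 0) (bd_filter \<Omega>)"
  unfolding bd_filter_def filterlim_def
  by (rule order_trans[OF filtermap_mono[OF inf_le2] filtermap_filtercomap])

lemma eventually_bd_filter_dist_bd:
  "\<forall>\<^sub>F t in at_right 0. P t \<Longrightarrow> \<forall>\<^sub>F x in bd_filter \<Omega>. P (dist_bd \<Omega> x)"
  by (rule eventually_compose_filterlim[OF _ filterlim_dist_bd])

lemma eventually_bd_filter:
  assumes "open \<Omega>" "frontier \<Omega> \<noteq> {}"
  shows "eventually P (bd_filter \<Omega>) \<longleftrightarrow> (\<exists>\<delta>>0. \<forall>x\<in>\<Omega>. dist_bd \<Omega> x < \<delta> \<longrightarrow> P x)"
proof -
  have "eventually P (bd_filter \<Omega>) \<longleftrightarrow> (\<exists>Q. eventually Q (at_right 0) \<and> (\<forall>x\<in>\<Omega>. Q (dist_bd \<Omega> x) \<longrightarrow> P x))"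
    unfolding bd_filter_def inf_commute[of "principal \<Omega>"] eventually_inf_principal
      eventually_filtercomap
    by blast
  also have "\<dots> \<longleftrightarrow> (\<exists>\<delta>>0. \<forall>x\<in>\<Omega>. dist_bd \<Omega> x < \<delta> \<longrightarrow> P x)"
  proof
    assume "\<exists>Q. eventually Q (at_right 0) \<and> (\<forall>x\<in>\<Omega>. Q (dist_bd \<Omega> x) \<longrightarrow> P x)"
    then show "\<exists>\<delta>>0. \<forall>x\<in>\<Omega>. dist_bd \<Omega> x < \<delta> \<longrightarrow> P x"
      unfolding eventually_at_right_field using dist_bd_pos[OF assms] by blast
  next
    assume "\<exists>\<delta>>0. \<forall>x\<in>\<Omega>. dist_bd \<Omega> x < \<delta> \<longrightarrow> P x"
    then obtain \<delta> where "\<delta> > 0" "\<forall>x\<in>\<Omega>. dist_bd \<Omega> x < \<delta> \<longrightarrow> P x" by blast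
    then show "\<exists>Q. eventually Q (at_right 0) \<and> (\<forall>x\<in>\<Omega>. Q (dist_bd \<Omega> x) \<longrightarrow> P x)"
      unfolding eventually_at_right_field by (intro exI[of _ "\<lambda>t. t < \<delta>"]) auto
  qed
  finally show ?thesis .
qed

section \<open>Barriers near a strictly convex boundary\<close>

locale strictly_convex_domain =
  fixes k :: nat and \<Omega> :: "(real^'n) set"
  assumes k_positive: "0 < k" and domain: "open \<Omega>" "bounded \<Omega>" "\<Omega> \<noteq> {}"
    and convex: "strictly_convex_k (k - 1) \<Omega>" and boundary: "C31_boundary \<Omega>"
begin

sublocale C2_domain \<Omega>
  by unfold_locales (use domain C31_boundary_adapted[OF boundary] in auto)

lemma continuous_on_curvature: "continuous_on (frontier \<Omega>) (\<lambda>p. sigma_matrix j (C p))"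
  by (rule continuous_on_compose2[OF continuous_on_sigma_matrix continuous_on_second_form]) auto

lemma curvature_pos:
  assumes "p \<in> frontier \<Omega>" "j < k"
  shows "sigma_matrix j (C p) > 0"
  using assms convex
  unfolding sigma_matrix_second_form[OF open_\<Omega> boundary assms(1)] strictly_convex_k_def
  by (cases "j = 0") (auto simp flip: sigma_matrix_second_form[OF open_\<Omega> boundary assms(1)])

lemma curvature_lower_bound: "\<exists>c>0. \<forall>j<k. \<forall>p\<in>frontier \<Omega>. c \<le> sigma_matrix j (C p)"
proof -
  have "\<exists>c>0. \<forall>p\<in>frontier \<Omega>. c \<le> sigma_matrix j (C p)" if "j < k" for j
    using continuous_attains_inf[OF compact_frontier_\<Omega> frontier_nonempty continuous_on_curvature]
      curvature_pos[OF _ that] by metis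
  then obtain c where c_bounds: "\<And>j. j < k \<Longrightarrow> c j > 0"
      "\<And>j p. j < k \<Longrightarrow> p \<in> frontier \<Omega> \<Longrightarrow> c j \<le> sigma_matrix j (C p)"
    by metis
  have "0 \<in> {..<k}" using k_positive by simp
  then have "{..<k} \<noteq> {}" by blast
  then have "Min (c ` {..<k}) > 0" using c_bounds(1) by simp
  moreover have "Min (c ` {..<k}) \<le> sigma_matrix j (C p)" if "j < k" "p \<in> frontier \<Omega>" for j p
    using c_bounds(2)[OF that] that(1) by (intro order_trans[OF Min_le]) auto
  ultimately show ?thesis by blast
qed

lemma
  shows curvature_le_L0: "p \<in> frontier \<Omega> \<Longrightarrow> sigma_matrix (k - 1) (C p) \<le> L0 k \<Omega>"
    and curvature_ge_l0: "p \<in> frontier \<Omega> \<Longrightarrow> l0 k \<Omega> \<le> sigma_matrix (k - 1) (C p)"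
    and l0_pos: "l0 k \<Omega> > 0" and L0_pos: "L0 k \<Omega> > 0"
proof -
  have image_eq: "curv_sigma \<Omega> (k - 1) ` frontier \<Omega> = (\<lambda>p. sigma_matrix (k - 1) (C p)) ` frontier \<Omega>"
    by (intro image_cong) (simp_all add: sigma_matrix_second_form[OF open_\<Omega> boundary])
  have bounded: "bounded ((\<lambda>p. sigma_matrix (k - 1) (C p)) ` frontier \<Omega>)"
    by (intro compact_imp_bounded compact_continuous_image continuous_on_curvature compact_frontier_\<Omega>)
  show L0: "sigma_matrix (k - 1) (C p) \<le> L0 k \<Omega>" if "p \<in> frontier \<Omega>" for p
    unfolding L0_def image_eq by (rule cSUP_upper[OF that bounded_imp_bdd_above[OF bounded]])
  show l0: "l0 k \<Omega> \<le> sigma_matrix (k - 1) (C p)" if "p \<in> frontier \<Omega>" for p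
    unfolding l0_def image_eq by (rule cINF_lower[OF bounded_imp_bdd_below[OF bounded] that])
  obtain c where c_le: "c > 0" "\<And>p. p \<in> frontier \<Omega> \<Longrightarrow> c \<le> sigma_matrix (k - 1) (C p)"
    using curvature_lower_bound k_positive by (metis diff_less zero_less_one)
  then have "c \<le> l0 k \<Omega>"
    unfolding l0_def image_eq by (intro cINF_greatest frontier_nonempty)
  with c_le(1) show "l0 k \<Omega> > 0" by simp
  moreover obtain p where "p \<in> frontier \<Omega>" using frontier_nonempty by blast
  ultimately show "L0 k \<Omega> > 0" using L0[of p] l0[of p] by linarith
qed

end

locale boundary_barriers =
  blowup_profile k f Cf m M \<delta>0 Cm + strictly_convex_domain k \<Omega>
  for k f Cf m M \<delta>0 Cm and \<Omega> :: "(real^'n) set" +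
  assumes Cf_Cm: "Cf > 1 - Cm"
begin

definition "\<theta> = 1 - (1 - Cm) / Cf"

lemma \<theta>_pos: "\<theta> > 0"
  using Cf_Cm Cf_pos by (simp add: \<theta>_def field_simps)

definition barrier_hess :: "real \<Rightarrow> real \<Rightarrow> real^'n \<Rightarrow> real \<Rightarrow> real^'n^'n" where
  "barrier_hess \<xi> t p \<eta> =
     convexity \<xi> t *\<^sub>R outer (\<nu> p) + slope \<xi> t *\<^sub>R (C p + \<eta> *\<^sub>R tangent_proj (\<nu> p))"

definition perturbed_curvature :: "nat \<Rightarrow> real^'n \<Rightarrow> real \<Rightarrow> real \<Rightarrow> real \<Rightarrow> real" where
  "perturbed_curvature j p \<eta> r s =
     r * sigma_matrix (Suc j) (C p + \<eta> *\<^sub>R tangent_proj (\<nu> p))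
     + s * sigma_matrix j (C p + \<eta> *\<^sub>R tangent_proj (\<nu> p))"

lemma sigma_barrier_hess:
  assumes \<xi>: "\<xi> > 0" "profile_domain \<xi> t" and p: "p \<in> frontier \<Omega>"
  shows "sigma_matrix (Suc j) (barrier_hess \<xi> t p \<eta>) = weight \<xi> t * slope \<xi> t ^ j *
    perturbed_curvature j p \<eta> (slope \<xi> t / weight \<xi> t) (convexity \<xi> t / weight \<xi> t)"
proof -
  define B where "B = C p + \<eta> *\<^sub>R tangent_proj (\<nu> p)"
  have "B *v \<nu> p = 0"
    using second_form_normal[OF p] norm_normal[OF p]
    by (simp add: B_def matrix_vector_mult_add_rdistrib scaleR_matrix_vector_assoc[symmetric]
      tangent_proj_mult_vec norm_eq_1)
  then have "(slope \<xi> t *\<^sub>R B) *v \<nu> p = 0" by (simp add: scaleR_matrix_vector_assoc[symmetric])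
  from sigma_matrix_Suc_outer_plus[OF this]
  have "sigma_matrix (Suc j) (barrier_hess \<xi> t p \<eta>) =
      slope \<xi> t ^ Suc j * sigma_matrix (Suc j) B + convexity \<xi> t * (slope \<xi> t ^ j * sigma_matrix j B)"
    using norm_normal[OF p]
    unfolding barrier_hess_def B_def[symmetric] by (simp add: sigma_matrix_scaleR)
  then show ?thesis
    using weight_pos[OF \<xi>]
    unfolding perturbed_curvature_def B_def[symmetric] by (simp add: field_simps)
qed

lemma perturbed_curvature_uniform:
  assumes "\<kappa> > 0"
  shows "\<forall>\<^sub>F y in nhds (0, 0, s0). \<forall>p\<in>frontier \<Omega>.
    \<bar>perturbed_curvature j p (fst y) (fst (snd y)) (snd (snd y)) - s0 * sigma_matrix j (C p)\<bar> \<le> \<kappa>"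
proof -
  define F where "F z = perturbed_curvature j (snd z) (fst (fst z))
      (fst (snd (fst z))) (snd (snd (fst z)))" for z
  have snd: "continuous_on (UNIV \<times> frontier \<Omega>) (\<lambda>z. h (snd z))" if "continuous_on (frontier \<Omega>) h"
    for h :: "real^'n \<Rightarrow> real^'n^'n"
    by (rule continuous_on_compose2[OF that]) (auto intro: continuous_intros)
  have "continuous_on (UNIV \<times> frontier \<Omega>) (\<lambda>z. C (snd z) + fst (fst z) *\<^sub>R tangent_proj (\<nu> (snd z)))"
    by (intro continuous_intros snd continuous_on_second_form
        continuous_on_tangent_proj continuous_on_inner_normal)
  from continuous_on_compose2[OF continuous_on_sigma_matrix[of UNIV] this]
  have "continuous_on (UNIV \<times> frontier \<Omega>) F"
    unfolding F_def perturbed_curvature_def by (intro continuous_intros) auto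
  then obtain X where near: "(0, 0, s0) \<in> X" "open X"
      "\<forall>y\<in>X \<inter> UNIV. \<forall>p\<in>frontier \<Omega>. dist (F (y, p)) (F ((0, 0, s0), p)) \<le> \<kappa>"
    using continuous_on_prod_compactE[OF _ compact_frontier_\<Omega> UNIV_I \<open>\<kappa> > 0\<close>] by blast
  from eventually_nhds_in_open[OF near(2,1)] show ?thesis
    by eventually_elim (use near(3) in \<open>auto simp: F_def perturbed_curvature_def dist_real_def\<close>)
qed

lemma eventually_perturbed_curvature:
  assumes \<xi>: "\<xi> > 0" and "\<kappa> > 0"
  shows "\<exists>\<eta>>0. \<forall>\<^sub>F t in at_right 0. \<forall>\<eta>'\<in>{0, \<eta>}. \<forall>j\<in>{..<k}. \<forall>p\<in>frontier \<Omega>.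
    \<bar>perturbed_curvature j p \<eta>' (slope \<xi> t / weight \<xi> t) (convexity \<xi> t / weight \<xi> t)
      - \<theta> * sigma_matrix j (C p)\<bar> \<le> \<kappa>"
proof -
  let ?near = "\<lambda>\<eta> y. \<forall>j\<in>{..<k}. \<forall>p\<in>frontier \<Omega>.
    \<bar>perturbed_curvature j p \<eta> (fst y) (snd y) - \<theta> * sigma_matrix j (C p)\<bar> \<le> \<kappa>"
  have "\<forall>\<^sub>F z in nhds (0, 0, \<theta>). ?near (fst z) (snd z)"
    using perturbed_curvature_uniform[OF \<open>\<kappa> > 0\<close>] by (intro eventually_ball_finite) auto
  then obtain P Q where eventually_P: "eventually P (nhds 0)"
    and eventually_Q: "eventually Q (nhds (0, \<theta>))"
    and near_if_P_Q: "\<And>\<eta> y. P \<eta> \<Longrightarrow> Q y \<Longrightarrow> ?near \<eta> y"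
    unfolding nhds_prod[of 0 "(0, \<theta>)"] eventually_prod_filter by auto
  have "\<forall>\<^sub>F \<eta> in at_right 0. P \<eta>"
    using eventually_P by (auto simp: eventually_at_filter elim: eventually_mono)
  with eventually_at_right_less[of "0 :: real"] have "\<forall>\<^sub>F \<eta> in at_right 0. 0 < \<eta> \<and> P \<eta>"
    by eventually_elim simp
  then obtain \<eta> where \<eta>: "\<eta> > 0" "P \<eta>" by (auto dest: eventually_happens)
  have "P 0" using eventually_P by (rule eventually_nhds_x_imp_x)
  have "\<forall>\<^sub>F t in at_right 0. Q (slope \<xi> t / weight \<xi> t, convexity \<xi> t / weight \<xi> t)"
    by (rule eventually_compose_filterlim[OF eventually_Q])
      (intro tendsto_Pair slope_over_weight_tendsto convexity_over_weight_tendsto[folded \<theta>_def] \<xi>)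
  then have "\<forall>\<^sub>F t in at_right 0. \<forall>\<eta>'\<in>{0, \<eta>}.
      ?near \<eta>' (slope \<xi> t / weight \<xi> t, convexity \<xi> t / weight \<xi> t)"
    by eventually_elim (use near_if_P_Q \<open>P 0\<close> \<open>P \<eta>\<close> in blast)
  with \<eta>(1) show ?thesis unfolding fst_conv snd_conv by blast
qed

definition barrier_bounds :: "real \<Rightarrow> real \<Rightarrow> real \<Rightarrow> real \<Rightarrow> bool" where
  "barrier_bounds \<xi> \<kappa> \<eta> t \<longleftrightarrow> profile_domain \<xi> t \<and> (\<forall>p\<in>frontier \<Omega>.
     (\<forall>j\<in>{1..k}. sigma_matrix j (barrier_hess \<xi> t p \<eta>) > 0) \<and>
     sigma_matrix k (barrier_hess \<xi> t p \<eta>) \<le> source \<xi> t * (\<theta> * L0 k \<Omega> + \<kappa>) \<and>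
     source \<xi> t * (\<theta> * l0 k \<Omega> - \<kappa>) \<le> sigma_matrix k (barrier_hess \<xi> t p \<eta>))"

lemma barrier_boundsI:
  assumes \<xi>: "\<xi> > 0" and t: "profile_domain \<xi> t"
    and near: "\<And>j p. j < k \<Longrightarrow> p \<in> frontier \<Omega> \<Longrightarrow>
      \<bar>perturbed_curvature j p \<eta> (slope \<xi> t / weight \<xi> t) (convexity \<xi> t / weight \<xi> t)
        - \<theta> * sigma_matrix j (C p)\<bar> \<le> \<kappa>'"
    and small: "\<And>j p. j < k \<Longrightarrow> p \<in> frontier \<Omega> \<Longrightarrow> \<kappa>' < \<theta> * sigma_matrix j (C p)" "\<kappa>' \<le> \<kappa>"
  shows "barrier_bounds \<xi> \<kappa> \<eta> t"
  unfolding barrier_bounds_def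
proof (intro conjI ballI t)
  fix p assume p: "p \<in> frontier \<Omega>"
  define W where "W j =
      perturbed_curvature j p \<eta> (slope \<xi> t / weight \<xi> t) (convexity \<xi> t / weight \<xi> t)" for j
  note W = near[OF _ p, folded W_def]
  have sigma: "sigma_matrix (Suc j) (barrier_hess \<xi> t p \<eta>) = weight \<xi> t * slope \<xi> t ^ j * W j" for j
    unfolding W_def by (rule sigma_barrier_hess[OF \<xi> t p])
  show "sigma_matrix j (barrier_hess \<xi> t p \<eta>) > 0" if "j \<in> {1..k}" for j
  proof -
    obtain i where i: "j = Suc i" "i < k" using \<open>j \<in> {1..k}\<close> by (cases j) auto
    have "W i > 0" using W[OF i(2)] small(1)[OF i(2) p] by linarith
    then show ?thesis unfolding i(1) sigma using weight_pos[OF \<xi> t] slope_pos[OF \<xi> t] by simp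
  qed
  have "k - 1 < k" using k_ge_1 by simp
  have sigma_k: "sigma_matrix k (barrier_hess \<xi> t p \<eta>) = source \<xi> t * W (k - 1)"
    using sigma[of "k - 1"] k_ge_1 weight_slope_eq_source[OF \<xi> t] by simp
  have "\<theta> * l0 k \<Omega> \<le> \<theta> * sigma_matrix (k - 1) (C p)" "\<theta> * sigma_matrix (k - 1) (C p) \<le> \<theta> * L0 k \<Omega>"
    using curvature_ge_l0[OF p] curvature_le_L0[OF p] \<theta>_pos by simp_all
  then have "\<theta> * l0 k \<Omega> - \<kappa> \<le> W (k - 1)" "W (k - 1) \<le> \<theta> * L0 k \<Omega> + \<kappa>"
    using W[OF \<open>k - 1 < k\<close>] small(2) by linarith+
  then show "sigma_matrix k (barrier_hess \<xi> t p \<eta>) \<le> source \<xi> t * (\<theta> * L0 k \<Omega> + \<kappa>)"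
    "source \<xi> t * (\<theta> * l0 k \<Omega> - \<kappa>) \<le> sigma_matrix k (barrier_hess \<xi> t p \<eta>)"
    unfolding sigma_k using source_pos[OF \<xi> t] by (simp_all add: mult_left_mono less_imp_le)
qed

lemma eventually_barrier_bounds:
  assumes \<xi>: "\<xi> > 0" and "\<kappa> > 0"
  shows "\<exists>\<eta>>0. \<forall>\<^sub>F t in at_right 0. barrier_bounds \<xi> \<kappa> 0 t \<and> barrier_bounds \<xi> \<kappa> \<eta> t"
proof -
  obtain c where "c > 0" and curvature_ge: "\<And>j p. j < k \<Longrightarrow> p \<in> frontier \<Omega> \<Longrightarrow> c \<le> sigma_matrix j (C p)"
    using curvature_lower_bound by blast
  then have "\<theta> * c > 0" using \<theta>_pos by simp
  define \<kappa>' where "\<kappa>' = min \<kappa> (\<theta> * c / 2)"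
  have "\<kappa>' > 0" "\<kappa>' \<le> \<kappa>" using \<open>\<kappa> > 0\<close> \<open>\<theta> * c > 0\<close> by (simp_all add: \<kappa>'_def)
  have small: "\<kappa>' < \<theta> * sigma_matrix j (C p)" if "j < k" "p \<in> frontier \<Omega>" for j p
  proof -
    have "\<kappa>' < \<theta> * c" using \<open>\<theta> * c > 0\<close> unfolding \<kappa>'_def by linarith
    also have "\<dots> \<le> \<theta> * sigma_matrix j (C p)" using curvature_ge[OF that] \<theta>_pos by simp
    finally show ?thesis .
  qed
  obtain \<eta> where "\<eta> > 0" and near: "\<forall>\<^sub>F t in at_right 0. \<forall>\<eta>'\<in>{0, \<eta>}. \<forall>j\<in>{..<k}. \<forall>p\<in>frontier \<Omega>.
      \<bar>perturbed_curvature j p \<eta>' (slope \<xi> t / weight \<xi> t) (convexity \<xi> t / weight \<xi> t)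
        - \<theta> * sigma_matrix j (C p)\<bar> \<le> \<kappa>'"
    using eventually_perturbed_curvature[OF \<xi> \<open>\<kappa>' > 0\<close>] by blast
  from near eventually_profile_domain[OF \<xi>]
  have "\<forall>\<^sub>F t in at_right 0. barrier_bounds \<xi> \<kappa> 0 t \<and> barrier_bounds \<xi> \<kappa> \<eta> t"
  proof eventually_elim
    case (elim t)
    then have "barrier_bounds \<xi> \<kappa> \<eta>' t" if "\<eta>' \<in> {0, \<eta>}" for \<eta>'
      using that by (intro barrier_boundsI[OF \<xi> _ _ small \<open>\<kappa>' \<le> \<kappa>\<close>]) auto
    then show ?case by simp
  qed
  with \<open>\<eta> > 0\<close> show ?thesis by blast
qed

lemma
  assumes \<xi>: "\<xi> > 0" and t0: "\<And>s. 0 < s \<Longrightarrow> s < t0 \<Longrightarrow> profile_domain \<xi> s"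
    and z: "0 < d z + r" "d z + r < t0"
  shows barrier_superjet: "(\<nu> p, - (C p + \<eta> *\<^sub>R tangent_proj (\<nu> p))) \<in> subjet d z \<Longrightarrow>
      (- slope \<xi> (d z + r) *\<^sub>R \<nu> p, barrier_hess \<xi> (d z + r) p \<eta>)
        \<in> superjet (\<lambda>y. profile \<xi> (d y + r)) z"
    and barrier_subjet: "(\<nu> p, - (C p + \<eta> *\<^sub>R tangent_proj (\<nu> p))) \<in> superjet d z \<Longrightarrow>
      (- slope \<xi> (d z + r) *\<^sub>R \<nu> p, barrier_hess \<xi> (d z + r) p \<eta>)
        \<in> subjet (\<lambda>y. profile \<xi> (d y + r)) z"
proof -
  define B where "B = C p + \<eta> *\<^sub>R tangent_proj (\<nu> p)"
  have hess_eq: "barrier_hess \<xi> t p \<eta> = convexity \<xi> t *\<^sub>R outer (\<nu> p) + - slope \<xi> t *\<^sub>R (- B)" for t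
    unfolding barrier_hess_def B_def[symmetric] by simp
  have cont: "isCont (\<lambda>y. d y + r) z" by (intro continuous_intros isCont_dist_bd)
  have deriv: "(profile \<xi> has_real_derivative - slope \<xi> s) (at s)" if "s \<in> {0<..<t0}" for s
    using profile_deriv[OF \<xi> t0] that by simp
  have deriv2: "((\<lambda>s. - slope \<xi> s) has_real_derivative convexity \<xi> (d z + r)) (at (d z + r))"
    using DERIV_minus[OF slope_deriv[OF \<xi> t0[OF z]]] by simp
  have anti: "profile \<xi> s' \<le> profile \<xi> s" if "s \<in> {0<..<t0}" "s' \<in> {0<..<t0}" "s \<le> s'" for s s'
    using profile_antimono[OF \<xi> t0] that by simp
  have slope: "- slope \<xi> (d z + r) \<le> 0" using slope_pos[OF \<xi> t0[OF z]] by simp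
  have domain: "open {0<..<t0}" "d z + r \<in> {0<..<t0}" using z by auto
  show "(- slope \<xi> (d z + r) *\<^sub>R \<nu> p, barrier_hess \<xi> (d z + r) p \<eta>)
    \<in> superjet (\<lambda>y. profile \<xi> (d y + r)) z"
    if "(\<nu> p, - (C p + \<eta> *\<^sub>R tangent_proj (\<nu> p))) \<in> subjet d z"
  proof -
    have "(\<nu> p, - B) \<in> subjet (\<lambda>y. d y + r) z" using that by (simp only: subjet_add_const B_def)
    from superjet_compose_antimono[OF this cont domain deriv deriv2 anti slope] show ?thesis
      unfolding hess_eq .
  qed
  show "(- slope \<xi> (d z + r) *\<^sub>R \<nu> p, barrier_hess \<xi> (d z + r) p \<eta>)
    \<in> subjet (\<lambda>y. profile \<xi> (d y + r)) z"
    if "(\<nu> p, - (C p + \<eta> *\<^sub>R tangent_proj (\<nu> p))) \<in> superjet d z"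
  proof -
    have "(\<nu> p, - B) \<in> superjet (\<lambda>y. d y + r) z" using that by (simp only: superjet_add_const B_def)
    from subjet_compose_antimono[OF this cont domain deriv deriv2 anti slope] show ?thesis
      unfolding hess_eq .
  qed
qed

end

section \<open>Boundary behaviour of large solutions\<close>

lemma
  fixes a v c :: real
  shows perturbed_product_less: "a * v < c \<Longrightarrow> \<exists>\<kappa>>0. a * (v + \<kappa>) < c - \<kappa>"
    and perturbed_product_greater: "c < a * v \<Longrightarrow> \<exists>\<kappa>>0. c + \<kappa> < a * (v - \<kappa>)"
proof -
  have less: "\<exists>\<kappa>>0. a * (v + \<kappa>) < c - \<kappa>" if "a * v < c" for v c :: real
  proof -
    have "((\<lambda>\<kappa>. a * (v + \<kappa>) + \<kappa>) \<longlongrightarrow> a * v) (at_right 0)" by (auto intro!: tendsto_eq_intros)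
    from order_tendstoD(2)[OF this that] show ?thesis
      unfolding eventually_at_right_field by (metis add.commute dense less_diff_eq)
  qed
  show "a * v < c \<Longrightarrow> \<exists>\<kappa>>0. a * (v + \<kappa>) < c - \<kappa>" by (rule less)
  show "\<exists>\<kappa>>0. c + \<kappa> < a * (v - \<kappa>)" if "c < a * v"
    using less[of "- v" "- c"] that by (auto simp: algebra_simps)
qed

lemma powr_root_scale:
  fixes c v :: real and k :: nat
  assumes "c > 0" "v > 0"
  defines "x \<equiv> (c / v) powr (1 / real (k + 1))"
  shows "x > 0" and "x ^ (k + 1) * v = c"
proof -
  show "x > 0" using assms by (simp add: x_def)
  then have "x ^ (k + 1) = x powr real (k + 1)" by (rule powr_realpow[symmetric])
  also have "\<dots> = c / v" using assms by (simp add: x_def powr_powr)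
  finally show "x ^ (k + 1) * v = c" using assms by simp
qed

locale large_solution = boundary_barriers k f Cf m M \<delta>0 Cm \<Omega>
  for k f Cf m M \<delta>0 Cm and \<Omega> :: "(real^'n) set" +
  fixes b u :: "real^'n \<Rightarrow> real" and bl bu :: real
  assumes bl_pos: "bl > 0" and bu_pos: "bu > 0"
    and b_Liminf: "Liminf (bd_filter \<Omega>) (\<lambda>x. ereal (b x / m (dist_bd \<Omega> x) ^ (k + 1))) = ereal bl"
    and b_Limsup: "Limsup (bd_filter \<Omega>) (\<lambda>x. ereal (b x / m (dist_bd \<Omega> x) ^ (k + 1))) = ereal bu"
    and u_pos: "\<And>x. x \<in> \<Omega> \<Longrightarrow> u x > 0"
    and u_solution: "visc_sol k b f \<Omega> u"
    and u_at_top: "filterlim u at_top (bd_filter \<Omega>)"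
begin

lemmas eventually_boundary = eventually_bd_filter[OF open_\<Omega> frontier_nonempty]

lemma u_cont: "continuous_on \<Omega> u"
  using u_solution by (simp add: visc_sol_def visc_sub_def)

lemma m_power_pos: "\<forall>\<^sub>F x in bd_filter \<Omega>. m (d x) ^ (k + 1) > 0"
  using eventually_bd_filter_dist_bd[OF eventually_near_0] by eventually_elim (simp add: m_pos)

lemma b_lower: "\<kappa> > 0 \<Longrightarrow> \<forall>\<^sub>F x in bd_filter \<Omega>. (bl - \<kappa>) * m (d x) ^ (k + 1) < b x"
proof -
  assume "\<kappa> > 0"
  then have "ereal (bl - \<kappa>) < Liminf (bd_filter \<Omega>) (\<lambda>x. ereal (b x / m (d x) ^ (k + 1)))"
    by (simp only: b_Liminf) simp
  from less_LiminfD[OF this] m_power_pos show ?thesis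
    by eventually_elim (simp add: less_divide_eq)
qed

lemma b_upper: "\<kappa> > 0 \<Longrightarrow> \<forall>\<^sub>F x in bd_filter \<Omega>. b x < (bu + \<kappa>) * m (d x) ^ (k + 1)"
proof -
  assume "\<kappa> > 0"
  then have "Limsup (bd_filter \<Omega>) (\<lambda>x. ereal (b x / m (d x) ^ (k + 1))) < ereal (bu + \<kappa>)"
    by (simp only: b_Limsup) simp
  from Limsup_lessD[OF this] m_power_pos show ?thesis
    by eventually_elim (simp add: divide_less_eq)
qed

lemma no_touching_from_below:
  assumes \<xi>: "\<xi> > 0" and gap: "\<xi> ^ (k + 1) * (\<theta> * L0 k \<Omega> + \<kappa>) < bl - \<kappa>" "\<kappa> > 0"
    and z: "z \<in> \<Omega>" "(bl - \<kappa>) * m (d z) ^ (k + 1) < b z"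
    and t: "profile_domain \<xi> t" "t \<le> d z" "d z < \<delta>0" "profile \<xi> t < u z"
    and A: "\<And>j. j \<in> {1..k} \<Longrightarrow> sigma_matrix j A > 0"
      "sigma_matrix k A \<le> source \<xi> t * (\<theta> * L0 k \<Omega> + \<kappa>)"
  shows "(q, A) \<notin> superjet u z"
proof
  let ?S = "m t ^ (k + 1) * f (profile \<xi> t)"
  assume "(q, A) \<in> superjet u z"
  then have "b z * f (u z) \<le> sigma_matrix k A"
    using u_solution A(1) by (intro visc_sub_superjet[OF open_\<Omega> z(1)]) (auto simp: visc_sol_def)
  also have "\<dots> \<le> \<xi> ^ (k + 1) * (\<theta> * L0 k \<Omega> + \<kappa>) * ?S" using A(2) by (simp add: source_def mult_ac)
  also have "\<dots> < (bl - \<kappa>) * ?S"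
    by (rule mult_strict_right_mono[OF gap(1) source_density_pos[OF \<xi> t(1)]])
  also have "\<dots> \<le> (bl - \<kappa>) * (m (d z) ^ (k + 1) * f (u z))"
  proof (intro mult_left_mono mult_mono power_mono)
    have t': "0 < t" "t < \<delta>0" "0 < profile \<xi> t"
      using t(1) profile_gt_1[OF \<xi> t(1)] by (simp_all add: profile_domain_def)
    show "m t \<le> m (d z)" "0 \<le> m t" "0 \<le> m (d z) ^ (k + 1)" "0 \<le> f (profile \<xi> t)"
      using t' m_le[of t "d z"] m_pos[of t] m_pos[of "d z"] t(2,3) f_pos
      by (simp_all add: less_imp_le)
    show "f (profile \<xi> t) \<le> f (u z)" using f_mono t'(3) t(4) by (simp add: mono_on_def)
    have "0 < \<xi> ^ (k + 1) * (\<theta> * L0 k \<Omega> + \<kappa>)" using \<xi> \<theta>_pos L0_pos gap(2) by (simp add: add_pos_pos)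
    then show "0 \<le> bl - \<kappa>" using gap(1) by linarith
  qed
  also have "\<dots> < b z * f (u z)"
    using mult_strict_right_mono[OF z(2) f_pos[OF u_pos[OF z(1)]]] by (simp only: mult.assoc)
  finally show False .
qed

lemma no_touching_from_above:
  assumes \<xi>: "\<xi> > 0" and gap: "bu + \<kappa> < \<xi> ^ (k + 1) * (\<theta> * l0 k \<Omega> - \<kappa>)" "\<kappa> > 0"
    and z: "z \<in> \<Omega>" "b z < (bu + \<kappa>) * m (d z) ^ (k + 1)"
    and t: "profile_domain \<xi> t" "d z \<le> t" "u z < profile \<xi> t"
    and A: "\<And>j. j \<in> {1..k} \<Longrightarrow> sigma_matrix j A > 0"
      "source \<xi> t * (\<theta> * l0 k \<Omega> - \<kappa>) \<le> sigma_matrix k A"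
  shows "(q, A) \<notin> subjet u z"
proof
  let ?S = "m t ^ (k + 1) * f (profile \<xi> t)"
  assume "(q, A) \<in> subjet u z"
  then have "sigma_matrix k A \<le> b z * f (u z)"
    using u_solution A(1) by (intro visc_super_subjet[OF open_\<Omega> z(1)]) (auto simp: visc_sol_def)
  also have "\<dots> < (bu + \<kappa>) * (m (d z) ^ (k + 1) * f (u z))"
    using mult_strict_right_mono[OF z(2) f_pos[OF u_pos[OF z(1)]]] by (simp only: mult.assoc)
  also have "\<dots> \<le> (bu + \<kappa>) * ?S"
  proof (intro mult_left_mono mult_mono power_mono)
    have "t < \<delta>0" "0 < d z" using t(1) d_pos[OF z(1)] by (simp_all add: profile_domain_def)
    then show "m (d z) \<le> m t" "0 \<le> m (d z)" "0 \<le> m t ^ (k + 1)" "0 \<le> f (u z)"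
      using m_le[of "d z" t] m_pos[of t] m_pos[of "d z"] t(2) f_pos u_pos[OF z(1)]
      by (simp_all add: less_imp_le)
    show "f (u z) \<le> f (profile \<xi> t)" using f_mono u_pos[OF z(1)] t(3) by (simp add: mono_on_def)
    show "0 \<le> bu + \<kappa>" using bu_pos gap(2) by simp
  qed
  also have "\<dots> < \<xi> ^ (k + 1) * (\<theta> * l0 k \<Omega> - \<kappa>) * ?S"
    by (rule mult_strict_right_mono[OF gap(1) source_density_pos[OF \<xi> t(1)]])
  also have "\<dots> \<le> sigma_matrix k A" using A(2) by (simp add: source_def mult_ac)
  finally show False by simp
qed

lemma upper_barrier_local_maximum:
  assumes \<xi>: "\<xi> > 0" and gap: "\<xi> ^ (k + 1) * (\<theta> * L0 k \<Omega>) < bl"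
  shows "\<exists>\<delta>>0. (\<forall>t. 0 < t \<longrightarrow> t < \<delta> \<longrightarrow> profile_domain \<xi> t) \<and>
    (\<forall>r\<le>0. \<forall>z\<in>\<Omega>. 0 < d z + r \<longrightarrow> d z < \<delta> \<longrightarrow>
      (\<forall>\<^sub>F y in nhds z. u y - profile \<xi> (d y + r) \<le> u z - profile \<xi> (d z + r)) \<longrightarrow>
      u z \<le> profile \<xi> (d z + r))"
proof -
  obtain \<kappa> where "\<kappa> > 0" and gap\<kappa>: "\<xi> ^ (k + 1) * (\<theta> * L0 k \<Omega> + \<kappa>) < bl - \<kappa>"
    using perturbed_product_less[OF gap] by blast
  obtain \<eta> t0 where "\<eta> > 0" "t0 > 0" and bounds: "\<And>t. 0 < t \<Longrightarrow> t < t0 \<Longrightarrow> barrier_bounds \<xi> \<kappa> \<eta> t"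
    using eventually_barrier_bounds[OF \<xi> \<open>\<kappa> > 0\<close>] unfolding eventually_at_right_field by blast
  have domain: "profile_domain \<xi> t" if "0 < t" "t < t0" for t
    using bounds[OF that] by (simp add: barrier_bounds_def)
  obtain \<delta>\<^sub>1 where "\<delta>\<^sub>1 > 0" and jet: "\<And>x p. x \<in> \<Omega> \<Longrightarrow> d x < \<delta>\<^sub>1 \<Longrightarrow> p \<in> frontier \<Omega> \<Longrightarrow> d x = norm (x - p) \<Longrightarrow>
      (\<nu> p, - (C p + \<eta> *\<^sub>R tangent_proj (\<nu> p))) \<in> subjet d x"
    using subjet_dist_bd[OF \<open>\<eta> > 0\<close>] by blast
  obtain \<delta>\<^sub>2 where "\<delta>\<^sub>2 > 0" and b_gt: "\<And>x. x \<in> \<Omega> \<Longrightarrow> d x < \<delta>\<^sub>2 \<Longrightarrow> (bl - \<kappa>) * m (d x) ^ (k + 1) < b x"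
    using b_lower[OF \<open>\<kappa> > 0\<close>] unfolding eventually_boundary by blast
  define \<delta> where "\<delta> = min (min t0 \<delta>0) (min \<delta>\<^sub>1 \<delta>\<^sub>2)"
  have "u z \<le> profile \<xi> (d z + r)"
    if r: "r \<le> 0" and z: "z \<in> \<Omega>" "0 < d z + r" "d z < \<delta>"
      and touching: "\<forall>\<^sub>F y in nhds z. u y - profile \<xi> (d y + r) \<le> u z - profile \<xi> (d z + r)" for r z
  proof (rule ccontr)
    assume above: "\<not> u z \<le> profile \<xi> (d z + r)"
    have t: "d z + r < t0" using r z by (simp add: \<delta>_def)
    obtain p where p: "p \<in> frontier \<Omega>" "d z = norm (z - p)"
      using dist_bd_attained[OF frontier_nonempty] .
    have "d z < \<delta>\<^sub>1" using z(3) by (simp add: \<delta>_def)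
    note superjet_local_maximum[OF barrier_superjet[OF \<xi> domain z(2) t jet[OF z(1) this p]] touching]
    moreover have "(q, barrier_hess \<xi> (d z + r) p \<eta>) \<notin> superjet u z" for q
      using no_touching_from_below[OF \<xi> gap\<kappa> \<open>\<kappa> > 0\<close> z(1) b_gt[OF z(1)] domain[OF z(2) t]]
        bounds[OF z(2) t] p(1) r z(3) above
      by (simp add: \<delta>_def barrier_bounds_def)
    ultimately show False by blast
  qed
  moreover have "\<delta> > 0" using \<open>t0 > 0\<close> \<open>\<delta>\<^sub>1 > 0\<close> \<open>\<delta>\<^sub>2 > 0\<close> \<delta>0_pos by (simp add: \<delta>_def)
  moreover have "profile_domain \<xi> t" if "0 < t" "t < \<delta>" for t using domain that by (simp add: \<delta>_def)
  ultimately show ?thesis by blast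
qed

lemma lower_barrier_local_minimum:
  assumes \<xi>: "\<xi> > 0" and gap: "bu < \<xi> ^ (k + 1) * (\<theta> * l0 k \<Omega>)"
  shows "\<exists>\<delta>>0. (\<forall>t. 0 < t \<longrightarrow> t < \<delta> \<longrightarrow> profile_domain \<xi> t) \<and>
    (\<forall>r\<ge>0. \<forall>z\<in>\<Omega>. d z + r < \<delta> \<longrightarrow>
      (\<forall>\<^sub>F y in nhds z. u z - profile \<xi> (d z + r) \<le> u y - profile \<xi> (d y + r)) \<longrightarrow>
      profile \<xi> (d z + r) \<le> u z)"
proof -
  obtain \<kappa> where "\<kappa> > 0" and gap\<kappa>: "bu + \<kappa> < \<xi> ^ (k + 1) * (\<theta> * l0 k \<Omega> - \<kappa>)"
    using perturbed_product_greater[OF gap] by blast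
  obtain t0 where "t0 > 0" and bounds: "\<And>t. 0 < t \<Longrightarrow> t < t0 \<Longrightarrow> barrier_bounds \<xi> \<kappa> 0 t"
    using eventually_barrier_bounds[OF \<xi> \<open>\<kappa> > 0\<close>] unfolding eventually_at_right_field by blast
  have domain: "profile_domain \<xi> t" if "0 < t" "t < t0" for t
    using bounds[OF that] by (simp add: barrier_bounds_def)
  obtain \<delta>' where "\<delta>' > 0" and b_lt: "\<And>x. x \<in> \<Omega> \<Longrightarrow> d x < \<delta>' \<Longrightarrow> b x < (bu + \<kappa>) * m (d x) ^ (k + 1)"
    using b_upper[OF \<open>\<kappa> > 0\<close>] unfolding eventually_boundary by blast
  define \<delta> where "\<delta> = min t0 \<delta>'"
  have "profile \<xi> (d z + r) \<le> u z"
    if r: "r \<ge> 0" and z: "z \<in> \<Omega>" "d z + r < \<delta>"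
      and touching: "\<forall>\<^sub>F y in nhds z. u z - profile \<xi> (d z + r) \<le> u y - profile \<xi> (d y + r)" for r z
  proof (rule ccontr)
    assume below: "\<not> profile \<xi> (d z + r) \<le> u z"
    have t: "0 < d z + r" "d z + r < t0" using r z d_pos[OF z(1)] by (simp_all add: \<delta>_def)
    obtain p where p: "p \<in> frontier \<Omega>" "d z = norm (z - p)"
      using dist_bd_attained[OF frontier_nonempty] .
    have "(\<nu> p, - (C p + 0 *\<^sub>R tangent_proj (\<nu> p))) \<in> superjet d z"
      using superjet_dist_bd[OF z(1) p] by simp
    note subjet_local_minimum[OF barrier_subjet[OF \<xi> domain t this] touching]
    moreover have "(q, barrier_hess \<xi> (d z + r) p 0) \<notin> subjet u z" for q
      using no_touching_from_above[OF \<xi> gap\<kappa> \<open>\<kappa> > 0\<close> z(1) b_lt[OF z(1)] domain[OF t]]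
        bounds[OF t] p(1) r z(2) below
      by (simp add: \<delta>_def barrier_bounds_def)
    ultimately show False by blast
  qed
  moreover have "\<delta> > 0" using \<open>t0 > 0\<close> \<open>\<delta>' > 0\<close> by (simp add: \<delta>_def)
  moreover have "profile_domain \<xi> t" if "0 < t" "t < \<delta>" for t using domain that by (simp add: \<delta>_def)
  ultimately show ?thesis by blast
qed

lemma profile_tendsto_shift:
  assumes "isCont (profile \<xi>) t"
  shows "((\<lambda>\<sigma>. profile \<xi> (t + c * \<sigma>)) \<longlongrightarrow> profile \<xi> t) (at_right 0)"
  by (rule isCont_tendsto_compose[OF assms]) (auto intro!: tendsto_eq_intros)

lemma upper_barrier_shifted_comparison:
  assumes \<xi>: "\<xi> > 0" and "\<xi> ^ (k + 1) * (\<theta> * L0 k \<Omega>) < bl"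
  shows "\<exists>\<delta>>0. \<exists>c. (\<forall>t. 0 < t \<longrightarrow> t < \<delta> \<longrightarrow> profile_domain \<xi> t) \<and>
    (\<forall>\<sigma>>0. \<forall>x\<in>\<Omega>. \<sigma> < d x \<longrightarrow> d x < \<delta> \<longrightarrow> u x - profile \<xi> (d x - \<sigma>) \<le> c)"
proof -
  obtain \<delta> where "\<delta> > 0" and domain: "\<And>t. 0 < t \<Longrightarrow> t < \<delta> \<Longrightarrow> profile_domain \<xi> t"
    and local_max: "\<And>r z. r \<le> 0 \<Longrightarrow> z \<in> \<Omega> \<Longrightarrow> 0 < d z + r \<Longrightarrow> d z < \<delta> \<Longrightarrow>
      \<forall>\<^sub>F y in nhds z. u y - profile \<xi> (d y + r) \<le> u z - profile \<xi> (d z + r) \<Longrightarrow>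
      u z \<le> profile \<xi> (d z + r)"
    using upper_barrier_local_maximum[OF assms] by blast
  obtain c where outer_bound: "c \<ge> 0" "\<And>x. x \<in> \<Omega> \<Longrightarrow> \<delta> / 2 \<le> d x \<Longrightarrow> d x \<le> \<delta> / 2 \<Longrightarrow> u x \<le> c"
    using bounded_above_on_dist_bd_strip[OF open_\<Omega> bounded_\<Omega> u_cont half_gt_zero[OF \<open>\<delta> > 0\<close>],
        where \<delta> = "\<delta> / 2"] by blast
  have "u x - profile \<xi> (d x - \<sigma>) \<le> c" if x: "x \<in> \<Omega>" "\<sigma> < d x" "d x < \<delta> / 2" and "0 < \<sigma>" for x \<sigma>
  proof (rule dist_bd_strip_maximum_principle[OF open_\<Omega> bounded_\<Omega>, where a = \<sigma> and \<delta> = "\<delta> / 2"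
        and w = "\<lambda>y. u y - profile \<xi> (d y - \<sigma>)"])
    show "continuous_on {y \<in> \<Omega>. \<sigma> < d y \<and> d y \<le> \<delta> / 2} (\<lambda>y. u y - profile \<xi> (d y - \<sigma>))"
      using \<open>\<delta> > 0\<close> \<open>0 < \<sigma>\<close>
      by (intro continuous_intros continuous_on_subset[OF u_cont]
          continuous_on_compose2[OF profile_cont[OF \<xi> domain]]) auto
    show "\<exists>s>\<sigma>. \<forall>y\<in>\<Omega>. \<sigma> < d y \<longrightarrow> d y < s \<longrightarrow> d y \<le> \<delta> / 2 \<longrightarrow> u y - profile \<xi> (d y - \<sigma>) \<le> c"
    proof -
      obtain c' where strip_bound: "\<And>y. y \<in> \<Omega> \<Longrightarrow> \<sigma> \<le> d y \<Longrightarrow> d y \<le> \<delta> / 2 \<Longrightarrow> u y \<le> c'"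
        using bounded_above_on_dist_bd_strip[OF open_\<Omega> bounded_\<Omega> u_cont \<open>0 < \<sigma>\<close>] by metis
      have "\<forall>\<^sub>F t in at_right 0. c' \<le> profile \<xi> t"
        using profile_at_top[OF \<xi>] by (simp add: filterlim_at_top)
      then obtain s where profile_large: "s > 0" "\<And>t. 0 < t \<Longrightarrow> t < s \<Longrightarrow> c' \<le> profile \<xi> t"
        unfolding eventually_at_right_field by blast
      have "u y - profile \<xi> (d y - \<sigma>) \<le> c" if "y \<in> \<Omega>" "\<sigma> < d y" "d y < \<sigma> + s" "d y \<le> \<delta> / 2" for y
        using strip_bound[of y] profile_large(2)[of "d y - \<sigma>"] that \<open>c \<ge> 0\<close> by simp
      then show ?thesis using profile_large(1) by (intro exI[of _ "\<sigma> + s"]) simp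
    qed
    show "u y - profile \<xi> (d y - \<sigma>) \<le> c" if "y \<in> \<Omega>" "d y = \<delta> / 2" for y
      using outer_bound(2)[OF that(1)] that(2) profile_gt_1[OF \<xi> domain[of "d y - \<sigma>"]] x \<open>0 < \<sigma>\<close>
      by simp
    show False if "z \<in> \<Omega>" "\<sigma> < d z" "d z < \<delta> / 2" "c < u z - profile \<xi> (d z - \<sigma>)"
      "\<forall>\<^sub>F y in nhds z. u y - profile \<xi> (d y - \<sigma>) \<le> u z - profile \<xi> (d z - \<sigma>)" for z
      using local_max[of "- \<sigma>" z] that \<open>0 < \<sigma>\<close> \<open>c \<ge> 0\<close> \<open>\<delta> > 0\<close> by simp
  qed (use x \<open>0 < \<sigma>\<close> in auto)
  then show ?thesis using \<open>\<delta> > 0\<close> domain by (intro exI[of _ "\<delta> / 2"] exI[of _ c]) auto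
qed

lemma upper_barrier_estimate:
  assumes \<xi>: "\<xi> > 0" and "\<xi> ^ (k + 1) * (\<theta> * L0 k \<Omega>) < bl"
  shows "\<exists>c. \<forall>\<^sub>F x in bd_filter \<Omega>. u x \<le> profile \<xi> (d x) + c"
proof -
  obtain \<delta> c where "\<delta> > 0" and domain: "\<And>t. 0 < t \<Longrightarrow> t < \<delta> \<Longrightarrow> profile_domain \<xi> t"
    and compare: "\<And>x \<sigma>. 0 < \<sigma> \<Longrightarrow> x \<in> \<Omega> \<Longrightarrow> \<sigma> < d x \<Longrightarrow> d x < \<delta> \<Longrightarrow> u x - profile \<xi> (d x - \<sigma>) \<le> c"
    using upper_barrier_shifted_comparison[OF assms] by blast
  have "u x \<le> profile \<xi> (d x) + c" if x: "x \<in> \<Omega>" "d x < \<delta>" for x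
  proof (rule tendsto_lowerbound)
    have "isCont (profile \<xi>) (d x)"
      using x d_pos[OF x(1)] by (intro DERIV_isCont[OF profile_deriv[OF \<xi> domain]]) auto
    from tendsto_add[OF profile_tendsto_shift[OF this, of "-1"] tendsto_const]
    show "((\<lambda>\<sigma>. profile \<xi> (d x + -1 * \<sigma>) + c) \<longlongrightarrow> profile \<xi> (d x) + c) (at_right 0)" .
    have "\<forall>\<^sub>F \<sigma> in at_right 0. 0 < \<sigma> \<and> \<sigma> < d x"
      using d_pos[OF x(1)] unfolding eventually_at_right_field by blast
    then show "\<forall>\<^sub>F \<sigma> in at_right 0. u x \<le> profile \<xi> (d x + -1 * \<sigma>) + c"
      by eventually_elim (use compare x in force)
  qed simp
  with \<open>\<delta> > 0\<close> show ?thesis unfolding eventually_boundary by blast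
qed

lemma lower_barrier_shifted_comparison:
  assumes \<xi>: "\<xi> > 0" and "bu < \<xi> ^ (k + 1) * (\<theta> * l0 k \<Omega>)"
  shows "\<exists>\<delta>>0. \<exists>c. (\<forall>t. 0 < t \<longrightarrow> t < \<delta> \<longrightarrow> profile_domain \<xi> t) \<and>
    (\<forall>\<sigma>>0. \<forall>x\<in>\<Omega>. \<sigma> < \<delta> \<longrightarrow> d x < \<delta> \<longrightarrow> profile \<xi> (d x + \<sigma>) - u x \<le> c)"
proof -
  obtain \<delta> where "\<delta> > 0" and domain: "\<And>t. 0 < t \<Longrightarrow> t < \<delta> \<Longrightarrow> profile_domain \<xi> t"
    and local_min: "\<And>r z. 0 \<le> r \<Longrightarrow> z \<in> \<Omega> \<Longrightarrow> d z + r < \<delta> \<Longrightarrow>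
      \<forall>\<^sub>F y in nhds z. u z - profile \<xi> (d z + r) \<le> u y - profile \<xi> (d y + r) \<Longrightarrow>
      profile \<xi> (d z + r) \<le> u z"
    using lower_barrier_local_minimum[OF assms] by blast
  define c where "c = profile \<xi> (\<delta> / 2)"
  have "c \<ge> 0" using profile_gt_1[OF \<xi> domain[of "\<delta> / 2"]] \<open>\<delta> > 0\<close> by (simp add: c_def)
  have "profile \<xi> (d x + \<sigma>) - u x \<le> c" if x: "x \<in> \<Omega>" "d x < \<delta> / 2" and "0 < \<sigma>" "\<sigma> < \<delta> / 2" for x \<sigma>
  proof (rule dist_bd_strip_maximum_principle[OF open_\<Omega> bounded_\<Omega>, where a = 0 and \<delta> = "\<delta> / 2"
        and w = "\<lambda>y. profile \<xi> (d y + \<sigma>) - u y"])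
    note less_\<delta> = \<open>\<sigma> < \<delta> / 2\<close> \<open>0 < \<sigma>\<close>
    show "continuous_on {y \<in> \<Omega>. 0 < d y \<and> d y \<le> \<delta> / 2} (\<lambda>y. profile \<xi> (d y + \<sigma>) - u y)"
      using less_\<delta>
      by (intro continuous_intros continuous_on_subset[OF u_cont]
          continuous_on_compose2[OF profile_cont[OF \<xi> domain]]) auto
    show "\<exists>s>0. \<forall>y\<in>\<Omega>. 0 < d y \<longrightarrow> d y < s \<longrightarrow> d y \<le> \<delta> / 2 \<longrightarrow> profile \<xi> (d y + \<sigma>) - u y \<le> c"
    proof -
      have "\<forall>\<^sub>F y in bd_filter \<Omega>. profile \<xi> \<sigma> \<le> u y" using u_at_top by (simp add: filterlim_at_top)
      then obtain s where u_large: "s > 0" "\<And>y. y \<in> \<Omega> \<Longrightarrow> d y < s \<Longrightarrow> profile \<xi> \<sigma> \<le> u y"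
        unfolding eventually_boundary by blast
      have "profile \<xi> (d y + \<sigma>) - u y \<le> c" if "y \<in> \<Omega>" "0 < d y" "d y < s" "d y \<le> \<delta> / 2" for y
        using profile_antimono[OF \<xi> domain, of \<delta> \<sigma> "d y + \<sigma>"] u_large(2)[of y] that less_\<delta> \<open>c \<ge> 0\<close>
        by simp
      then show ?thesis using u_large(1) by (intro exI[of _ s]) simp
    qed
    show "profile \<xi> (d y + \<sigma>) - u y \<le> c" if "y \<in> \<Omega>" "d y = \<delta> / 2" for y
      using profile_antimono[OF \<xi> domain, of \<delta> "\<delta> / 2" "\<delta> / 2 + \<sigma>"] less_\<delta> u_pos[OF that(1)]
      unfolding c_def that(2) by simp
    show False if "z \<in> \<Omega>" "0 < d z" "d z < \<delta> / 2" "c < profile \<xi> (d z + \<sigma>) - u z"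
      and max: "\<forall>\<^sub>F y in nhds z. profile \<xi> (d y + \<sigma>) - u y \<le> profile \<xi> (d z + \<sigma>) - u z" for z
    proof -
      have "\<forall>\<^sub>F y in nhds z. u z - profile \<xi> (d z + \<sigma>) \<le> u y - profile \<xi> (d y + \<sigma>)"
        using max by eventually_elim linarith
      then show False using local_min[of \<sigma> z] that less_\<delta> \<open>c \<ge> 0\<close> by simp
    qed
  qed (use x d_pos in auto)
  then show ?thesis using \<open>\<delta> > 0\<close> domain by (intro exI[of _ "\<delta> / 2"] exI[of _ c]) auto
qed

lemma lower_barrier_estimate:
  assumes \<xi>: "\<xi> > 0" and "bu < \<xi> ^ (k + 1) * (\<theta> * l0 k \<Omega>)"
  shows "\<exists>c. \<forall>\<^sub>F x in bd_filter \<Omega>. profile \<xi> (d x) \<le> u x + c"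
proof -
  obtain \<delta> c where "\<delta> > 0" and domain: "\<And>t. 0 < t \<Longrightarrow> t < \<delta> \<Longrightarrow> profile_domain \<xi> t"
    and compare: "\<And>x \<sigma>. 0 < \<sigma> \<Longrightarrow> x \<in> \<Omega> \<Longrightarrow> \<sigma> < \<delta> \<Longrightarrow> d x < \<delta> \<Longrightarrow> profile \<xi> (d x + \<sigma>) - u x \<le> c"
    using lower_barrier_shifted_comparison[OF assms] by blast
  have "profile \<xi> (d x) \<le> u x + c" if x: "x \<in> \<Omega>" "d x < \<delta>" for x
  proof (rule tendsto_upperbound)
    have "isCont (profile \<xi>) (d x)"
      using x d_pos[OF x(1)] by (intro DERIV_isCont[OF profile_deriv[OF \<xi> domain]]) auto
    from profile_tendsto_shift[OF this, of 1]
    show "((\<lambda>\<sigma>. profile \<xi> (d x + 1 * \<sigma>)) \<longlongrightarrow> profile \<xi> (d x)) (at_right 0)" .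
    have "\<forall>\<^sub>F \<sigma> in at_right 0. 0 < \<sigma> \<and> \<sigma> < \<delta>"
      using \<open>\<delta> > 0\<close> unfolding eventually_at_right_field by (intro exI[of _ "\<delta>"]) simp
    then show "\<forall>\<^sub>F \<sigma> in at_right 0. profile \<xi> (d x + 1 * \<sigma>) \<le> u x + c"
      by eventually_elim (use compare x in force)
  qed simp
  with \<open>\<delta> > 0\<close> show ?thesis unfolding eventually_boundary by blast
qed

lemma eventually_const_over_profile_less:
  assumes "\<xi> > 0" "e > 0"
  shows "\<forall>\<^sub>F x in bd_filter \<Omega>. 0 < profile \<xi> (d x) \<and> c / profile \<xi> (d x) < e"
proof -
  have top: "filterlim (\<lambda>x. profile \<xi> (d x)) at_top (bd_filter \<Omega>)"
    by (rule filterlim_compose[OF profile_at_top[OF assms(1)] filterlim_dist_bd])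
  have "((\<lambda>x. c / profile \<xi> (d x)) \<longlongrightarrow> 0) (bd_filter \<Omega>)"
    by (rule real_tendsto_divide_at_top[OF tendsto_const top])
  then have "\<forall>\<^sub>F x in bd_filter \<Omega>. c / profile \<xi> (d x) < e" by (rule order_tendstoD) (rule assms(2))
  moreover have "\<forall>\<^sub>F x in bd_filter \<Omega>. 0 < profile \<xi> (d x)"
    using top by (simp add: filterlim_at_top_dense)
  ultimately show ?thesis by (rule eventually_conj[rotated])
qed

lemma Limsup_over_profile_le_1:
  assumes "\<xi> > 0" and critical: "\<xi> ^ (k + 1) * (\<theta> * L0 k \<Omega>) = bl"
  shows "Limsup (bd_filter \<Omega>) (\<lambda>x. ereal (u x / profile \<xi> (d x))) \<le> 1"
  unfolding Limsup_le_iff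
proof (intro allI impI)
  fix y :: ereal assume "1 < y"
  then obtain r where r: "1 < r" "ereal r < y" using ereal_dense2[of 1 y] by auto
  have "((\<lambda>\<zeta>. (\<xi> / \<zeta>) powr (Cf + 1)) \<longlongrightarrow> (\<xi> / \<xi>) powr (Cf + 1)) (at_left \<xi>)"
    using assms by (intro tendsto_intros) auto
  then have "\<forall>\<^sub>F \<zeta> in at_left \<xi>. (\<xi> / \<zeta>) powr (Cf + 1) < r"
    using r assms by (intro order_tendstoD) simp_all
  moreover have "\<forall>\<^sub>F \<zeta> in at_left \<xi>. \<zeta> \<in> {0<..<\<xi>}" using \<open>\<xi> > 0\<close> by (rule eventually_at_left_real)
  ultimately have "\<forall>\<^sub>F \<zeta> in at_left \<xi>. 0 < \<zeta> \<and> \<zeta> < \<xi> \<and> (\<xi> / \<zeta>) powr (Cf + 1) < r"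
    by eventually_elim auto
  then obtain \<zeta> where \<zeta>: "0 < \<zeta>" "\<zeta> < \<xi>" "(\<xi> / \<zeta>) powr (Cf + 1) < r"
    by (auto dest: eventually_happens)
  have "\<zeta> ^ (k + 1) * (\<theta> * L0 k \<Omega>) < bl"
    unfolding critical[symmetric]
      using \<zeta> \<theta>_pos L0_pos by (intro mult_strict_right_mono power_strict_mono) auto
  then obtain c where barrier: "\<forall>\<^sub>F x in bd_filter \<Omega>. u x \<le> profile \<zeta> (d x) + c"
    using upper_barrier_estimate[OF \<zeta>(1)] by blast
  let ?q = "(\<xi> / \<zeta>) powr (Cf + 1)"
  have "\<forall>\<^sub>F x in bd_filter \<Omega>. profile \<zeta> (d x) \<le> ?q * profile \<xi> (d x)"
    by (rule eventually_bd_filter_dist_bd[OF profile_le_scaled]) (use \<zeta> in auto)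
  moreover have "0 < r - ?q" using \<zeta>(3) by simp
  note barrier eventually_const_over_profile_less[OF \<open>\<xi> > 0\<close> this, of c]
  ultimately show "\<forall>\<^sub>F x in bd_filter \<Omega>. ereal (u x / profile \<xi> (d x)) < y"
  proof eventually_elim
    case (elim x)
    have "u x / profile \<xi> (d x) \<le> ?q + c / profile \<xi> (d x)"
      using elim \<zeta> by (simp add: field_simps)
    also have "\<dots> < r" using elim \<zeta> by simp
    finally have "ereal (u x / profile \<xi> (d x)) < ereal r" by simp
    then show ?case using r(2) by (rule less_trans)
  qed
qed

lemma Liminf_over_profile_ge_1:
  assumes "\<xi> > 0" and critical: "\<xi> ^ (k + 1) * (\<theta> * l0 k \<Omega>) = bu"
  shows "1 \<le> Liminf (bd_filter \<Omega>) (\<lambda>x. ereal (u x / profile \<xi> (d x)))"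
  unfolding le_Liminf_iff
proof (intro allI impI)
  fix y :: ereal assume "y < 1"
  then obtain r where r: "r < 1" "y < ereal r" using ereal_dense2[of y 1] by auto
  have "((\<lambda>\<zeta>. (\<xi> / \<zeta>) powr (Cf + 1)) \<longlongrightarrow> (\<xi> / \<xi>) powr (Cf + 1)) (at_right \<xi>)"
    using assms by (intro tendsto_intros) auto
  then have "\<forall>\<^sub>F \<zeta> in at_right \<xi>. r < (\<xi> / \<zeta>) powr (Cf + 1)"
    using r assms by (intro order_tendstoD) simp_all
  with eventually_at_right_less[of \<xi>]
  have "\<forall>\<^sub>F \<zeta> in at_right \<xi>. \<xi> < \<zeta> \<and> r < (\<xi> / \<zeta>) powr (Cf + 1)" by eventually_elim simp
  then obtain \<zeta> where \<zeta>: "\<xi> < \<zeta>" "r < (\<xi> / \<zeta>) powr (Cf + 1)" by (auto dest: eventually_happens)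
  have "\<zeta> > 0" using \<zeta>(1) \<open>\<xi> > 0\<close> by simp
  have "bu < \<zeta> ^ (k + 1) * (\<theta> * l0 k \<Omega>)"
    unfolding critical[symmetric] using \<zeta> \<open>\<xi> > 0\<close> \<theta>_pos l0_pos
    by (intro mult_strict_right_mono power_strict_mono) auto
  then obtain c where barrier: "\<forall>\<^sub>F x in bd_filter \<Omega>. profile \<zeta> (d x) \<le> u x + c"
    using lower_barrier_estimate[OF \<open>\<zeta> > 0\<close>] by blast
  let ?q = "(\<xi> / \<zeta>) powr (Cf + 1)"
  have "\<forall>\<^sub>F x in bd_filter \<Omega>. profile \<xi> (d x) \<le> (\<zeta> / \<xi>) powr (Cf + 1) * profile \<zeta> (d x)"
    by (rule eventually_bd_filter_dist_bd[OF profile_le_scaled]) (use \<zeta> \<open>\<xi> > 0\<close> in auto)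
  moreover have "0 < ?q - r" using \<zeta>(2) by simp
  note barrier eventually_const_over_profile_less[OF \<open>\<xi> > 0\<close> this, of c]
  ultimately show "\<forall>\<^sub>F x in bd_filter \<Omega>. y < ereal (u x / profile \<xi> (d x))"
  proof eventually_elim
    case (elim x)
    have "?q * profile \<xi> (d x) \<le> ?q * ((\<zeta> / \<xi>) powr (Cf + 1) * profile \<zeta> (d x))"
      using elim by (intro mult_left_mono) auto
    also have "\<dots> = profile \<zeta> (d x)" using \<open>\<xi> > 0\<close> \<open>\<zeta> > 0\<close> by (simp add: powr_divide)
    finally have "?q * profile \<xi> (d x) \<le> u x + c" using elim by simp
    have "r < ?q - c / profile \<xi> (d x)" using elim \<zeta> by simp
    also have "\<dots> \<le> u x / profile \<xi> (d x)"
      using elim \<open>?q * profile \<xi> (d x) \<le> u x + c\<close>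
      by (simp add: diff_le_eq pos_le_divide_eq flip: add_divide_distrib)
    finally have "ereal r < ereal (u x / profile \<xi> (d x))" by simp
    with r(2) show ?case by (rule less_trans)
  qed
qed

end

theorem theorem1p2:
  fixes \<Omega> :: "(real^'n) set"
    and k :: nat
    and f :: "real \<Rightarrow> real"
    and b :: "real^'n \<Rightarrow> real"
    and m M :: "real \<Rightarrow> real"
    and \<delta>0 bl bu Cf Cm :: real
    and u :: "real^'n \<Rightarrow> real"
  assumes n2: "CARD('n) \<ge> 2"
    and k_range: "1 \<le> k" "k \<le> CARD('n)"
    and dom: "open \<Omega>" "connected \<Omega>" "bounded \<Omega>" "\<Omega> \<noteq> {}"
    and conv: "strictly_convex_k (k - 1) \<Omega>"
    and bdry: "C31_boundary \<Omega>"
    \<comment> \<open>(f1)\<close>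
    and f1: "f C1_differentiable_on {0<..}" "\<forall>s>0. f s > 0" "mono_on {0<..} f"
    \<comment> \<open>(f2)\<close>
    and f2: "\<forall>s>0. (\<lambda>\<tau>. 1 / Hf k f \<tau>) integrable_on {s..}"
    \<comment> \<open>(f3)\<close>
    and f3: "Cf > 0" "((\<lambda>s. deriv (Hf k f) s * Phi k f s) \<longlongrightarrow> Cf) at_top"
    \<comment> \<open>(b1)\<close>
    and b1: "C11_closure \<Omega> b" "\<forall>x\<in>\<Omega>. b x > 0"
    \<comment> \<open>(b2)\<close>
    and b2: "\<delta>0 > 0" "m C1_differentiable_on {0<..<\<delta>0}"
      "\<forall>t\<in>{0<..<\<delta>0}. m t > 0" "mono_on {0<..<\<delta>0} m"
      "bl > 0" "bu > 0"
      "Liminf (bd_filter \<Omega>) (\<lambda>x. ereal (b x / m (dist_bd \<Omega> x) ^ (k + 1))) = ereal bl"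
      "Limsup (bd_filter \<Omega>) (\<lambda>x. ereal (b x / m (dist_bd \<Omega> x) ^ (k + 1))) = ereal bu"
      "\<forall>t\<in>{0<..<\<delta>0}. m integrable_on {0..t}"
      "\<forall>t\<in>{0<..<\<delta>0}. M t = integral {0..t} m"
      "Cm \<ge> 0" "((\<lambda>t. deriv (\<lambda>s. M s / m s) t) \<longlongrightarrow> Cm) (at_right 0)"
    and Cfm: "Cf > 1 - Cm"
    \<comment> \<open>u is a positive viscosity solution blowing up at the boundary\<close>
    and u_pos: "\<forall>x\<in>\<Omega>. u x > 0"
    and u_sol: "visc_sol k b f \<Omega> u"
    and u_bd: "filterlim u at_top (bd_filter \<Omega>)"
  shows
    "let xil = (bl / (L0 k \<Omega> * (1 - (1 - Cm) / Cf))) powr (1 / real (k + 1));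
         xiu = (bu / (l0 k \<Omega> * (1 - (1 - Cm) / Cf))) powr (1 / real (k + 1))
     in 1 \<le> Liminf (bd_filter \<Omega>) (\<lambda>x. ereal (u x / varphi k f (xiu * M (dist_bd \<Omega> x))))
      \<and> Limsup (bd_filter \<Omega>) (\<lambda>x. ereal (u x / varphi k f (xil * M (dist_bd \<Omega> x)))) \<le> 1"
proof -
  have f_cont: "continuous_on {0<..} f" by (rule C1_differentiable_imp_continuous_on[OF f1(1)])
  have m_differentiable: "m differentiable (at t)" if "0 < t" "t < \<delta>0" for t
    using b2(2) that by (auto simp: C1_differentiable_on_eq)
  interpret large_solution k f Cf m M \<delta>0 Cm \<Omega> b u bl bu
    by unfold_locales (use assms f_cont m_differentiable in auto)
  show ?thesis
    unfolding Let_def \<theta>_def[symmetric] profile_def[symmetric]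
    using powr_root_scale[OF bl_pos mult_pos_pos[OF L0_pos \<theta>_pos]]
      powr_root_scale[OF bu_pos mult_pos_pos[OF l0_pos \<theta>_pos]]
    by (simp add: Liminf_over_profile_ge_1 Limsup_over_profile_le_1 mult.commute)
qed

end
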